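(* Consider $M=H_3\times\mathbb{T}^3$ with the $\mathcal{S}$-structure $(\phi,\xi_i,\eta_i,h)$ of CR-codimension 4 and the connection $\nabla$ described in the context. The holonomy algebra $\mathfrak{hol}(\nabla)$ of $\nabla$ is abelian and 1-dimensional, $\mathfrak{hol}(\nabla)\cong\mathfrak{so}(2)$, and moreover the curvature tensor $R^{\nabla}$ is $\nabla$-parallel, $\nabla R^{\nabla}=0$.
   Context: Let $H_3$ be the 3-dimensional Heisenberg group, with left-invariant frame $X,Y,Z$ whose only non-zero bracket is $[X,Y]=Z$, and let $\mathbb{T}^3$ be the 3-torus with a left-invariant metric $g_2$ and a $g_2$-orthonormal left-invariant frame $\zeta_1,\zeta_2,\zeta_3$. On $M=H_3\times\mathbb{T}^3$ take the left-invariant product metric $h=g_1\oplus g_2$, where $g_1$ is the left-invariant metric on $H_3$ with $X,Y,Z$ mutually orthogonal, $g_1(X,X)=g_1(Y,Y)=\frac12$, $g_1(Z,Z)=4$. Choose left-invariant $h$-orthonormal vector fields $\xi_1,\dots,\xi_4$ in the commutative Lie algebra $\langle Z,\zeta_1,\zeta_2,\zeta_3\rangle$ with $Z=\sum_{i=1}^4\xi_i$. Let $\eta_i=h(\xi_i,\cdot)$, and let $\phi$ be the left-invariant endomorphism with $\phi(X)=Y$, $\phi(Y)=-X$, $\phi(\xi_i)=0$. Put $F(U,V)=h(U,\phi V)$. This is an $\mathcal{S}$-manifold (a normal metric $f$-manifold with $2F=d\eta_i$ for all $i=1,\dots,4$, where $d\eta(U,V)=U\eta(V)-V\eta(U)-\eta([U,V])$).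 Let $\nabla=\nabla^h+\frac12T$, i.e. $h(\nabla_UV,W)=h(\nabla^h_UV,W)+\frac12T(U,V,W)$, where $\nabla^h$ is the Levi-Civita connection of $h$ and $T=2(\eta_1+\cdots+\eta_4)\wedge F$, with $(\eta\wedge F)(U,V,W)=\eta(U)F(V,W)-\eta(V)F(U,W)+\eta(W)F(U,V)$. This is the unique connection with totally skew-symmetric torsion making $h,\phi,\xi_i,\eta_i$ parallel. $R^\nabla(U,V)W=\nabla_U\nabla_VW-\nabla_V\nabla_UW-\nabla_{[U,V]}W$. *)

theory Defs
  imports "HOL-Analysis.Analysis"
begin

text \<open>
  Manifolds are represented as embedded submanifolds \<open>S\<close> of a Euclidean space \<open>'a\<close>. A vector
  field on \<open>S\<close> is a function \<open>'a \<Rightarrow> 'a\<close> of which only the values on \<open>S\<close> matter, and likewise for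
  metrics, endomorphism fields and differential forms.
\<close>

section \<open>Calculus on embedded submanifolds\<close>

text \<open>\<open>C\<^sup>k\<close> on an open set \<open>W\<close>.\<close>

primrec Ck_on :: "nat \<Rightarrow> 'a::euclidean_space set \<Rightarrow> ('a \<Rightarrow> 'b::real_normed_vector) \<Rightarrow> bool" where
  "Ck_on 0 W f \<longleftrightarrow> continuous_on W f"
| "Ck_on (Suc k) W f \<longleftrightarrow>
     (\<forall>x\<in>W. f differentiable (at x)) \<and> (\<forall>v. Ck_on k W (\<lambda>x. frechet_derivative f (at x) v))"

text \<open>Smoothness on an arbitrary subset: locally the restriction of a \<open>C\<^sup>\<infinity>\<close> map on an open set.\<close>

definition smooth_map :: "'a::euclidean_space set \<Rightarrow> ('a \<Rightarrow> 'b::real_normed_vector) \<Rightarrow> bool" where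
  "smooth_map S f \<longleftrightarrow>
     (\<forall>p\<in>S. \<exists>W g. open W \<and> p \<in> W \<and> (\<forall>k. Ck_on k W g) \<and> (\<forall>x\<in>W \<inter> S. g x = f x))"

definition curve_through :: "'a::euclidean_space set \<Rightarrow> 'a \<Rightarrow> 'a \<Rightarrow> (real \<Rightarrow> 'a) \<Rightarrow> bool" where
  "curve_through S p v c \<longleftrightarrow>
     (\<forall>t. c t \<in> S) \<and> c 0 = p \<and> (c has_vector_derivative v) (at 0)"

definition tangent_space :: "'a::euclidean_space set \<Rightarrow> 'a \<Rightarrow> 'a set" where
  "tangent_space S p = {v. \<exists>c. curve_through S p v c}"

text \<open>The derivative at \<open>p\<close> of a map \<open>f\<close> on \<open>S\<close> in the tangent direction \<open>v\<close>.\<close>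

definition tangent_deriv ::
  "'a::euclidean_space set \<Rightarrow> ('a \<Rightarrow> 'b::real_normed_vector) \<Rightarrow> 'a \<Rightarrow> 'a \<Rightarrow> 'b" where
  "tangent_deriv S f p v =
     (THE d. \<forall>c. curve_through S p v c \<longrightarrow> ((\<lambda>t. f (c t)) has_vector_derivative d) (at 0))"

definition vector_field :: "'a::euclidean_space set \<Rightarrow> ('a \<Rightarrow> 'a) \<Rightarrow> bool" where
  "vector_field S U \<longleftrightarrow> smooth_map S U \<and> (\<forall>p\<in>S. U p \<in> tangent_space S p)"

text \<open>For tangential fields the commutator of derivations \<open>f \<mapsto> U (V f) - V (U f)\<close> is given by the
  derivation of the field \<open>D\<^sub>U V - D\<^sub>V U\<close>.\<close>

definition lie_bracket ::
  "'a::euclidean_space set \<Rightarrow> ('a \<Rightarrow> 'a) \<Rightarrow> ('a \<Rightarrow> 'a) \<Rightarrow> 'a \<Rightarrow> 'a" where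
  "lie_bracket S U V p = tangent_deriv S V p (U p) - tangent_deriv S U p (V p)"

definition riemannian_metric ::
  "'a::euclidean_space set \<Rightarrow> ('a \<Rightarrow> 'a \<Rightarrow> 'a \<Rightarrow> real) \<Rightarrow> bool" where
  "riemannian_metric S g \<longleftrightarrow>
     (\<forall>p\<in>S. \<forall>u\<in>tangent_space S p. \<forall>v\<in>tangent_space S p.
        g p u v = g p v u \<and> (u \<noteq> 0 \<longrightarrow> g p u u > 0) \<and>
        (\<forall>w\<in>tangent_space S p. \<forall>a b. g p (a *\<^sub>R u + b *\<^sub>R v) w = a * g p u w + b * g p v w)) \<and>
     (\<forall>U V. vector_field S U \<longrightarrow> vector_field S V \<longrightarrow> smooth_map S (\<lambda>p. g p (U p) (V p)))"


section \<open>Affine connections\<close>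

type_synonym 'a conn = "('a \<Rightarrow> 'a) \<Rightarrow> ('a \<Rightarrow> 'a) \<Rightarrow> 'a \<Rightarrow> 'a"

definition affine_connection :: "'a::euclidean_space set \<Rightarrow> 'a conn \<Rightarrow> bool" where
  "affine_connection S D \<longleftrightarrow>
     (\<forall>U V. vector_field S U \<longrightarrow> vector_field S V \<longrightarrow> vector_field S (D U V)) \<and>
     (\<forall>U U' V. vector_field S U \<longrightarrow> vector_field S U' \<longrightarrow> vector_field S V \<longrightarrow>
        (\<forall>p\<in>S. D (\<lambda>q. U q + U' q) V p = D U V p + D U' V p \<and>
               D V (\<lambda>q. U q + U' q) p = D V U p + D V U' p)) \<and>
     (\<forall>f U V. smooth_map S f \<longrightarrow> vector_field S U \<longrightarrow> vector_field S V \<longrightarrow>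
        (\<forall>p\<in>S. D (\<lambda>q. f q *\<^sub>R U q) V p = f p *\<^sub>R D U V p \<and>
               D U (\<lambda>q. f q *\<^sub>R V q) p = tangent_deriv S f p (U p) *\<^sub>R V p + f p *\<^sub>R D U V p))"

definition levi_civita ::
  "'a::euclidean_space set \<Rightarrow> ('a \<Rightarrow> 'a \<Rightarrow> 'a \<Rightarrow> real) \<Rightarrow> 'a conn \<Rightarrow> bool" where
  "levi_civita S g D \<longleftrightarrow> affine_connection S D \<and>
     (\<forall>U V. vector_field S U \<longrightarrow> vector_field S V \<longrightarrow>
        (\<forall>p\<in>S. D U V p - D V U p = lie_bracket S U V p)) \<and>
     (\<forall>U V W. vector_field S U \<longrightarrow> vector_field S V \<longrightarrow> vector_field S W \<longrightarrow>
        (\<forall>p\<in>S. tangent_deriv S (\<lambda>q. g q (V q) (W q)) p (U p) =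
                 g p (D U V p) (W p) + g p (V p) (D U W p)))"

definition curvature ::
  "'a::euclidean_space set \<Rightarrow> 'a conn \<Rightarrow> ('a \<Rightarrow> 'a) \<Rightarrow> ('a \<Rightarrow> 'a) \<Rightarrow> ('a \<Rightarrow> 'a) \<Rightarrow> 'a \<Rightarrow> 'a" where
  "curvature S D U V W p = D U (D V W) p - D V (D U W) p - D (lie_bracket S U V) W p"

definition parallel_curvature :: "'a::euclidean_space set \<Rightarrow> 'a conn \<Rightarrow> bool" where
  "parallel_curvature S D \<longleftrightarrow>
     (\<forall>A U V W. vector_field S A \<longrightarrow> vector_field S U \<longrightarrow> vector_field S V \<longrightarrow> vector_field S W \<longrightarrow>
        (\<forall>p\<in>S. D A (curvature S D U V W) p - curvature S D (D A U) V W p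
                 - curvature S D U (D A V) W p - curvature S D U V (D A W) p = 0))"


section \<open>Holonomy\<close>

text \<open>\<open>\<nabla>\<^sub>v W\<close> for a single tangent vector \<open>v\<close> at \<open>p\<close>.\<close>

definition covariant_deriv_at ::
  "'a::euclidean_space set \<Rightarrow> 'a conn \<Rightarrow> 'a \<Rightarrow> 'a \<Rightarrow> ('a \<Rightarrow> 'a) \<Rightarrow> 'a" where
  "covariant_deriv_at S D p v W = (THE w. \<forall>U. vector_field S U \<and> U p = v \<longrightarrow> D U W p = w)"

text \<open>
  If \<open>V = (\<Sum>j. a\<^sub>j W\<^sub>j)\<close> along \<open>\<gamma>\<close> with vector fields \<open>W\<^sub>j\<close> on \<open>S\<close>, then the covariant derivative
  of \<open>V\<close> along \<open>\<gamma>\<close> is \<open>(\<Sum>j. a\<^sub>j' W\<^sub>j + a\<^sub>j \<nabla>\<^bsub>\<gamma>'\<^esub> W\<^sub>j)\<close>, independently of how \<open>V\<close> is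
  written in this form. The finite set \<open>K\<close> accounts for the break points of \<open>\<gamma>\<close>.
\<close>

definition parallel_along ::
  "'a::euclidean_space set \<Rightarrow> 'a conn \<Rightarrow> (real \<Rightarrow> 'a) \<Rightarrow> (real \<Rightarrow> 'a) \<Rightarrow> bool" where
  "parallel_along S D \<gamma> V \<longleftrightarrow>
     (\<exists>(n::nat) W a K. finite K \<and>
        (\<forall>j<n. vector_field S (W j) \<and> continuous_on {0..1} (a j)) \<and>
        (\<forall>t\<in>{0..1}. V t = (\<Sum>j<n. a j t *\<^sub>R W j (\<gamma> t))) \<and>
        (\<forall>t\<in>{0..1} - K. \<exists>\<gamma>' a'. (\<gamma> has_vector_derivative \<gamma>') (at t) \<and>
           (\<forall>j<n. (a j has_real_derivative a' j) (at t)) \<and>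
           (\<Sum>j<n. a' j *\<^sub>R W j (\<gamma> t) + a j t *\<^sub>R covariant_deriv_at S D (\<gamma> t) \<gamma>' (W j)) = 0))"

definition piecewise_smooth_loop :: "'a::euclidean_space set \<Rightarrow> 'a \<Rightarrow> (real \<Rightarrow> 'a) \<Rightarrow> bool" where
  "piecewise_smooth_loop S p \<gamma> \<longleftrightarrow>
     (\<forall>t\<in>{0..1}. \<gamma> t \<in> S) \<and> \<gamma> 0 = p \<and> \<gamma> 1 = p \<and>
     (\<exists>(n::nat) s. s 0 = 0 \<and> s n = 1 \<and>
        (\<forall>i<n. s i < s (Suc i) \<and> smooth_map {s i..s (Suc i)} \<gamma>))"

text \<open>An endomorphism of the tangent space is identified with its extension by zero on the
  orthogonal complement in the ambient space, so that \<open>End(T\<^sub>p S)\<close> becomes a linear subspace, closed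
  under composition, of the bounded linear operators on \<open>'a\<close>.\<close>

definition tangent_endos :: "'a::euclidean_space set \<Rightarrow> 'a \<Rightarrow> ('a \<Rightarrow>\<^sub>L 'a) set" where
  "tangent_endos S p =
     {A. (\<forall>v\<in>tangent_space S p. blinfun_apply A v \<in> tangent_space S p) \<and>
         (\<forall>v. (\<forall>u\<in>tangent_space S p. u \<bullet> v = 0) \<longrightarrow> blinfun_apply A v = 0)}"

definition holonomy_group :: "'a::euclidean_space set \<Rightarrow> 'a conn \<Rightarrow> 'a \<Rightarrow> ('a \<Rightarrow>\<^sub>L 'a) set" where
  "holonomy_group S D p =
     {B \<in> tangent_endos S p. \<exists>\<gamma>. piecewise_smooth_loop S p \<gamma> \<and>
        (\<forall>v\<in>tangent_space S p.
           \<exists>V. parallel_along S D \<gamma> V \<and> V 0 = v \<and> V 1 = blinfun_apply B v)}"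

text \<open>The Lie algebra of the holonomy group: all \<open>A\<close> with \<open>exp (t A)\<close> in the group for every real
  \<open>t\<close>; the exponential is that of \<open>End(T\<^sub>p S)\<close>, hence its series is evaluated on tangent vectors.\<close>

definition holonomy_algebra :: "'a::euclidean_space set \<Rightarrow> 'a conn \<Rightarrow> 'a \<Rightarrow> ('a \<Rightarrow>\<^sub>L 'a) set" where
  "holonomy_algebra S D p =
     {A \<in> tangent_endos S p. \<forall>t::real. \<exists>B\<in>holonomy_group S D p. \<forall>v\<in>tangent_space S p.
        (\<lambda>n. (t ^ n / fact n) *\<^sub>R (blinfun_apply A ^^ n) v) sums blinfun_apply B v}"

definition blinfun_commutator ::
  "('a::real_normed_vector \<Rightarrow>\<^sub>L 'a) \<Rightarrow> ('a \<Rightarrow>\<^sub>L 'a) \<Rightarrow> ('a \<Rightarrow>\<^sub>L 'a)" where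
  "blinfun_commutator A B = (A o\<^sub>L B) - (B o\<^sub>L A)"

definition lie_algebra_iso ::
  "'a::real_vector set \<Rightarrow> ('a \<Rightarrow> 'a \<Rightarrow> 'a) \<Rightarrow> 'b::real_vector set \<Rightarrow> ('b \<Rightarrow> 'b \<Rightarrow> 'b) \<Rightarrow> bool" where
  "lie_algebra_iso L br L' br' \<longleftrightarrow>
     (\<exists>f. bij_betw f L L' \<and>
        (\<forall>x\<in>L. \<forall>y\<in>L. f (x + y) = f x + f y \<and> f (br x y) = br' (f x) (f y)) \<and>
        (\<forall>x\<in>L. \<forall>a::real. f (a *\<^sub>R x) = a *\<^sub>R f x))"

definition so2 :: "(real^2^2) set" where
  "so2 = {A. transpose A = - A}"

definition matrix_commutator :: "real^'n^'n \<Rightarrow> real^'n^'n \<Rightarrow> real^'n^'n" where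
  "matrix_commutator A B = A ** B - B ** A"


section \<open>Left-invariant tensors on a Lie group\<close>

text \<open>Here \<open>m\<close> is the multiplication of the Lie group \<open>S\<close>.\<close>

definition left_invariant_field ::
  "'a::euclidean_space set \<Rightarrow> ('a \<Rightarrow> 'a \<Rightarrow> 'a) \<Rightarrow> ('a \<Rightarrow> 'a) \<Rightarrow> bool" where
  "left_invariant_field S m U \<longleftrightarrow> vector_field S U \<and>
     (\<forall>q\<in>S. \<forall>p\<in>S. tangent_deriv S (m q) p (U p) = U (m q p))"

definition left_invariant_frame ::
  "'a::euclidean_space set \<Rightarrow> ('a \<Rightarrow> 'a \<Rightarrow> 'a) \<Rightarrow> ('a \<Rightarrow> 'a) list \<Rightarrow> bool" where
  "left_invariant_frame S m Us \<longleftrightarrow>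
     (\<forall>U\<in>set Us. left_invariant_field S m U) \<and>
     (\<forall>p\<in>S. distinct (map (\<lambda>U. U p) Us) \<and> independent (set (map (\<lambda>U. U p) Us)) \<and>
             span (set (map (\<lambda>U. U p) Us)) = tangent_space S p)"

definition left_invariant_metric ::
  "'a::euclidean_space set \<Rightarrow> ('a \<Rightarrow> 'a \<Rightarrow> 'a) \<Rightarrow> ('a \<Rightarrow> 'a \<Rightarrow> 'a \<Rightarrow> real) \<Rightarrow> bool" where
  "left_invariant_metric S m g \<longleftrightarrow> riemannian_metric S g \<and>
     (\<forall>q\<in>S. \<forall>p\<in>S. \<forall>u\<in>tangent_space S p. \<forall>v\<in>tangent_space S p.
        g (m q p) (tangent_deriv S (m q) p u) (tangent_deriv S (m q) p v) = g p u v)"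

definition left_invariant_endo ::
  "'a::euclidean_space set \<Rightarrow> ('a \<Rightarrow> 'a \<Rightarrow> 'a) \<Rightarrow> ('a \<Rightarrow> 'a \<Rightarrow> 'a) \<Rightarrow> bool" where
  "left_invariant_endo S m \<phi> \<longleftrightarrow>
     (\<forall>p\<in>S. \<forall>u\<in>tangent_space S p. \<phi> p u \<in> tangent_space S p \<and>
        (\<forall>v\<in>tangent_space S p. \<forall>a b. \<phi> p (a *\<^sub>R u + b *\<^sub>R v) = a *\<^sub>R \<phi> p u + b *\<^sub>R \<phi> p v) \<and>
        (\<forall>q\<in>S. \<phi> (m q p) (tangent_deriv S (m q) p u) = tangent_deriv S (m q) p (\<phi> p u)))"

definition orthonormal_fields ::
  "'a set \<Rightarrow> ('a \<Rightarrow> 'a \<Rightarrow> 'a \<Rightarrow> real) \<Rightarrow> nat set \<Rightarrow> (nat \<Rightarrow> 'a \<Rightarrow> 'a) \<Rightarrow> bool" where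
  "orthonormal_fields S g I e \<longleftrightarrow>
     (\<forall>p\<in>S. \<forall>i\<in>I. \<forall>j\<in>I. g p (e i p) (e j p) = (if i = j then 1 else 0))"


section \<open>The group \<open>H\<^sub>3 \<times> (S\<^sup>1)\<^sup>3\<close>\<close>

definition heisenberg :: "(real^3^3) set" where
  "heisenberg = {A. A $ 1 $ 1 = 1 \<and> A $ 2 $ 2 = 1 \<and> A $ 3 $ 3 = 1 \<and>
                    A $ 2 $ 1 = 0 \<and> A $ 3 $ 1 = 0 \<and> A $ 3 $ 2 = 0}"

text \<open>The torus is a group under the componentwise multiplication \<open>(*)\<close> of \<open>complex^3\<close>.\<close>

definition torus3 :: "(complex^3) set" where
  "torus3 = {z. \<forall>i. norm (z $ i) = 1}"

type_synonym ambient = "(real^3^3) \<times> (complex^3)"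

definition HT :: "ambient set" where
  "HT = heisenberg \<times> torus3"

definition HT_mult :: "ambient \<Rightarrow> ambient \<Rightarrow> ambient" where
  "HT_mult p q = (fst p ** fst q, snd p * snd q)"

definition lift_H :: "(real^3^3 \<Rightarrow> real^3^3) \<Rightarrow> ambient \<Rightarrow> ambient" where
  "lift_H U p = (U (fst p), 0)"

definition lift_T :: "(complex^3 \<Rightarrow> complex^3) \<Rightarrow> ambient \<Rightarrow> ambient" where
  "lift_T U p = (0, U (snd p))"

definition product_metric ::
  "('a \<Rightarrow> 'a \<Rightarrow> 'a \<Rightarrow> real) \<Rightarrow> ('b \<Rightarrow> 'b \<Rightarrow> 'b \<Rightarrow> real) \<Rightarrow> 'a \<times> 'b \<Rightarrow> 'a \<times> 'b \<Rightarrow> 'a \<times> 'b \<Rightarrow> real" where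
  "product_metric g1 g2 p u v = g1 (fst p) (fst u) (fst v) + g2 (snd p) (snd u) (snd v)"


section \<open>The torsion form of a metric \<open>f\<close>-structure\<close>

definition dual_form :: "('a \<Rightarrow> 'a \<Rightarrow> 'a \<Rightarrow> real) \<Rightarrow> ('a \<Rightarrow> 'a) \<Rightarrow> 'a \<Rightarrow> 'a \<Rightarrow> real" where
  "dual_form h \<xi> p u = h p (\<xi> p) u"

definition fundamental_form ::
  "('a \<Rightarrow> 'a \<Rightarrow> 'a \<Rightarrow> real) \<Rightarrow> ('a \<Rightarrow> 'a \<Rightarrow> 'a) \<Rightarrow> 'a \<Rightarrow> 'a \<Rightarrow> 'a \<Rightarrow> real" where
  "fundamental_form h \<phi> p u v = h p u (\<phi> p v)"

definition wedge_1_2 ::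
  "('a \<Rightarrow> 'a \<Rightarrow> real) \<Rightarrow> ('a \<Rightarrow> 'a \<Rightarrow> 'a \<Rightarrow> real) \<Rightarrow> 'a \<Rightarrow> 'a \<Rightarrow> 'a \<Rightarrow> 'a \<Rightarrow> real" where
  "wedge_1_2 \<eta> F p u v w = \<eta> p u * F p v w - \<eta> p v * F p u w + \<eta> p w * F p u v"

definition torsion_form ::
  "('a \<Rightarrow> 'a \<Rightarrow> 'a \<Rightarrow> real) \<Rightarrow> ('a \<Rightarrow> 'a \<Rightarrow> 'a) \<Rightarrow> (nat \<Rightarrow> 'a \<Rightarrow> 'a) \<Rightarrow> 'a \<Rightarrow> 'a \<Rightarrow> 'a \<Rightarrow> 'a \<Rightarrow> real" where
  "torsion_form h \<phi> \<xi> p u v w =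
     2 * wedge_1_2 (\<lambda>q x. \<Sum>i=1..4. dual_form h (\<xi> i) q x) (fundamental_form h \<phi>) p u v w"

end

theory Submission
  imports Defs
begin

text \<open>
  Write \<open>J X = Y\<close>, \<open>J Y = -X\<close> and \<open>J = 0\<close> on the span of \<open>Z\<close> and the \<open>\<zeta>\<^sub>j\<close>; this is \<open>\<phi>\<close>. The Koszul
  formula shows that the Levi-Civita derivatives of the left-invariant frame
  \<open>X, Y, Z, \<zeta>\<^sub>1, \<zeta>\<^sub>2, \<zeta>\<^sub>3\<close> and half of the torsion form cancel except when one differentiates in the
  direction \<open>Z\<close>, so that
  \<open>\<nabla>\<^sub>U W = (\<Sum>k. U(w\<^sub>k) E\<^sub>k) + \<omega>(U) J W\<close> with \<open>\<omega>(U) = -8 u\<^sub>Z\<close> (lemma \<open>nabla_frame\<close>). The connection is thus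
  the flat connection of the frame, modified by a one-form with values in the rotations of the plane of
  \<open>X\<close> and \<open>Y\<close>. Since all multiples of \<open>J\<close> commute, everything reduces to the scalar form \<open>\<omega>\<close>.

  Curvature: \<open>R(U,V)W = d\<omega>(U,V) J W\<close> (lemma \<open>curvature_formula\<close>), and \<open>[X,Y] = Z\<close> gives
  \<open>d\<omega>(U,V) = 8 (u\<^sub>X v\<^sub>Y - u\<^sub>Y v\<^sub>X)\<close> (lemma \<open>d\<omega>_area\<close>). Both \<open>J\<close> and the area form of the plane are invariant
  under rotations of the plane, hence parallel, and so is \<open>R\<close> (lemma \<open>parallel_curvatureI\<close>).

  Holonomy: parallel transport keeps the components along \<open>Z, \<zeta>\<^sub>1, \<zeta>\<^sub>2, \<zeta>\<^sub>3\<close> and the length of the component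
  in the plane. Differentiating these conserved quantities along \<open>exp (t A)\<close> leaves only multiples of \<open>J\<close> for
  an element \<open>A\<close> of the holonomy algebra (lemma \<open>holonomy_algebra_multiple\<close>). Conversely a loop \<open>\<gamma>\<close>
  rotates the plane by an angle which is, up to sign, the integral of \<open>\<omega>\<close> over \<open>\<gamma>\<close>. As \<open>\<omega>\<close> is not closed
  there are loops realising every angle (lemma \<open>turning_loop_exists\<close>), so the holonomy group contains
  \<open>exp (t J)\<close> for all \<open>t\<close> and its Lie algebra is the line spanned by \<open>J\<close>.
\<close>

section \<open>Smooth maps\<close>

lemmas frechet_derivative_worksI = iffD1[OF frechet_derivative_works]

lemma Ck_on_subset: "Ck_on k W f \<Longrightarrow> W' \<subseteq> W \<Longrightarrow> Ck_on k W' f"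
  by (induction k arbitrary: f) (auto intro: continuous_on_subset)

lemma Ck_on_SucD: "Ck_on (Suc k) W f \<Longrightarrow> Ck_on k W f"
proof (induction k arbitrary: f)
  case 0
  then show ?case
    by (auto intro!: continuous_at_imp_continuous_on differentiable_imp_continuous_within)
next
  case (Suc k)
  from Suc.prems have d: "\<forall>x\<in>W. f differentiable (at x)"
    and "\<And>v. Ck_on (Suc k) W (\<lambda>x. frechet_derivative f (at x) v)"
    unfolding Ck_on.simps(2)[of "Suc k"] by blast+
  from this(2)[THEN Suc.IH] d show ?case by (simp only: Ck_on.simps(2) simp_thms)
qed

lemma frechet_derivative_cong_open:
  assumes "open W" "x \<in> W" "\<And>y. y \<in> W \<Longrightarrow> f y = g y"
  shows "frechet_derivative f (at x) = frechet_derivative g (at x)"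
proof -
  have "(f has_derivative D) (at x) \<longleftrightarrow> (g has_derivative D) (at x)" for D
    using assms by (metis has_derivative_transform_within_open)
  then show ?thesis by (simp add: frechet_derivative_def)
qed

lemma Ck_on_cong:
  fixes f g :: "'a::euclidean_space \<Rightarrow> 'b::real_normed_vector"
  assumes "open W" "\<And>x. x \<in> W \<Longrightarrow> f x = g x"
  shows "Ck_on k W f \<longleftrightarrow> Ck_on k W g"
  using assms(2)
proof (induction k arbitrary: f g)
  case 0
  then show ?case by (simp cong: continuous_on_cong)
next
  case (Suc k)
  have der: "(f has_derivative D) (at x)"
    if "(g has_derivative D) (at x)" "x \<in> W" "\<And>x. x \<in> W \<Longrightarrow> f x = g x" for x D f and g :: "'a \<Rightarrow> 'b"
    by (rule has_derivative_transform_within_open[OF that(1) assms(1) that(2)]) (simp add: that(3))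
  have "f differentiable (at x) \<longleftrightarrow> g differentiable (at x)" if "x \<in> W" for x
    unfolding differentiable_def
    using der[OF _ that, of g _ f] der[OF _ that, of f _ g] Suc.prems by metis
  moreover have "Ck_on k W (\<lambda>x. frechet_derivative f (at x) v) \<longleftrightarrow>
      Ck_on k W (\<lambda>x. frechet_derivative g (at x) v)" for v
    using frechet_derivative_cong_open[OF assms(1) _ Suc.prems] by (intro Suc.IH) auto
  ultimately show ?case by simp
qed

lemma Ck_on_const: "Ck_on k W (\<lambda>x. c)"
  by (induction k arbitrary: c) auto

lemma Ck_on_add:
  assumes "open W" "Ck_on k W f" "Ck_on k W g"
  shows "Ck_on k W (\<lambda>x. f x + g x)"
  using assms(2,3)
proof (induction k arbitrary: f g)
  case 0
  then show ?case by (simp add: continuous_on_add)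
next
  case (Suc k)
  have "frechet_derivative (\<lambda>x. f x + g x) (at x) v =
      frechet_derivative f (at x) v + frechet_derivative g (at x) v" if "x \<in> W" for x v
  proof -
    have "((\<lambda>x. f x + g x) has_derivative
        (\<lambda>v. frechet_derivative f (at x) v + frechet_derivative g (at x) v)) (at x)"
      using Suc.prems that by (intro has_derivative_add frechet_derivative_worksI) auto
    from fun_cong[OF frechet_derivative_at[OF this], of v] show ?thesis by simp
  qed
  then have "Ck_on k W (\<lambda>x. frechet_derivative (\<lambda>x. f x + g x) (at x) v)" for v
    using Suc.prems
    by (subst Ck_on_cong[OF assms(1),
          of _ "\<lambda>x. frechet_derivative f (at x) v + frechet_derivative g (at x) v"])
       (simp_all add: Suc.IH)
  moreover have "(\<lambda>x. f x + g x) differentiable at x" if "x \<in> W" for x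
    using Suc.prems that by (intro differentiable_add) auto
  ultimately show ?case by simp
qed

lemma Ck_on_bounded_linear:
  assumes "bounded_linear L"
  shows "Ck_on k W L"
proof (cases k)
  case 0
  then show ?thesis using assms by (simp add: linear_continuous_on)
next
  case (Suc m)
  have "(L has_derivative L) (at x)" for x
    using assms by (rule bounded_linear_imp_has_derivative)
  then have "frechet_derivative L (at x) = L" "L differentiable (at x)" for x
    using frechet_derivative_at[of L L x] differentiableI[of L L "at x"] by auto
  then show ?thesis by (simp add: Suc Ck_on_const)
qed

lemma Ck_on_bilinear:
  assumes "bounded_bilinear B" "open W" "Ck_on k W f" "Ck_on k W g"
  shows "Ck_on k W (\<lambda>x. B (f x) (g x))"
  using assms(3,4)
proof (induction k arbitrary: f g)
  case 0
  then show ?case using bounded_bilinear.continuous_on[OF assms(1)] by simp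
next
  case (Suc k)
  let ?f = "\<lambda>x. frechet_derivative f (at x)" and ?g = "\<lambda>x. frechet_derivative g (at x)"
  have der: "((\<lambda>x. B (f x) (g x)) has_derivative (\<lambda>v. B (f x) (?g x v) + B (?f x v) (g x))) (at x)"
    if "x \<in> W" for x
    using that Suc.prems
    by (intro bounded_bilinear.FDERIV[OF assms(1)] frechet_derivative_worksI) auto
  then have eq: "frechet_derivative (\<lambda>x. B (f x) (g x)) (at x) v = B (f x) (?g x v) + B (?f x v) (g x)"
    if "x \<in> W" for x v
    using fun_cong[OF frechet_derivative_at[OF der[OF that]], of v] by simp
  have "Ck_on k W (\<lambda>x. frechet_derivative (\<lambda>x. B (f x) (g x)) (at x) v)" for v
  proof (subst Ck_on_cong[OF assms(2) eq])
    show "Ck_on k W (\<lambda>x. B (f x) (?g x v) + B (?f x v) (g x))"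
      using Suc.prems Suc.prems[THEN Ck_on_SucD] by (intro Ck_on_add Suc.IH assms(2)) simp_all
  qed auto
  moreover have "(\<lambda>x. B (f x) (g x)) differentiable at x" if "x \<in> W" for x
    using der[OF that] by (auto simp: differentiable_def)
  ultimately show ?case by simp
qed

lemma Ck_on_linear_comp:
  assumes "bounded_linear L" "open W" "Ck_on k W f"
  shows "Ck_on k W (\<lambda>x. L (f x))"
proof -
  \<comment> \<open>\<open>L (f x)\<close> is bilinear in the constant \<open>1\<close> and \<open>f x\<close>.\<close>
  have "bounded_bilinear (\<lambda>(r::real) y. r *\<^sub>R L y)"
    using bounded_bilinear.comp[OF bounded_bilinear_scaleR bounded_linear_ident assms(1)] .
  from Ck_on_bilinear[OF this assms(2) Ck_on_const assms(3), of 1] show ?thesis by simp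
qed

text \<open>The local extension is what makes the calculus of open sets available on \<open>S\<close>.\<close>

lemma smooth_map_extension:
  assumes "smooth_map S f" "p \<in> S"
  shows "\<exists>W g. open W \<and> p \<in> W \<and> (\<forall>k. Ck_on k W g) \<and> (\<forall>x\<in>W \<inter> S. g x = f x)"
  using assms unfolding smooth_map_def by blast

lemma smooth_map_cong:
  assumes "smooth_map S f" "\<And>x. x \<in> S \<Longrightarrow> f x = g x"
  shows "smooth_map S g"
  using assms unfolding smooth_map_def by (metis IntD2)

lemma smooth_map_bounded_linear: "bounded_linear L \<Longrightarrow> smooth_map S L"
  unfolding smooth_map_def
  by (intro ballI exI[of _ UNIV] exI[of _ L]) (simp add: Ck_on_bounded_linear)

lemma smooth_map_const: "smooth_map S (\<lambda>x. c)"
  unfolding smooth_map_def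
  by (intro ballI exI[of _ UNIV] exI[of _ "\<lambda>x. c"]) (simp add: Ck_on_const)

lemma smooth_map_bilinear:
  assumes "bounded_bilinear B" "smooth_map S f" "smooth_map S g"
  shows "smooth_map S (\<lambda>x. B (f x) (g x))"
  unfolding smooth_map_def
proof
  fix p assume p: "p \<in> S"
  obtain W1 f1 where 1: "open W1" "p \<in> W1" "\<forall>k. Ck_on k W1 f1"
      "\<forall>x\<in>W1 \<inter> S. f1 x = f x"
    using smooth_map_extension[OF assms(2) p] by blast
  obtain W2 g1 where 2: "open W2" "p \<in> W2" "\<forall>k. Ck_on k W2 g1"
      "\<forall>x\<in>W2 \<inter> S. g1 x = g x"
    using smooth_map_extension[OF assms(3) p] by blast
  have "Ck_on k (W1 \<inter> W2) (\<lambda>x. B (f1 x) (g1 x))" for k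
  proof (rule Ck_on_bilinear[OF assms(1)])
    show "Ck_on k (W1 \<inter> W2) f1" using 1(3) by (blast intro: Ck_on_subset[OF _ Int_lower1])
    show "Ck_on k (W1 \<inter> W2) g1" using 2(3) by (blast intro: Ck_on_subset[OF _ Int_lower2])
  qed (use 1 2 in blast)
  then show "\<exists>W g'. open W \<and> p \<in> W \<and> (\<forall>k. Ck_on k W g') \<and> (\<forall>x\<in>W \<inter> S. g' x = B (f x) (g x))"
    using 1 2 by (intro exI[of _ "W1 \<inter> W2"] exI[of _ "\<lambda>x. B (f1 x) (g1 x)"]) (simp add: open_Int)
qed

lemma smooth_map_linear_comp:
  assumes "bounded_linear L" "smooth_map S f"
  shows "smooth_map S (\<lambda>x. L (f x))"
  unfolding smooth_map_def
proof
  fix p assume p: "p \<in> S"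
  obtain W g where "open W" "p \<in> W" "\<forall>k. Ck_on k W g"
      "\<forall>x\<in>W \<inter> S. g x = f x"
    using smooth_map_extension[OF assms(2) p] by blast
  moreover from this have "Ck_on k W (\<lambda>x. L (g x))" for k
    using Ck_on_linear_comp[OF assms(1), of W k g] by simp
  ultimately show "\<exists>W g. open W \<and> p \<in> W \<and> (\<forall>k. Ck_on k W g) \<and> (\<forall>x\<in>W \<inter> S. g x = L (f x))"
    by (intro exI[of _ W] exI[of _ "\<lambda>x. L (g x)"]) simp
qed

lemma smooth_map_add:
  assumes "smooth_map S f" "smooth_map S g"
  shows "smooth_map S (\<lambda>x. f x + g x)"
  unfolding smooth_map_def
proof
  fix p assume p: "p \<in> S"
  obtain W1 f1 where 1: "open W1" "p \<in> W1" "\<forall>k. Ck_on k W1 f1"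
      "\<forall>x\<in>W1 \<inter> S. f1 x = f x"
    using smooth_map_extension[OF assms(1) p] by blast
  obtain W2 g1 where 2: "open W2" "p \<in> W2" "\<forall>k. Ck_on k W2 g1"
      "\<forall>x\<in>W2 \<inter> S. g1 x = g x"
    using smooth_map_extension[OF assms(2) p] by blast
  have "Ck_on k (W1 \<inter> W2) (\<lambda>x. f1 x + g1 x)" for k
  proof (rule Ck_on_add)
    show "Ck_on k (W1 \<inter> W2) f1" using 1(3) by (blast intro: Ck_on_subset[OF _ Int_lower1])
    show "Ck_on k (W1 \<inter> W2) g1" using 2(3) by (blast intro: Ck_on_subset[OF _ Int_lower2])
  qed (use 1 2 in blast)
  then show "\<exists>W g'. open W \<and> p \<in> W \<and> (\<forall>k. Ck_on k W g') \<and> (\<forall>x\<in>W \<inter> S. g' x = f x + g x)"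
    using 1 2 by (intro exI[of _ "W1 \<inter> W2"] exI[of _ "\<lambda>x. f1 x + g1 x"]) (simp add: open_Int)
qed

lemmas smooth_map_mult = smooth_map_bilinear[OF bounded_bilinear_mult]
lemmas smooth_map_scaleR = smooth_map_bilinear[OF bounded_bilinear_scaleR]

lemma smooth_map_minus:
  fixes f g :: "'a::euclidean_space \<Rightarrow> 'b::real_normed_vector"
  assumes "smooth_map S f" "smooth_map S g"
  shows "smooth_map S (\<lambda>x. f x - g x)"
  using smooth_map_add[OF assms(1) smooth_map_linear_comp[OF bounded_linear_minus[OF bounded_linear_ident] assms(2)]]
  by simp

lemma smooth_map_imp_continuous_on:
  assumes "smooth_map S f"
  shows "continuous_on S f"
  unfolding continuous_on_eq_continuous_within
proof
  fix p assume p: "p \<in> S"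
  obtain W g where W: "open W" "p \<in> W" "\<forall>k. Ck_on k W g" "\<forall>x\<in>W \<inter> S. g x = f x"
    using smooth_map_extension[OF assms p] by blast
  have "continuous_on W g" using W(3) Ck_on.simps(1) by blast
  then have "(g \<longlongrightarrow> g p) (at p)"
    using W(1,2) by (simp add: continuous_on_eq_continuous_at isCont_def)
  then have "(g \<longlongrightarrow> f p) (at p within S)"
    using W(2,4) p by (auto intro: tendsto_within_subset)
  moreover have "\<forall>\<^sub>F x in at p within S. g x = f x"
    unfolding eventually_at_topological using W by blast
  ultimately show "continuous (at p within S) f"
    unfolding continuous_within using tendsto_cong by fast
qed

section \<open>Symmetry of second derivatives\<close>

lemma Ck_on_1_has_derivative:
  assumes "Ck_on (Suc k) W g" "x \<in> W"
  shows "(g has_derivative frechet_derivative g (at x)) (at x)"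
  using assms by (intro frechet_derivative_worksI) simp

text \<open>The mean value theorem, applied first in the direction \<open>u\<close> and then in the direction \<open>v\<close>, turns
  the second difference into a mixed second derivative. The second difference is symmetric in \<open>u\<close> and
  \<open>v\<close>, which is how the next lemma compares the two mixed derivatives.\<close>

lemma second_difference_MVT:
  fixes g :: "'a::euclidean_space \<Rightarrow> real"
  assumes g: "Ck_on 2 (ball x r) g" and h: "h > 0" "h * (norm u + norm v) < r"
  shows "\<exists>s t. 0 < s \<and> s < h \<and> 0 < t \<and> t < h \<and>
    g (x + h *\<^sub>R u + h *\<^sub>R v) - g (x + h *\<^sub>R u) - g (x + h *\<^sub>R v) + g x =
    h * h * frechet_derivative (\<lambda>y. frechet_derivative g (at y) u) (at (x + s *\<^sub>R u + t *\<^sub>R v)) v"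
proof -
  let ?gu = "\<lambda>y. frechet_derivative g (at y) u"
  have inb: "x + s *\<^sub>R u + t *\<^sub>R v \<in> ball x r" if "0 \<le> s" "s \<le> h" "0 \<le> t" "t \<le> h" for s t
  proof -
    have "norm (s *\<^sub>R u + t *\<^sub>R v) \<le> s * norm u + t * norm v"
      using norm_triangle_ineq[of "s *\<^sub>R u" "t *\<^sub>R v"] that by simp
    also have "\<dots> \<le> h * (norm u + norm v)"
      using that by (simp add: distrib_left add_mono mult_right_mono)
    also have "\<dots> < r" by fact
    finally have "norm (s *\<^sub>R u + t *\<^sub>R v) < r" .
    moreover have "x - (x + s *\<^sub>R u + t *\<^sub>R v) = - (s *\<^sub>R u + t *\<^sub>R v)" by simp
    ultimately show ?thesis by (simp only: mem_ball dist_norm norm_minus_cancel)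
  qed
  have g2: "Ck_on (Suc (Suc 0)) (ball x r) g" using g by (simp add: numeral_2_eq_2)
  have dg: "(g has_derivative frechet_derivative g (at y)) (at y)" if "y \<in> ball x r" for y
    using Ck_on_1_has_derivative[OF g2 that] .
  have dgu: "(?gu has_derivative frechet_derivative ?gu (at y)) (at y)" if "y \<in> ball x r" for y
    using Ck_on_1_has_derivative[of 0 "ball x r" ?gu y] g2 that by simp
  have lin1: "frechet_derivative g (at y) (a *\<^sub>R u) = a * ?gu y" if "y \<in> ball x r" for y a
    using has_derivative_bounded_linear[OF dg[OF that]] by (simp add: bounded_linear.linear linear_cmul)
  have lin2: "frechet_derivative ?gu (at y) (a *\<^sub>R v) = a * frechet_derivative ?gu (at y) v" if "y \<in> ball x r" for y a
    using has_derivative_bounded_linear[OF dgu[OF that]] by (simp add: bounded_linear.linear linear_cmul)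
  define f where "f s = g (x + s *\<^sub>R u + h *\<^sub>R v) - g (x + s *\<^sub>R u + 0 *\<^sub>R v)" for s
  have dline: "((\<lambda>s. g (x + s *\<^sub>R u + t *\<^sub>R v)) has_real_derivative ?gu (x + s *\<^sub>R u + t *\<^sub>R v)) (at s)"
    if "0 \<le> s" "s \<le> h" "0 \<le> t" "t \<le> h" for s t
    unfolding has_field_derivative_def
  proof (rule has_derivative_eq_rhs)
    show "((\<lambda>s. g (x + s *\<^sub>R u + t *\<^sub>R v)) has_derivative
        (\<lambda>a. frechet_derivative g (at (x + s *\<^sub>R u + t *\<^sub>R v)) (a *\<^sub>R u))) (at s)"
      by (rule has_derivative_compose[where f = "\<lambda>s. x + s *\<^sub>R u + t *\<^sub>R v" and g = g, OF _ dg[OF inb[OF that]]]) (auto intro!: derivative_eq_intros)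
  qed (simp add: lin1[OF inb[OF that]] mult.commute fun_eq_iff)
  have "\<exists>s. 0 < s \<and> s < h \<and> f h - f 0 = (h - 0) * (?gu (x + s *\<^sub>R u + h *\<^sub>R v) - ?gu (x + s *\<^sub>R u + 0 *\<^sub>R v))"
    unfolding f_def using h(1) by (intro MVT2[OF h(1)] DERIV_diff) (rule dline; simp)+
  then obtain s where s: "0 < s" "s < h"
    "f h - f 0 = h * (?gu (x + s *\<^sub>R u + h *\<^sub>R v) - ?gu (x + s *\<^sub>R u + 0 *\<^sub>R v))"
    by auto
  have dline2: "((\<lambda>t. ?gu (x + s *\<^sub>R u + t *\<^sub>R v)) has_real_derivative
      frechet_derivative ?gu (at (x + s *\<^sub>R u + t *\<^sub>R v)) v) (at t)"
    if "0 \<le> t" "t \<le> h" for t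
  proof -
    have i: "x + s *\<^sub>R u + t *\<^sub>R v \<in> ball x r" using inb s that by simp
    show ?thesis unfolding has_field_derivative_def
    proof (rule has_derivative_eq_rhs)
      show "((\<lambda>t. ?gu (x + s *\<^sub>R u + t *\<^sub>R v)) has_derivative
          (\<lambda>a. frechet_derivative ?gu (at (x + s *\<^sub>R u + t *\<^sub>R v)) (a *\<^sub>R v))) (at t)"
        by (rule has_derivative_compose[where f = "\<lambda>t. x + s *\<^sub>R u + t *\<^sub>R v" and g = ?gu, OF _ dgu[OF i]]) (auto intro!: derivative_eq_intros)
    qed (simp add: lin2[OF i] mult.commute fun_eq_iff)
  qed
  have "\<exists>t. 0 < t \<and> t < h \<and> ?gu (x + s *\<^sub>R u + h *\<^sub>R v) - ?gu (x + s *\<^sub>R u + 0 *\<^sub>R v) =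
      (h - 0) * frechet_derivative ?gu (at (x + s *\<^sub>R u + t *\<^sub>R v)) v"
    using h(1) by (intro MVT2[OF h(1)]) (rule dline2; simp)
  then obtain t where t: "0 < t" "t < h" "?gu (x + s *\<^sub>R u + h *\<^sub>R v) - ?gu (x + s *\<^sub>R u + 0 *\<^sub>R v) =
      h * frechet_derivative ?gu (at (x + s *\<^sub>R u + t *\<^sub>R v)) v"
    by auto
  show ?thesis
    using s t by (intro exI[of _ s] exI[of _ t]) (simp add: f_def)
qed

text \<open>Schwarz's theorem: both mixed derivatives, evaluated at points that tend to \<open>x\<close>, equal the same
  second difference divided by \<open>h\<^sup>2\<close>, and they are continuous.\<close>

lemma symmetric_second_derivative:
  fixes g :: "'a::euclidean_space \<Rightarrow> real"
  assumes "open W" "x \<in> W" "Ck_on 2 W g"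
  shows "frechet_derivative (\<lambda>y. frechet_derivative g (at y) u) (at x) v =
         frechet_derivative (\<lambda>y. frechet_derivative g (at y) v) (at x) u"
proof -
  obtain r where r: "r > 0" "ball x r \<subseteq> W" using assms(1,2) openE by blast
  have g: "Ck_on 2 (ball x r) g" using assms(3) r(2) by (rule Ck_on_subset)
  define D where "D u v y = frechet_derivative (\<lambda>y. frechet_derivative g (at y) u) (at y) v" for u v y
  have contD: "continuous (at x) (D u v)" for u v
  proof -
    have "continuous_on (ball x r) (D u v)"
      using g by (simp add: numeral_2_eq_2 D_def[abs_def])
    then show ?thesis using r(1) by (simp add: continuous_on_eq_continuous_at)
  qed
  have "dist (D u v x) (D v u x) < e" if e: "e > 0" for e
  proof -
    obtain d1 where d1: "d1 > 0" "\<And>y. dist y x < d1 \<Longrightarrow> dist (D u v y) (D u v x) < e/2"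
      using contD[of u v] e unfolding continuous_at_eps_delta by (metis half_gt_zero)
    obtain d2 where d2: "d2 > 0" "\<And>y. dist y x < d2 \<Longrightarrow> dist (D v u y) (D v u x) < e/2"
      using contD[of v u] e unfolding continuous_at_eps_delta by (metis half_gt_zero)
    \<comment> \<open>The step \<open>h\<close> is so small that all four corners and all intermediate points are within \<open>m\<close> of \<open>x\<close>.\<close>
    define m where "m = min r (min d1 d2)"
    define h where "h = m / (norm u + norm v + 1)"
    have m: "m > 0" using r d1 d2 by (simp add: m_def)
    have pos: "norm u + norm v + 1 > 0" by (simp add: add_nonneg_pos)
    have h: "h > 0" using m pos by (simp add: h_def)
    have "h * (norm u + norm v) < h * (norm u + norm v + 1)" using h by simp
    also have "\<dots> = m" using pos by (simp add: h_def)
    finally have hm: "h * (norm u + norm v) < m" .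
    have near: "dist (x + s *\<^sub>R a + t *\<^sub>R b) x < m"
      if "0 < s" "s < h" "0 < t" "t < h" "norm a + norm b = norm u + norm v" for s t a b
    proof -
      have "norm (s *\<^sub>R a + t *\<^sub>R b) \<le> s * norm a + t * norm b"
        using norm_triangle_ineq[of "s *\<^sub>R a" "t *\<^sub>R b"] that by simp
      also have "\<dots> \<le> h * (norm a + norm b)"
        unfolding distrib_left using that(1-4) by (intro add_mono mult_right_mono) auto
      finally show ?thesis using hm that by (simp add: dist_norm add.assoc)
    qed
    have "h * (norm u + norm v) < r" "h * (norm v + norm u) < r"
      using hm by (auto simp: m_def add.commute)
    from second_difference_MVT[OF g h this(1)] second_difference_MVT[OF g h this(2)]
    obtain s t s' t' where st: "0 < s" "s < h" "0 < t" "t < h" "0 < s'" "s' < h" "0 < t'" "t' < h"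
      and e1: "g (x + h *\<^sub>R u + h *\<^sub>R v) - g (x + h *\<^sub>R u) - g (x + h *\<^sub>R v) + g x =
          h * h * D u v (x + s *\<^sub>R u + t *\<^sub>R v)"
      and e2: "g (x + h *\<^sub>R v + h *\<^sub>R u) - g (x + h *\<^sub>R v) - g (x + h *\<^sub>R u) + g x =
          h * h * D v u (x + s' *\<^sub>R v + t' *\<^sub>R u)"
      unfolding D_def by metis
    have swap: "x + h *\<^sub>R v + h *\<^sub>R u = x + h *\<^sub>R u + h *\<^sub>R v"
      by (simp only: add.assoc add.commute[of "h *\<^sub>R v"])
    have "h * h * D u v (x + s *\<^sub>R u + t *\<^sub>R v) =
        g (x + h *\<^sub>R u + h *\<^sub>R v) - g (x + h *\<^sub>R v) - g (x + h *\<^sub>R u) + g x"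
      unfolding e1[symmetric] by simp
    also have "\<dots> = h * h * D v u (x + s' *\<^sub>R v + t' *\<^sub>R u)"
      using e2 unfolding swap .
    finally have eq: "D u v (x + s *\<^sub>R u + t *\<^sub>R v) = D v u (x + s' *\<^sub>R v + t' *\<^sub>R u)"
      using h by simp
    have "dist (x + s *\<^sub>R u + t *\<^sub>R v) x < m" "dist (x + s' *\<^sub>R v + t' *\<^sub>R u) x < m"
      using st by (auto intro!: near)
    then have "dist (D u v (x + s *\<^sub>R u + t *\<^sub>R v)) (D u v x) < e/2"
      "dist (D v u (x + s' *\<^sub>R v + t' *\<^sub>R u)) (D v u x) < e/2"
      using d1(2) d2(2) by (auto simp: m_def)
    with eq show ?thesis
      by - (rule dist_triangle_half_r[of "D u v (x + s *\<^sub>R u + t *\<^sub>R v)" _ e], simp_all)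
  qed
  then have "D u v x = D v u x" by (metis dist_not_less_zero less_irrefl zero_less_dist_iff)
  then show ?thesis by (simp add: D_def)
qed

section \<open>Derivatives along a submanifold\<close>

text \<open>Any extension \<open>g\<close> of \<open>f\<close> computes the derivative of \<open>f\<close> along a curve in \<open>S\<close>. In \<open>lie_bracket_derivation\<close>
  the function \<open>g\<close> is itself a directional derivative whose derivative is known at a single point.\<close>

lemma has_vector_derivative_along_extension:
  assumes g: "(g has_derivative D) (at (\<gamma> t0))" and \<gamma>: "(\<gamma> has_vector_derivative v) (at t0)"
    and W: "open W" "\<gamma> t0 \<in> W" and eq: "\<And>x. x \<in> W \<Longrightarrow> x \<in> S \<Longrightarrow> g x = f x"
    and S: "\<forall>\<^sub>F t in nhds t0. \<gamma> t \<in> S"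
  shows "((\<lambda>t. f (\<gamma> t)) has_vector_derivative D v) (at t0)"
proof -
  have "((\<lambda>t. g (\<gamma> t)) has_vector_derivative D v) (at t0)"
    using vector_derivative_diff_chain_within[OF \<gamma> has_derivative_at_withinI[OF g]]
    by (simp add: o_def)
  moreover have ev: "\<forall>\<^sub>F t in nhds t0. g (\<gamma> t) = f (\<gamma> t)"
  proof -
    have "isCont \<gamma> t0" using \<gamma> by (rule has_vector_derivative_continuous)
    then have "\<forall>\<^sub>F t in nhds t0. \<gamma> t \<in> W"
      using W by (auto simp: continuous_at_open eventually_nhds)
    with S show ?thesis by eventually_elim (use eq in blast)
  qed
  moreover have "\<forall>\<^sub>F t in at t0. g (\<gamma> t) = f (\<gamma> t)"
    using ev unfolding eventually_at_filter by (rule eventually_mono) simp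
  moreover have "g (\<gamma> t0) = f (\<gamma> t0)"
    using ev by (rule eventually_nhds_x_imp_x)
  ultimately show ?thesis
    unfolding has_vector_derivative_def
    by - (rule has_derivative_transform_eventually[of "\<lambda>t. g (\<gamma> t)"], simp_all)
qed

lemma tangent_space_curve:
  assumes \<gamma>: "(\<gamma> has_vector_derivative v) (at t0)" and S: "\<forall>\<^sub>F t in nhds t0. \<gamma> t \<in> S"
  shows "v \<in> tangent_space S (\<gamma> t0)"
proof -
  obtain d where d: "d > 0" "\<And>t. dist t t0 < d \<Longrightarrow> \<gamma> t \<in> S"
    using S unfolding eventually_nhds_metric by blast
  \<comment> \<open>A curve has to be defined on all of \<open>\<real>\<close>, so it is made constant away from \<open>t0\<close>.\<close>
  define c where "c s = (if \<bar>s\<bar> < d then \<gamma> (t0 + s) else \<gamma> t0)" for s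
  have "((\<lambda>s. t0 + s) has_vector_derivative 1) (at 0)"
    by (auto intro!: derivative_eq_intros)
  then have "((\<lambda>s. \<gamma> (t0 + s)) has_vector_derivative v) (at 0)"
    using vector_diff_chain_at[of "\<lambda>s. t0 + s" 1 0 \<gamma> v] \<gamma> by (simp add: o_def)
  then have "(c has_vector_derivative v) (at 0)"
    unfolding has_vector_derivative_def
    by (rule has_derivative_transform_within_open[where s = "ball 0 d"])
       (use d(1) in \<open>auto simp: c_def dist_norm\<close>)
  moreover have "c t \<in> S" for t
    using d by (auto simp: c_def dist_norm)
  ultimately have "curve_through S (\<gamma> t0) v c"
    using d(1) by (simp add: curve_through_def c_def)
  then show ?thesis by (auto simp: tangent_space_def)
qed

text \<open>A curve with velocity \<open>v\<close> has to exist because otherwise every value satisfies the defining property.\<close>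

lemma tangent_deriv_eqI:
  assumes c: "curve_through S p v c"
    and d: "\<And>c. curve_through S p v c \<Longrightarrow> ((\<lambda>t. f (c t)) has_vector_derivative d) (at 0)"
  shows "tangent_deriv S f p v = d"
  unfolding tangent_deriv_def
proof (rule the_equality)
  fix d' assume "\<forall>c. curve_through S p v c \<longrightarrow> ((\<lambda>t. f (c t)) has_vector_derivative d') (at 0)"
  with c have "((\<lambda>t. f (c t)) has_vector_derivative d') (at 0)" by blast
  with d[OF c] show "d' = d" by (metis vector_derivative_at)
qed (use d in blast)

lemma tangent_deriv_extension:
  assumes "open W" "p \<in> W" "(g has_derivative D) (at p)"
    and eq: "\<And>x. x \<in> W \<Longrightarrow> x \<in> S \<Longrightarrow> g x = f x" and v: "v \<in> tangent_space S p"
  shows "tangent_deriv S f p v = D v"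
proof -
  obtain c where c: "curve_through S p v c" using v by (auto simp: tangent_space_def)
  show ?thesis
  proof (rule tangent_deriv_eqI[OF c])
    fix c assume "curve_through S p v c"
    then have c: "c 0 = p" "(c has_vector_derivative v) (at 0)" "\<forall>\<^sub>F t in nhds 0. c t \<in> S"
      by (simp_all add: curve_through_def)
    show "((\<lambda>t. f (c t)) has_vector_derivative D v) (at 0)"
      by (rule has_vector_derivative_along_extension[OF _ c(2) assms(1) _ eq c(3)])
         (simp_all add: c(1) assms(2,3))
  qed
qed

lemma tangent_deriv_linear:
  assumes "bounded_linear L" "v \<in> tangent_space S p"
  shows "tangent_deriv S L p v = L v"
  by (rule tangent_deriv_extension[OF open_UNIV UNIV_I bounded_linear_imp_has_derivative[OF assms(1)] _ assms(2)])
     simp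

lemma Ck_on_all_has_derivative:
  assumes "\<forall>k. Ck_on k W g" "x \<in> W"
  shows "(g has_derivative frechet_derivative g (at x)) (at x)"
  using assms Ck_on_1_has_derivative by blast

lemma has_vector_derivative_along:
  assumes f: "smooth_map S f" and \<gamma>: "(\<gamma> has_vector_derivative v) (at t0)"
    and S: "\<forall>\<^sub>F t in nhds t0. \<gamma> t \<in> S"
  shows "((\<lambda>t. f (\<gamma> t)) has_vector_derivative tangent_deriv S f (\<gamma> t0) v) (at t0)"
proof -
  have p: "\<gamma> t0 \<in> S" using S by (rule eventually_nhds_x_imp_x)
  obtain W g where W: "open W" "\<gamma> t0 \<in> W" "\<forall>k. Ck_on k W g" "\<forall>x\<in>W \<inter> S. g x = f x"
    using smooth_map_extension[OF f p] by blast
  note D = Ck_on_all_has_derivative[OF W(3,2)]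
  have "tangent_deriv S f (\<gamma> t0) v = frechet_derivative g (at (\<gamma> t0)) v"
    using W(4) by (intro tangent_deriv_extension[OF W(1,2) D _ tangent_space_curve[OF \<gamma> S]]) blast
  moreover have "((\<lambda>t. f (\<gamma> t)) has_vector_derivative frechet_derivative g (at (\<gamma> t0)) v) (at t0)"
    using W(4) by (intro has_vector_derivative_along_extension[OF D \<gamma> W(1,2) _ S]) blast
  ultimately show ?thesis by simp
qed

lemma tangent_deriv_curve:
  assumes "smooth_map S f" "curve_through S p v c"
  shows "((\<lambda>t. f (c t)) has_vector_derivative tangent_deriv S f p v) (at 0)"
  using has_vector_derivative_along[OF assms(1), of c v 0] assms(2)
  by (auto simp: curve_through_def)

lemma tangent_deriv_cong:
  assumes "\<And>x. x \<in> S \<Longrightarrow> f x = g x"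
  shows "tangent_deriv S f p v = tangent_deriv S g p v"
proof -
  have "(curve_through S p v c \<longrightarrow> ((\<lambda>t. f (c t)) has_vector_derivative d) (at 0)) \<longleftrightarrow>
      (curve_through S p v c \<longrightarrow> ((\<lambda>t. g (c t)) has_vector_derivative d) (at 0))" for c d
    using assms by (simp add: curve_through_def)
  then show ?thesis unfolding tangent_deriv_def by simp
qed

lemma tangent_deriv_const:
  assumes "v \<in> tangent_space S p" "\<And>x. x \<in> S \<Longrightarrow> f x = a"
  shows "tangent_deriv S f p v = 0"
  using tangent_deriv_extension[OF open_UNIV UNIV_I has_derivative_const[of a] _ assms(1), of f] assms(2)
  by simp

lemma tangent_deriv_bilinear:
  assumes B: "bounded_bilinear B" and f: "smooth_map S f" and g: "smooth_map S g"
    and v: "v \<in> tangent_space S p"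
  shows "tangent_deriv S (\<lambda>x. B (f x) (g x)) p v =
    B (f p) (tangent_deriv S g p v) + B (tangent_deriv S f p v) (g p)"
proof -
  obtain c where c: "curve_through S p v c" using v by (auto simp: tangent_space_def)
  show ?thesis
  proof (rule tangent_deriv_eqI[OF c])
    fix c assume c: "curve_through S p v c"
    then have "c 0 = p" by (simp add: curve_through_def)
    then show "((\<lambda>t. B (f (c t)) (g (c t))) has_vector_derivative
        B (f p) (tangent_deriv S g p v) + B (tangent_deriv S f p v) (g p)) (at 0)"
      using bounded_bilinear.has_vector_derivative[OF B tangent_deriv_curve[OF f c] tangent_deriv_curve[OF g c]]
      by simp
  qed
qed

lemmas tangent_deriv_mult = tangent_deriv_bilinear[OF bounded_bilinear_mult]

lemma tangent_deriv_diff: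
  assumes f: "smooth_map S f" and g: "smooth_map S g" and v: "v \<in> tangent_space S p"
  shows "tangent_deriv S (\<lambda>x. f x - g x) p v = tangent_deriv S f p v - tangent_deriv S g p v"
proof -
  obtain c where c: "curve_through S p v c" using v by (auto simp: tangent_space_def)
  show ?thesis
    by (rule tangent_deriv_eqI[OF c])
       (rule has_vector_derivative_diff[OF tangent_deriv_curve[OF f] tangent_deriv_curve[OF g]])
qed

lemma tangent_deriv_add:
  assumes f: "smooth_map S f" and g: "smooth_map S g" and v: "v \<in> tangent_space S p"
  shows "tangent_deriv S (\<lambda>x. f x + g x) p v = tangent_deriv S f p v + tangent_deriv S g p v"
proof -
  obtain c where c: "curve_through S p v c" using v by (auto simp: tangent_space_def)
  show ?thesis
    by (rule tangent_deriv_eqI[OF c])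
       (rule has_vector_derivative_add[OF tangent_deriv_curve[OF f] tangent_deriv_curve[OF g]])
qed

lemma vector_fieldD:
  assumes "vector_field S U"
  shows "smooth_map S U" "p \<in> S \<Longrightarrow> U p \<in> tangent_space S p"
  using assms by (auto simp: vector_field_def)

lemma vector_field_cong:
  assumes "vector_field S U" "\<And>x. x \<in> S \<Longrightarrow> U x = V x"
  shows "vector_field S V"
  unfolding vector_field_def
  using smooth_map_cong[OF vector_fieldD(1)[OF assms(1)] assms(2)] vector_fieldD(2)[OF assms(1)] assms(2)
  by simp

lemma frechet_derivative_euclidean_sum:
  fixes w :: "'a::euclidean_space"
  assumes "Ck_on (Suc k) W g" "x \<in> W"
  shows "frechet_derivative g (at x) w = (\<Sum>b\<in>Basis. (w \<bullet> b) *\<^sub>R frechet_derivative g (at x) b)"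
proof -
  have "linear (frechet_derivative g (at x))"
    using has_derivative_linear[OF Ck_on_1_has_derivative[OF assms]] .
  then have "frechet_derivative g (at x) (\<Sum>b\<in>Basis. (w \<bullet> b) *\<^sub>R b) =
      (\<Sum>b\<in>Basis. (w \<bullet> b) *\<^sub>R frechet_derivative g (at x) b)"
    by (simp only: linear_sum linear_cmul)
  then show ?thesis by (simp only: euclidean_representation)
qed

text \<open>Expanding \<open>V\<close> in the basis reduces the derivative of the directional derivative along a variable
  field to the product rule: one term differentiates \<open>V\<close>, the other one \<open>g\<close> twice.\<close>

lemma has_derivative_directional:
  fixes g :: "'a::euclidean_space \<Rightarrow> real"
  assumes W: "open W" "p \<in> W" and g: "Ck_on 2 W g" and V: "(V has_derivative V') (at p)"
  shows "((\<lambda>q. frechet_derivative g (at q) (V q)) has_derivative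
    (\<lambda>w. frechet_derivative g (at p) (V' w) +
         frechet_derivative (\<lambda>q. frechet_derivative g (at q) (V p)) (at p) w)) (at p)"
proof -
  let ?D = "\<lambda>b q. frechet_derivative g (at q) b"
  have g2: "Ck_on (Suc (Suc 0)) W g" using g by (simp add: numeral_2_eq_2)
  have dD: "(?D b has_derivative frechet_derivative (?D b) (at p)) (at p)" for b
    using Ck_on_1_has_derivative[of 0 W "?D b" p] g2 W(2) by simp
  have const: "((\<lambda>q. \<Sum>b\<in>Basis. (V p \<bullet> b) * ?D b q) has_derivative
      (\<lambda>w. \<Sum>b\<in>Basis. (V p \<bullet> b) * frechet_derivative (?D b) (at p) w)) (at p)"
    by (intro has_derivative_sum has_derivative_mult_right dD)
  have "(?D (V p) has_derivative (\<lambda>w. \<Sum>b\<in>Basis. (V p \<bullet> b) * frechet_derivative (?D b) (at p) w)) (at p)"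
    using frechet_derivative_euclidean_sum[OF g2, of _ "V p"]
    by - (rule has_derivative_transform_within_open[OF const W], simp)
  then have eq: "frechet_derivative (?D (V p)) (at p) =
      (\<lambda>w. \<Sum>b\<in>Basis. (V p \<bullet> b) * frechet_derivative (?D b) (at p) w)"
    by (rule frechet_derivative_at[symmetric])
  have "((\<lambda>q. \<Sum>b\<in>Basis. (V q \<bullet> b) * ?D b q) has_derivative
      (\<lambda>w. \<Sum>b\<in>Basis. (V p \<bullet> b) * frechet_derivative (?D b) (at p) w + (V' w \<bullet> b) * ?D b p)) (at p)"
    by (intro has_derivative_sum has_derivative_mult dD has_derivative_inner_left V)
  also have "(\<lambda>w. \<Sum>b\<in>Basis. (V p \<bullet> b) * frechet_derivative (?D b) (at p) w + (V' w \<bullet> b) * ?D b p) =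
      (\<lambda>w. ?D (V' w) p + frechet_derivative (?D (V p)) (at p) w)"
    unfolding eq
    by (rule ext, subst frechet_derivative_euclidean_sum[OF g2 W(2), of "V' _"]) (simp add: sum.distrib)
  finally show ?thesis
    using frechet_derivative_euclidean_sum[OF g2, of x "V x" for x]
    by - (rule has_derivative_transform_within_open[OF _ W], simp_all)
qed

text \<open>The bracket is defined by differentiating the fields as vector-valued maps. In
  \<open>U (V f) - V (U f)\<close> the second derivatives of an extension of \<open>f\<close> cancel by symmetry, and what is left is
  the derivative of \<open>f\<close> in the direction of \<open>D\<^sub>U V - D\<^sub>V U\<close>.\<close>

lemma lie_bracket_derivation:
  fixes f :: "'a::euclidean_space \<Rightarrow> real"
  assumes f: "smooth_map S f" and U: "vector_field S U" and V: "vector_field S V" and p: "p \<in> S"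
    and br: "lie_bracket S U V p \<in> tangent_space S p"
  shows "tangent_deriv S f p (lie_bracket S U V p) =
    tangent_deriv S (\<lambda>q. tangent_deriv S f q (V q)) p (U p) -
    tangent_deriv S (\<lambda>q. tangent_deriv S f q (U q)) p (V p)"
proof -
  note T = vector_fieldD(2)[OF U] vector_fieldD(2)[OF V]
  obtain W1 g where g: "open W1" "p \<in> W1" "\<forall>k. Ck_on k W1 g" "\<forall>x\<in>W1 \<inter> S. g x = f x"
    using smooth_map_extension[OF f p] by blast
  have ext: "tangent_deriv S f q v = frechet_derivative g (at q) v"
    if "q \<in> W1" "v \<in> tangent_space S q" for q v
    using g that by (intro tangent_deriv_extension[OF g(1) that(1) Ck_on_all_has_derivative[OF g(3)]]) auto
  have dir: "tangent_deriv S (\<lambda>q. tangent_deriv S f q (V q)) p (U p) =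
      frechet_derivative g (at p) (tangent_deriv S V p (U p)) +
      frechet_derivative (\<lambda>q. frechet_derivative g (at q) (V p)) (at p) (U p)"
    if U: "U p \<in> tangent_space S p" and V: "vector_field S V" for U V
  proof -
    obtain W2 V' where V': "open W2" "p \<in> W2" "\<forall>k. Ck_on k W2 V'" "\<forall>x\<in>W2 \<inter> S. V' x = V x"
      using smooth_map_extension[OF vector_fieldD(1)[OF V] p] by blast
    note dV' = Ck_on_all_has_derivative[OF V'(3,2)]
    have Vp: "V' p = V p" using V' p by blast
    have "tangent_deriv S V p (U p) = frechet_derivative V' (at p) (U p)"
      using V' by (intro tangent_deriv_extension[OF V'(1,2) dV' _ U]) auto
    moreover have "tangent_deriv S (\<lambda>q. tangent_deriv S f q (V q)) p (U p) =
        frechet_derivative g (at p) (frechet_derivative V' (at p) (U p)) +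
        frechet_derivative (\<lambda>q. frechet_derivative g (at q) (V' p)) (at p) (U p)"
    proof (rule tangent_deriv_extension[where W = "W1 \<inter> W2", OF _ _
          has_derivative_directional[OF g(1,2) g(3)[rule_format] dV'] _ U])
      show "frechet_derivative g (at x) (V' x) = tangent_deriv S f x (V x)"
        if "x \<in> W1 \<inter> W2" "x \<in> S" for x
        using that V'(4) ext[of x "V x"] vector_fieldD(2)[OF V] by auto
    qed (use g V' in auto)
    ultimately show ?thesis by (simp add: Vp)
  qed
  have lin: "linear (frechet_derivative g (at p))"
    using has_derivative_linear[OF Ck_on_all_has_derivative[OF g(3,2)]] .
  show ?thesis
    using ext[OF g(2) br] dir[of U V, OF T(1)[OF p] V] dir[of V U, OF T(2)[OF p] U]
      symmetric_second_derivative[OF g(1,2) g(3)[rule_format], of "V p" "U p"]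
    by (simp add: lie_bracket_def linear_diff[OF lin])
qed

section \<open>Connections in a moving frame\<close>

text \<open>The coordinates \<open>c k p\<close> are functionals on the whole ambient space, of which only the values on
  the tangent space matter; with this convention they are linear without side conditions.\<close>

locale moving_frame =
  fixes S :: "'a::euclidean_space set" and E :: "nat \<Rightarrow> 'a \<Rightarrow> 'a" and n :: nat
    and c :: "nat \<Rightarrow> 'a \<Rightarrow> 'a \<Rightarrow> real"
  assumes frame_field: "k < n \<Longrightarrow> vector_field S (E k)"
    and coord_linear: "p \<in> S \<Longrightarrow> k < n \<Longrightarrow> linear (c k p)"
    and coord_frame: "p \<in> S \<Longrightarrow> j < n \<Longrightarrow> k < n \<Longrightarrow> c k p (E j p) = (if j = k then 1 else 0)"
    and coord_expand: "p \<in> S \<Longrightarrow> v \<in> tangent_space S p \<Longrightarrow> v = (\<Sum>k<n. c k p v *\<^sub>R E k p)"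
    and coord_smooth: "vector_field S W \<Longrightarrow> k < n \<Longrightarrow> smooth_map S (\<lambda>p. c k p (W p))"
    and tangent_subspace: "p \<in> S \<Longrightarrow> subspace (tangent_space S p)"
begin

lemma frame_tangent: "p \<in> S \<Longrightarrow> k < n \<Longrightarrow> E k p \<in> tangent_space S p"
  using vector_fieldD(2)[OF frame_field] .

lemma zero_field: "vector_field S (\<lambda>q. 0)"
  using tangent_subspace by (simp add: vector_field_def smooth_map_const subspace_0)

lemma add_field: "vector_field S U \<Longrightarrow> vector_field S V \<Longrightarrow> vector_field S (\<lambda>q. U q + V q)"
  using tangent_subspace by (simp add: vector_field_def smooth_map_add subspace_add)

lemma scale_field: "smooth_map S f \<Longrightarrow> vector_field S U \<Longrightarrow> vector_field S (\<lambda>q. f q *\<^sub>R U q)"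
  using tangent_subspace by (simp add: vector_field_def smooth_map_scaleR subspace_scale)

lemma diff_field: "vector_field S U \<Longrightarrow> vector_field S V \<Longrightarrow> vector_field S (\<lambda>q. U q - V q)"
  using tangent_subspace by (simp add: vector_field_def smooth_map_minus subspace_diff)

lemma sum_field:
  assumes "finite K" "\<And>k. k \<in> K \<Longrightarrow> vector_field S (U k)"
  shows "vector_field S (\<lambda>q. \<Sum>k\<in>K. U k q)"
  using assms by (induction K) (simp_all add: zero_field add_field)

lemma combination_field:
  assumes "\<And>k. k < n \<Longrightarrow> smooth_map S (f k)"
  shows "vector_field S (\<lambda>q. \<Sum>k<n. f k q *\<^sub>R E k q)"
  using assms by (intro sum_field) (simp_all add: scale_field frame_field)

lemma coord_sum:
  assumes "p \<in> S" "k < n"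
  shows "c k p (\<Sum>j<n. a j *\<^sub>R E j p) = a k"
proof -
  have "c k p (\<Sum>j<n. a j *\<^sub>R E j p) = (\<Sum>j<n. a j * c k p (E j p))"
    using coord_linear[OF assms] by (simp add: linear_sum linear_cmul)
  also have "\<dots> = (\<Sum>j<n. if j = k then a j else 0)"
    using coord_frame[OF assms(1) _ assms(2)] by (intro sum.cong) auto
  finally show ?thesis using assms(2) by simp
qed

lemma tangent_eqI:
  assumes "p \<in> S" "v \<in> tangent_space S p" "w \<in> tangent_space S p" "\<And>k. k < n \<Longrightarrow> c k p v = c k p w"
  shows "v = w"
proof -
  have "(\<Sum>k<n. c k p v *\<^sub>R E k p) = (\<Sum>k<n. c k p w *\<^sub>R E k p)"
    using assms(4) by simp
  then show ?thesis using coord_expand[OF assms(1,2)] coord_expand[OF assms(1,3)] by simp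
qed

end

locale framed_connection = moving_frame S E n c
  for S :: "'a::euclidean_space set" and E n c +
  fixes D :: "'a conn"
  assumes connection: "affine_connection S D"
begin

lemma conn_field: "vector_field S U \<Longrightarrow> vector_field S V \<Longrightarrow> vector_field S (D U V)"
  using connection unfolding affine_connection_def by blast

lemma conn_add_left:
  "vector_field S U \<Longrightarrow> vector_field S U' \<Longrightarrow> vector_field S V \<Longrightarrow> p \<in> S \<Longrightarrow>
    D (\<lambda>q. U q + U' q) V p = D U V p + D U' V p"
  using connection unfolding affine_connection_def by blast

lemma conn_add_right:
  "vector_field S U \<Longrightarrow> vector_field S U' \<Longrightarrow> vector_field S V \<Longrightarrow> p \<in> S \<Longrightarrow>
    D V (\<lambda>q. U q + U' q) p = D V U p + D V U' p"
  using connection unfolding affine_connection_def by blast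

lemma conn_scale_left:
  "smooth_map S f \<Longrightarrow> vector_field S U \<Longrightarrow> vector_field S V \<Longrightarrow> p \<in> S \<Longrightarrow>
    D (\<lambda>q. f q *\<^sub>R U q) V p = f p *\<^sub>R D U V p"
  using connection unfolding affine_connection_def by blast

lemma conn_scale_right:
  "smooth_map S f \<Longrightarrow> vector_field S U \<Longrightarrow> vector_field S V \<Longrightarrow> p \<in> S \<Longrightarrow>
    D U (\<lambda>q. f q *\<^sub>R V q) p = tangent_deriv S f p (U p) *\<^sub>R V p + f p *\<^sub>R D U V p"
  using connection unfolding affine_connection_def by blast

text \<open>A field \<open>N\<close> vanishing on \<open>S\<close> is \<open>f N\<close> with \<open>f\<close> the indicator function of the complement
  of \<open>S\<close>, which counts as smooth on \<open>S\<close> because it vanishes there.\<close>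

lemma conn_null:
  assumes U: "vector_field S U" and N: "vector_field S N" and null: "\<And>q. q \<in> S \<Longrightarrow> N q = 0" and p: "p \<in> S"
  shows "D N U p = 0" "D U N p = 0"
proof -
  define f :: "'a \<Rightarrow> real" where "f q = (if q \<in> S then 0 else 1)" for q
  have f: "smooth_map S f" by (rule smooth_map_cong[OF smooth_map_const[of _ 0]]) (simp add: f_def)
  have fN: "(\<lambda>q. f q *\<^sub>R N q) = N" using null by (auto simp: f_def)
  have "tangent_deriv S f p (U p) = 0"
    by (rule tangent_deriv_const[OF vector_fieldD(2)[OF U p], of _ 0]) (simp add: f_def)
  then show "D N U p = 0" "D U N p = 0"
    using conn_scale_left[OF f N U p] conn_scale_right[OF f U N p] p unfolding fN by (simp_all add: f_def)
qed

text \<open>The axioms of a connection speak of maps on the ambient space. Only the values on \<open>S\<close> matter,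
  because fields that vanish on \<open>S\<close> contribute nothing.\<close>

lemma conn_cong:
  assumes U: "vector_field S U" and V: "vector_field S V"
    and eq: "\<And>q. q \<in> S \<Longrightarrow> U q = U' q" "\<And>q. q \<in> S \<Longrightarrow> V q = V' q" and p: "p \<in> S"
  shows "D U' V' p = D U V p"
proof -
  have U': "vector_field S U'" and V': "vector_field S V'"
    using vector_field_cong[OF U eq(1)] vector_field_cong[OF V eq(2)] by blast+
  have NU: "vector_field S (\<lambda>q. U' q - U q)" and NV: "vector_field S (\<lambda>q. V' q - V q)"
    by (intro diff_field U' V' U V)+
  have "D (\<lambda>q. U q + (U' q - U q)) V' p = D U V' p + D (\<lambda>q. U' q - U q) V' p"
    by (rule conn_add_left[OF U NU V' p])
  also have "D (\<lambda>q. U' q - U q) V' p = 0"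
    using eq(1) by (intro conn_null(1)[OF V' NU _ p]) simp
  finally have 1: "D U' V' p = D U V' p" by simp
  have "D U (\<lambda>q. V q + (V' q - V q)) p = D U V p + D U (\<lambda>q. V' q - V q) p"
    by (rule conn_add_right[OF V NV U p])
  also have "D U (\<lambda>q. V' q - V q) p = 0"
    using eq(2) by (intro conn_null(2)[OF U NV _ p]) simp
  finally show ?thesis using 1 by simp
qed

lemma conn_sum_left:
  assumes K: "finite K" and V: "vector_field S V" and p: "p \<in> S"
    and f: "\<And>k. k \<in> K \<Longrightarrow> smooth_map S (f k)" and U: "\<And>k. k \<in> K \<Longrightarrow> vector_field S (U k)"
  shows "D (\<lambda>q. \<Sum>k\<in>K. f k q *\<^sub>R U k q) V p = (\<Sum>k\<in>K. f k p *\<^sub>R D (U k) V p)"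
  using K f U
proof (induction K)
  case empty
  then show ?case using conn_null(1)[OF V zero_field _ p] by simp
next
  case (insert k K)
  have "vector_field S (\<lambda>q. f k q *\<^sub>R U k q)" "vector_field S (\<lambda>q. \<Sum>k\<in>K. f k q *\<^sub>R U k q)"
    using insert by (simp_all add: sum_field scale_field)
  then show ?case using insert by (simp add: conn_add_left conn_scale_left V p)
qed

lemma conn_sum_right:
  assumes K: "finite K" and U: "vector_field S U" and p: "p \<in> S"
    and f: "\<And>k. k \<in> K \<Longrightarrow> smooth_map S (f k)" and V: "\<And>k. k \<in> K \<Longrightarrow> vector_field S (V k)"
  shows "D U (\<lambda>q. \<Sum>k\<in>K. f k q *\<^sub>R V k q) p =
    (\<Sum>k\<in>K. tangent_deriv S (f k) p (U p) *\<^sub>R V k p + f k p *\<^sub>R D U (V k) p)"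
  using K f V
proof (induction K)
  case empty
  then show ?case using conn_null(2)[OF U zero_field _ p] by simp
next
  case (insert k K)
  have "vector_field S (\<lambda>q. f k q *\<^sub>R V k q)" "vector_field S (\<lambda>q. \<Sum>k\<in>K. f k q *\<^sub>R V k q)"
    using insert by (simp_all add: sum_field scale_field)
  then show ?case using insert by (simp add: conn_add_right conn_scale_right U p)
qed

text \<open>In particular the covariant derivative at \<open>p\<close> depends on \<open>U\<close> only through \<open>U p\<close>.\<close>

lemma conn_expand_left:
  assumes U: "vector_field S U" and V: "vector_field S V" and p: "p \<in> S"
  shows "D U V p = (\<Sum>k<n. c k p (U p) *\<^sub>R D (E k) V p)"
proof -
  have sm: "smooth_map S (\<lambda>q. c k q (U q))" if "k \<in> {..<n}" for k
    using coord_smooth[OF U] that by simp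
  have fr: "vector_field S (E k)" if "k \<in> {..<n}" for k
    using frame_field that by simp
  have "D U V p = D (\<lambda>q. \<Sum>k<n. c k q (U q) *\<^sub>R E k q) V p"
    using coord_expand[OF _ vector_fieldD(2)[OF U]] combination_field[OF coord_smooth[OF U]]
    by (intro conn_cong[OF _ V _ _ p]) simp_all
  also have "\<dots> = (\<Sum>k<n. c k p (U p) *\<^sub>R D (E k) V p)"
    by (rule conn_sum_left[OF finite_lessThan V p sm fr])
  finally show ?thesis .
qed

lemma conn_expand_right:
  assumes U: "vector_field S U" and V: "vector_field S V" and p: "p \<in> S"
  shows "D U V p = (\<Sum>k<n. tangent_deriv S (\<lambda>q. c k q (V q)) p (U p) *\<^sub>R E k p + c k p (V p) *\<^sub>R D U (E k) p)"
proof -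
  have sm: "smooth_map S (\<lambda>q. c k q (V q))" if "k \<in> {..<n}" for k
    using coord_smooth[OF V] that by simp
  have fr: "vector_field S (E k)" if "k \<in> {..<n}" for k
    using frame_field that by simp
  have "D U V p = D U (\<lambda>q. \<Sum>k<n. c k q (V q) *\<^sub>R E k q) p"
    using coord_expand[OF _ vector_fieldD(2)[OF V]] combination_field[OF coord_smooth[OF V]]
    by (intro conn_cong[OF U _ _ _ p]) simp_all
  also have "\<dots> = (\<Sum>k<n. tangent_deriv S (\<lambda>q. c k q (V q)) p (U p) *\<^sub>R E k p + c k p (V p) *\<^sub>R D U (E k) p)"
    by (rule conn_sum_right[OF finite_lessThan U p sm fr])
  finally show ?thesis .
qed

end

section \<open>Curvature of a connection rotating a plane\<close>

text \<open>The connection differs from the flat connection of the frame by the one-form \<open>\<omega>\<close> with values in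
  the infinitesimal rotations of the plane spanned by the first two frame fields.\<close>

locale rotating_connection = framed_connection S E n c D
  for S :: "'a::euclidean_space set" and E n c D +
  fixes \<omega> :: "'a \<Rightarrow> 'a \<Rightarrow> real"
  assumes n2: "2 \<le> n"
    and conn_frame0: "vector_field S U \<Longrightarrow> p \<in> S \<Longrightarrow> D U (E 0) p = \<omega> p (U p) *\<^sub>R E 1 p"
    and conn_frame1: "vector_field S U \<Longrightarrow> p \<in> S \<Longrightarrow> D U (E 1) p = - \<omega> p (U p) *\<^sub>R E 0 p"
    and conn_frame_rest: "vector_field S U \<Longrightarrow> p \<in> S \<Longrightarrow> 2 \<le> k \<Longrightarrow> k < n \<Longrightarrow> D U (E k) p = 0"
    and \<omega>_smooth: "vector_field S U \<Longrightarrow> smooth_map S (\<lambda>q. \<omega> q (U q))"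
begin

text \<open>The infinitesimal rotation: \<open>E 0 \<mapsto> E 1 \<mapsto> - E 0\<close>, all other frame fields are killed.\<close>

definition J :: "'a \<Rightarrow> 'a \<Rightarrow> 'a" where
  "J p v = c 0 p v *\<^sub>R E 1 p - c 1 p v *\<^sub>R E 0 p"

lemma n_pos: "0 < n" "1 < n" "Suc 0 < n"
  using n2 by auto

lemma J_tangent: "p \<in> S \<Longrightarrow> J p v \<in> tangent_space S p"
  unfolding J_def using n_pos by (intro subspace_diff subspace_scale tangent_subspace frame_tangent) auto

lemma coord_J:
  assumes "p \<in> S" "k < n"
  shows "c k p (J p v) = (if k = 0 then - c 1 p v else if k = 1 then c 0 p v else 0)"
  using assms n_pos coord_linear[OF assms] coord_frame[of p _ k]
  by (simp add: J_def linear_diff linear_cmul)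

lemma conn_formula:
  assumes U: "vector_field S U" and W: "vector_field S W" and p: "p \<in> S"
  shows "D U W p = (\<Sum>k<n. tangent_deriv S (\<lambda>q. c k q (W q)) p (U p) *\<^sub>R E k p) + \<omega> p (U p) *\<^sub>R J p (W p)"
proof -
  have "(\<Sum>k<n. c k p (W p) *\<^sub>R D U (E k) p) = (\<Sum>k\<in>{0,1}. c k p (W p) *\<^sub>R D U (E k) p)"
    using n2 conn_frame_rest[OF U p] by (intro sum.mono_neutral_right) auto
  also have "\<dots> = \<omega> p (U p) *\<^sub>R J p (W p)"
    using conn_frame0[OF U p] conn_frame1[OF U p] by (simp add: J_def algebra_simps)
  finally show ?thesis
    unfolding conn_expand_right[OF U W p] sum.distrib by simp
qed

lemma coord_conn:
  assumes U: "vector_field S U" and W: "vector_field S W" and p: "p \<in> S" and k: "k < n"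
  shows "c k p (D U W p) = tangent_deriv S (\<lambda>q. c k q (W q)) p (U p) + \<omega> p (U p) * c k p (J p (W p))"
  unfolding conn_formula[OF U W p]
  using coord_linear[OF p k] coord_sum[OF p k] by (simp add: linear_add linear_cmul)

lemma coord_conn_cases:
  assumes U: "vector_field S U" and W: "vector_field S W" and p: "p \<in> S"
  shows "c 0 p (D U W p) = tangent_deriv S (\<lambda>q. c 0 q (W q)) p (U p) - \<omega> p (U p) * c 1 p (W p)"
    and "c 1 p (D U W p) = tangent_deriv S (\<lambda>q. c 1 q (W q)) p (U p) + \<omega> p (U p) * c 0 p (W p)"
    and "2 \<le> k \<Longrightarrow> k < n \<Longrightarrow> c k p (D U W p) = tangent_deriv S (\<lambda>q. c k q (W q)) p (U p)"
  using coord_conn[OF U W p] n_pos coord_J[OF p] by simp_all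

text \<open>Smoothness of \<open>U(w\<^sub>k)\<close> comes for free from the connection: \<open>D U W\<close> is a vector field, and its
  coordinates differ from \<open>U(w\<^sub>k)\<close> by products of smooth functions.\<close>

lemma coord_deriv_smooth:
  assumes U: "vector_field S U" and W: "vector_field S W" and k: "k < n"
  shows "smooth_map S (\<lambda>q. tangent_deriv S (\<lambda>q. c k q (W q)) q (U q))"
proof -
  have s: "smooth_map S (\<lambda>q. c k q (D U W q))" "smooth_map S (\<lambda>q. \<omega> q (U q))"
      "smooth_map S (\<lambda>q. c 0 q (W q))" "smooth_map S (\<lambda>q. c 1 q (W q))"
    using coord_smooth[OF conn_field[OF U W]] coord_smooth[OF W] \<omega>_smooth[OF U] k n_pos by auto
  consider "k = 0" | "k = 1" | "2 \<le> k" by linarith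
  then show ?thesis
  proof cases
    case 1
    show ?thesis
      by (rule smooth_map_cong[OF smooth_map_add[OF s(1) smooth_map_mult[OF s(2,4)]]])
         (simp add: 1 coord_conn_cases(1)[OF U W])
  next
    case 2
    show ?thesis
      by (rule smooth_map_cong[OF smooth_map_minus[OF s(1) smooth_map_mult[OF s(2,3)]]])
         (simp add: 2 coord_conn_cases(2)[OF U W, simplified])
  next
    case 3
    show ?thesis
      by (rule smooth_map_cong[OF s(1)]) (simp add: coord_conn_cases(3)[OF U W _ 3 k])
  qed
qed

end

locale rotating_connection_brackets = rotating_connection S E n c D \<omega>
  for S :: "'a::euclidean_space set" and E n c D \<omega> +
  assumes bracket_field: "vector_field S U \<Longrightarrow> vector_field S V \<Longrightarrow> vector_field S (lie_bracket S U V)"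
begin

text \<open>The exterior derivative of \<open>\<omega>\<close>.\<close>

definition d\<omega> :: "('a \<Rightarrow> 'a) \<Rightarrow> ('a \<Rightarrow> 'a) \<Rightarrow> 'a \<Rightarrow> real" where
  "d\<omega> U V p = tangent_deriv S (\<lambda>q. \<omega> q (V q)) p (U p) - tangent_deriv S (\<lambda>q. \<omega> q (U q)) p (V p)
     - \<omega> p (lie_bracket S U V p)"

lemma curvature_field:
  assumes "vector_field S U" "vector_field S V" "vector_field S W"
  shows "vector_field S (curvature S D U V W)"
proof -
  have "vector_field S (\<lambda>p. D U (D V W) p - D V (D U W) p - D (lie_bracket S U V) W p)"
    using assms by (intro diff_field conn_field bracket_field)
  then show ?thesis by (simp add: curvature_def[abs_def])
qed

text \<open>The terms quadratic in \<open>\<omega>\<close> and the mixed terms are symmetric in \<open>U\<close> and \<open>V\<close>, because the rotations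
  of a plane commute. They drop out of the curvature.\<close>

lemma second_conn:
  assumes U: "vector_field S U" and V: "vector_field S V" and W: "vector_field S W" and p: "p \<in> S"
  shows "c 0 p (D U (D V W) p) =
      tangent_deriv S (\<lambda>q. tangent_deriv S (\<lambda>q. c 0 q (W q)) q (V q)) p (U p)
      - tangent_deriv S (\<lambda>q. \<omega> q (V q)) p (U p) * c 1 p (W p)
      - \<omega> p (V p) * tangent_deriv S (\<lambda>q. c 1 q (W q)) p (U p)
      - \<omega> p (U p) * tangent_deriv S (\<lambda>q. c 1 q (W q)) p (V p)
      - \<omega> p (U p) * \<omega> p (V p) * c 0 p (W p)" (is ?A)
    and "c 1 p (D U (D V W) p) =
      tangent_deriv S (\<lambda>q. tangent_deriv S (\<lambda>q. c 1 q (W q)) q (V q)) p (U p)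
      + tangent_deriv S (\<lambda>q. \<omega> q (V q)) p (U p) * c 0 p (W p)
      + \<omega> p (V p) * tangent_deriv S (\<lambda>q. c 0 q (W q)) p (U p)
      + \<omega> p (U p) * tangent_deriv S (\<lambda>q. c 0 q (W q)) p (V p)
      - \<omega> p (U p) * \<omega> p (V p) * c 1 p (W p)" (is ?B)
    and "2 \<le> k \<Longrightarrow> k < n \<Longrightarrow> c k p (D U (D V W) p) =
      tangent_deriv S (\<lambda>q. tangent_deriv S (\<lambda>q. c k q (W q)) q (V q)) p (U p)"
proof -
  note DVW = conn_field[OF V W] and Up = vector_fieldD(2)[OF U p]
  have s: "smooth_map S (\<lambda>q. \<omega> q (V q))" "smooth_map S (\<lambda>q. c 0 q (W q))" "smooth_map S (\<lambda>q. c 1 q (W q))"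
    using coord_smooth[OF W] \<omega>_smooth[OF V] n_pos by auto
  have d: "smooth_map S (\<lambda>q. tangent_deriv S (\<lambda>q. c 0 q (W q)) q (V q))"
    "smooth_map S (\<lambda>q. tangent_deriv S (\<lambda>q. c 1 q (W q)) q (V q))"
    using coord_deriv_smooth[OF V W] n_pos by auto
  have "tangent_deriv S (\<lambda>q. c 0 q (D V W q)) p (U p) =
      tangent_deriv S (\<lambda>q. tangent_deriv S (\<lambda>q. c 0 q (W q)) q (V q) - \<omega> q (V q) * c 1 q (W q)) p (U p)"
    by (rule tangent_deriv_cong) (rule coord_conn_cases(1)[OF V W])
  also note tangent_deriv_diff[OF d(1) smooth_map_mult[OF s(1,3)] Up]
  also note tangent_deriv_mult[OF s(1,3) Up]
  finally show ?A
    unfolding coord_conn_cases(1)[OF U DVW p] coord_conn_cases(2)[OF V W p]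
    by (simp add: algebra_simps)
  have "tangent_deriv S (\<lambda>q. c 1 q (D V W q)) p (U p) =
      tangent_deriv S (\<lambda>q. tangent_deriv S (\<lambda>q. c 1 q (W q)) q (V q) + \<omega> q (V q) * c 0 q (W q)) p (U p)"
    by (rule tangent_deriv_cong) (rule coord_conn_cases(2)[OF V W])
  also note tangent_deriv_add[OF d(2) smooth_map_mult[OF s(1,2)] Up]
  also note tangent_deriv_mult[OF s(1,2) Up]
  finally show ?B
    unfolding coord_conn_cases(2)[OF U DVW p] coord_conn_cases(1)[OF V W p]
    by (simp add: algebra_simps)
  assume k: "2 \<le> k" "k < n"
  show "c k p (D U (D V W) p) =
      tangent_deriv S (\<lambda>q. tangent_deriv S (\<lambda>q. c k q (W q)) q (V q)) p (U p)"
    unfolding coord_conn_cases(3)[OF U DVW p k]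
    by (rule tangent_deriv_cong) (rule coord_conn_cases(3)[OF V W _ k])
qed

text \<open>After antisymmetrising, the second derivatives of the coordinates of \<open>W\<close> add up to the derivative
  along \<open>[U,V]\<close>, which is cancelled by the third term of the curvature.\<close>

lemma curvature_formula:
  assumes U: "vector_field S U" and V: "vector_field S V" and W: "vector_field S W" and p: "p \<in> S"
  shows "curvature S D U V W p = d\<omega> U V p *\<^sub>R J p (W p)"
proof (rule tangent_eqI[OF p])
  note B = bracket_field[OF U V]
  show "curvature S D U V W p \<in> tangent_space S p"
    using curvature_field[OF U V W] p by (rule vector_fieldD)
  show "d\<omega> U V p *\<^sub>R J p (W p) \<in> tangent_space S p"
    using tangent_subspace[OF p] J_tangent[OF p] by (simp add: subspace_scale)
  fix k assume k: "k < n"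
  have lb: "tangent_deriv S (\<lambda>q. c k q (W q)) p (lie_bracket S U V p) =
     tangent_deriv S (\<lambda>q. tangent_deriv S (\<lambda>q. c k q (W q)) q (V q)) p (U p) -
     tangent_deriv S (\<lambda>q. tangent_deriv S (\<lambda>q. c k q (W q)) q (U q)) p (V p)" if "k < n" for k
    using lie_bracket_derivation[OF coord_smooth[OF W that] U V p vector_fieldD(2)[OF B p]] .
  have split: "c k p (curvature S D U V W p) =
      c k p (D U (D V W) p) - c k p (D V (D U W) p) - c k p (D (lie_bracket S U V) W p)"
    unfolding curvature_def using coord_linear[OF p k] by (simp add: linear_diff)
  have rhs: "c k p (d\<omega> U V p *\<^sub>R J p (W p)) = d\<omega> U V p * c k p (J p (W p))"
    using coord_linear[OF p k] by (simp add: linear_cmul)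
  note second = second_conn[OF U V W p] second_conn[OF V U W p] coord_conn_cases[OF B W p]
  consider "k = 0" | "k = 1" | "2 \<le> k" by linarith
  then show "c k p (curvature S D U V W p) = c k p (d\<omega> U V p *\<^sub>R J p (W p))"
  proof cases
    case 1
    show ?thesis
      unfolding split rhs unfolding 1 second lb[OF n_pos(1)] coord_J[OF p n_pos(1)] d\<omega>_def
      by (simp add: algebra_simps)
  next
    case 2
    show ?thesis
      unfolding split rhs unfolding 2 second lb[OF n_pos(2)] coord_J[OF p n_pos(2)] d\<omega>_def
      by (simp add: algebra_simps)
  next
    case 3
    show ?thesis
      unfolding split rhs using 3 k
      by (simp add: second(3)[OF 3 k] second(6)[OF 3 k] second(9)[OF 3 k] lb[OF k] coord_J[OF p k])
  qed
qed

text \<open>The curvature \<open>w (u\<^sub>0 v\<^sub>1 - u\<^sub>1 v\<^sub>0) J\<close> is built from the area form of the plane and from \<open>J\<close>.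
  Both are invariant under the rotations by which the connection differs from the flat one.\<close>

lemma parallel_curvatureI:
  assumes d\<omega>: "\<And>U V p. vector_field S U \<Longrightarrow> vector_field S V \<Longrightarrow> p \<in> S \<Longrightarrow>
      d\<omega> U V p = w * (c 0 p (U p) * c 1 p (V p) - c 1 p (U p) * c 0 p (V p))"
  shows "parallel_curvature S D"
  unfolding parallel_curvature_def
proof (intro allI impI ballI)
  fix A U V W p
  assume A: "vector_field S A" and U: "vector_field S U" and V: "vector_field S V" and W: "vector_field S W"
    and p: "p \<in> S"
  let ?R = "curvature S D U V W"
  note Ap = vector_fieldD(2)[OF A p]
  note R = curvature_field[OF U V W]
  note R1 = curvature_field[OF conn_field[OF A U] V W] and R2 = curvature_field[OF U conn_field[OF A V] W]
    and R3 = curvature_field[OF U V conn_field[OF A W]]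
  have cR: "c k q (curvature S D U V W q) =
      w * (c 0 q (U q) * c 1 q (V q) - c 1 q (U q) * c 0 q (V q)) * c k q (J q (W q))"
    if "vector_field S U" "vector_field S V" "vector_field S W" "q \<in> S" "k < n" for U V W q k
    using that coord_linear[of q k] by (simp add: curvature_formula d\<omega> linear_cmul)
  have sm: "smooth_map S (\<lambda>q. c 0 q (Y q))" "smooth_map S (\<lambda>q. c 1 q (Y q))" if "vector_field S Y" for Y
    using coord_smooth[OF that] n_pos by auto
  note s = sm[OF U] sm[OF V] sm[OF W]
  \<comment> \<open>The scalar factor of the curvature; its derivative follows from the product rule.\<close>
  define O' where "O' q = w * (c 0 q (U q) * c 1 q (V q) - c 1 q (U q) * c 0 q (V q))" for q
  have sO: "smooth_map S O'"
    unfolding O'_def by (intro smooth_map_mult smooth_map_minus smooth_map_const s)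
  have dO: "tangent_deriv S O' p (A p) = w * (
      c 0 p (U p) * tangent_deriv S (\<lambda>q. c 1 q (V q)) p (A p) +
      tangent_deriv S (\<lambda>q. c 0 q (U q)) p (A p) * c 1 p (V p) -
      (c 1 p (U p) * tangent_deriv S (\<lambda>q. c 0 q (V q)) p (A p) +
      tangent_deriv S (\<lambda>q. c 1 q (U q)) p (A p) * c 0 p (V p)))"
    unfolding O'_def[abs_def]
    by (subst tangent_deriv_mult[OF smooth_map_const _ Ap],
        intro smooth_map_mult smooth_map_minus s,
        subst tangent_deriv_diff[OF smooth_map_mult[OF s(1,4)] smooth_map_mult[OF s(2,3)] Ap])
       (simp add: tangent_deriv_const[OF Ap, of _ w]
        tangent_deriv_mult[OF s(1,4) Ap] tangent_deriv_mult[OF s(2,3) Ap] del: One_nat_def)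
  note cc = coord_conn_cases[OF A U p] coord_conn_cases[OF A V p] coord_conn_cases[OF A W p]
  show "D A ?R p - curvature S D (D A U) V W p - curvature S D U (D A V) W p
      - curvature S D U V (D A W) p = 0"
  proof (rule tangent_eqI[OF p])
    show "D A ?R p - curvature S D (D A U) V W p - curvature S D U (D A V) W p
      - curvature S D U V (D A W) p \<in> tangent_space S p"
      using vector_fieldD(2)[OF R1 p] vector_fieldD(2)[OF R2 p] vector_fieldD(2)[OF R3 p]
        vector_fieldD(2)[OF conn_field[OF A R] p] tangent_subspace[OF p]
      by (simp add: subspace_diff)
    show "0 \<in> tangent_space S p" using tangent_subspace[OF p] by (rule subspace_0)
    fix k assume k: "k < n"
    have split: "c k p (D A ?R p - curvature S D (D A U) V W p - curvature S D U (D A V) W p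
      - curvature S D U V (D A W) p) = c k p (D A ?R p) - c k p (curvature S D (D A U) V W p)
      - c k p (curvature S D U (D A V) W p) - c k p (curvature S D U V (D A W) p)"
      using coord_linear[OF p k] by (simp add: linear_diff)
    have zero: "c k p 0 = 0" using coord_linear[OF p k] by (rule linear_0)
    note curv = cR[OF conn_field[OF A U] V W p k] cR[OF U conn_field[OF A V] W p k]
      cR[OF U V conn_field[OF A W] p k]
    have c0R: "c 0 q (?R q) = (- O' q) * c 1 q (W q)" and c1R: "c 1 q (?R q) = O' q * c 0 q (W q)" if "q \<in> S" for q
      using that cR[OF U V W that] n_pos coord_J[OF that] by (simp_all add: O'_def)
    have m1: "tangent_deriv S (\<lambda>q. c 1 q (?R q)) p (A p) =
        O' p * tangent_deriv S (\<lambda>q. c 0 q (W q)) p (A p) + tangent_deriv S O' p (A p) * c 0 p (W p)"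
      using tangent_deriv_cong[of S "\<lambda>q. c 1 q (?R q)" "\<lambda>q. O' q * c 0 q (W q)", OF c1R]
        tangent_deriv_mult[OF sO s(5) Ap] by simp
    have "tangent_deriv S (\<lambda>q. c 0 q (?R q)) p (A p) = tangent_deriv S (\<lambda>q. 0 - O' q * c 1 q (W q)) p (A p)"
      by (rule tangent_deriv_cong) (simp add: c0R)
    also have "\<dots> = - (O' p * tangent_deriv S (\<lambda>q. c 1 q (W q)) p (A p) + tangent_deriv S O' p (A p) * c 1 p (W p))"
      by (subst tangent_deriv_diff[OF smooth_map_const smooth_map_mult[OF sO s(6)] Ap])
         (simp add: tangent_deriv_const[OF Ap, of _ 0] tangent_deriv_mult[OF sO s(6) Ap] del: One_nat_def)
    finally have m0: "tangent_deriv S (\<lambda>q. c 0 q (?R q)) p (A p) =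
        - (O' p * tangent_deriv S (\<lambda>q. c 1 q (W q)) p (A p) + tangent_deriv S O' p (A p) * c 1 p (W p))" .
    consider "k = 0" | "k = 1" | "2 \<le> k" by linarith
    then show "c k p (D A ?R p - curvature S D (D A U) V W p - curvature S D U (D A V) W p
      - curvature S D U V (D A W) p) = c k p 0"
    proof cases
      case 1
      show ?thesis
        unfolding split zero curv unfolding 1 coord_conn_cases(1)[OF A R p] m0 dO c1R[OF p]
          coord_J[OF p n_pos(1)] cc
        by (simp add: O'_def algebra_simps)
    next
      case 2
      show ?thesis
        unfolding split zero curv unfolding 2 coord_conn_cases(2)[OF A R p] m1 dO c0R[OF p]
          coord_J[OF p n_pos(2)] cc
        by (simp add: O'_def algebra_simps)
    next
      case 3
      have "tangent_deriv S (\<lambda>q. c k q (?R q)) p (A p) = 0"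
        by (rule tangent_deriv_const[OF Ap, of _ 0]) (use 3 in \<open>simp add: cR[OF U V W _ k] coord_J k\<close>)
      then show ?thesis
        unfolding split zero curv coord_conn_cases(3)[OF A R p 3 k] using 3 by (simp add: coord_J[OF p k])
    qed
  qed
qed

end

section \<open>Upper bound for the holonomy\<close>

lemma piecewise_smooth_loop_continuous:
  assumes "piecewise_smooth_loop S p \<gamma>"
  shows "continuous_on {0..1} \<gamma>"
proof -
  obtain m s where s: "s 0 = (0::real)" "s m = 1"
    "\<And>i. i < m \<Longrightarrow> s i < s (Suc i)" "\<And>i. i < m \<Longrightarrow> smooth_map {s i..s (Suc i)} \<gamma>"
    using assms unfolding piecewise_smooth_loop_def by blast
  have "i \<le> m \<Longrightarrow> 0 \<le> s i \<and> continuous_on {0..s i} \<gamma>" for i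
  proof (induction i)
    case 0
    then show ?case by (simp add: s(1))
  next
    case (Suc i)
    then have IH: "0 \<le> s i" "continuous_on {0..s i} \<gamma>" and i: "i < m" by simp_all
    have "{0..s (Suc i)} = {0..s i} \<union> {s i..s (Suc i)}"
      using IH(1) s(3)[OF i] by (simp add: ivl_disj_un_two_touch)
    then show ?case
      using IH s(3)[OF i] smooth_map_imp_continuous_on[OF s(4)[OF i]]
      by (simp add: continuous_on_closed_Un)
  qed
  from this[of m] show ?thesis by (simp add: s(2))
qed

text \<open>This differentiates \<open>exp (t A) v\<close> at \<open>t = 0\<close> one coordinate at a time.\<close>

lemma exponential_series_derivative:
  fixes f :: "real \<Rightarrow> real"
  assumes "\<And>t. (\<lambda>n. t ^ n / fact n * d n) sums f t"
  shows "f 0 = d 0" "(f has_real_derivative d 1) (at 0)"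
proof -
  define a where "a n = d n / fact n" for n
  have a: "(\<lambda>n. a n * t ^ n) sums f t" for t
    using assms[of t] by (simp add: a_def mult.commute)
  then have f: "f = (\<lambda>t. \<Sum>n. a n * t ^ n)" by (simp add: sums_iff fun_eq_iff)
  show "f 0 = d 0" unfolding f by (simp add: powser_zero) (simp add: a_def)
  have "((\<lambda>t. \<Sum>n. a n * t ^ n) has_real_derivative (\<Sum>n. diffs a n * 0 ^ n)) (at 0)"
    using a by (intro termdiffs_strong_converges_everywhere) (simp add: sums_iff)
  then show "(f has_real_derivative d 1) (at 0)"
    unfolding f powser_zero by (simp add: diffs_def a_def)
qed

context rotating_connection
begin

lemma linear_J: "p \<in> S \<Longrightarrow> linear (J p)"
  using coord_linear[of p 0] coord_linear[of p 1] n_pos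
  by (intro linearI) (simp_all add: J_def linear_add linear_cmul algebra_simps)

lemma J_J: "p \<in> S \<Longrightarrow> J p (J p v) = - (c 0 p v *\<^sub>R E 0 p + c 1 p v *\<^sub>R E 1 p)"
  using coord_J[of p 0 v] coord_J[of p 1 v] n_pos by (simp add: J_def[of p "J p v"])

lemma J_J_J:
  assumes p: "p \<in> S"
  shows "J p (J p (J p v)) = - J p v"
  unfolding J_J[OF p, of "J p v"] coord_J[OF p n_pos(1)] coord_J[OF p n_pos(2)] by (simp add: J_def)

lemma field_through:
  assumes "p \<in> S" "v \<in> tangent_space S p"
  obtains U where "vector_field S U" "U p = v"
  using that[of "\<lambda>q. \<Sum>k<n. c k p v *\<^sub>R E k q"] coord_expand[OF assms]
    combination_field[of "\<lambda>k q. c k p v"] by (simp add: smooth_map_const)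

text \<open>The description operator in \<open>covariant_deriv_at\<close> is meaningful because \<open>D U W p\<close> depends on \<open>U\<close>
  only through \<open>U p\<close>.\<close>

lemma covariant_deriv_at_field:
  assumes U: "vector_field S U" and W: "vector_field S W" and p: "p \<in> S"
  shows "covariant_deriv_at S D p (U p) W = D U W p"
  unfolding covariant_deriv_at_def
proof (rule the_equality)
  show "\<forall>U'. vector_field S U' \<and> U' p = U p \<longrightarrow> D U' W p = D U W p"
    using conn_expand_left[OF _ W p] U by simp
qed (use U in blast)

lemma coord_covariant_deriv_at:
  assumes v: "v \<in> tangent_space S p" and W: "vector_field S W" and p: "p \<in> S" and k: "k < n"
  shows "covariant_deriv_at S D p v W \<in> tangent_space S p"
    "c k p (covariant_deriv_at S D p v W) =
      tangent_deriv S (\<lambda>q. c k q (W q)) p v + \<omega> p v * c k p (J p (W p))"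
proof -
  obtain U where U: "vector_field S U" "U p = v" by (rule field_through[OF p v])
  have eq: "covariant_deriv_at S D p v W = D U W p"
    using covariant_deriv_at_field[OF U(1) W p] U(2) by simp
  show "covariant_deriv_at S D p v W \<in> tangent_space S p"
    using vector_fieldD(2)[OF conn_field[OF U(1) W] p] eq by simp
  show "c k p (covariant_deriv_at S D p v W) =
      tangent_deriv S (\<lambda>q. c k q (W q)) p v + \<omega> p v * c k p (J p (W p))"
    unfolding eq coord_conn[OF U(1) W p k] U(2) ..
qed

text \<open>Rewriting the representation \<open>V = (\<Sum>j. a\<^sub>j W\<^sub>j)\<close> in the frame yields the linear system
  \<open>v\<^sub>k' = - l (J V)\<^sub>k\<close>, where \<open>l\<close> is the value of \<open>\<omega>\<close> on the velocity of the curve.\<close>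

lemma parallel_coords:
  assumes par: "parallel_along S D \<gamma> V" and cont: "continuous_on {0..1} \<gamma>"
    and S: "\<And>t. t \<in> {0..1} \<Longrightarrow> \<gamma> t \<in> S"
  shows "\<exists>K. finite K \<and> (\<forall>k<n. continuous_on {0..1} (\<lambda>t. c k (\<gamma> t) (V t))) \<and>
    (\<forall>t\<in>{0<..<1} - K. \<exists>l. \<forall>k<n. ((\<lambda>t. c k (\<gamma> t) (V t)) has_real_derivative
        - l * c k (\<gamma> t) (J (\<gamma> t) (V t))) (at t))"
proof -
  obtain m W a K where K: "finite K" and W: "\<And>j. j < (m::nat) \<Longrightarrow> vector_field S (W j)"
    and a: "\<And>j. j < m \<Longrightarrow> continuous_on {0..1} (a j)"
    and V: "\<And>t. t \<in> {0..1} \<Longrightarrow> V t = (\<Sum>j<m. a j t *\<^sub>R W j (\<gamma> t))"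
    and par': "\<And>t. t \<in> {0..1} - K \<Longrightarrow> \<exists>\<gamma>' a'. (\<gamma> has_vector_derivative \<gamma>') (at t) \<and>
           (\<forall>j<m. (a j has_real_derivative a' j) (at t)) \<and>
           (\<Sum>j<m. a' j *\<^sub>R W j (\<gamma> t) + a j t *\<^sub>R covariant_deriv_at S D (\<gamma> t) \<gamma>' (W j)) = 0"
    using par unfolding parallel_along_def by blast
  have cV: "c k (\<gamma> t) (V t) = (\<Sum>j<m. a j t * c k (\<gamma> t) (W j (\<gamma> t)))" if "t \<in> {0..1}" "k < n" for k t
    using coord_linear[OF S that(2)] that by (simp add: V linear_sum linear_cmul)
  show ?thesis
  proof (intro exI[of _ K] conjI K allI impI ballI)
    fix k assume k: "k < n"
    have "continuous_on {0..1} (\<lambda>t. c k (\<gamma> t) (W j (\<gamma> t)))" if "j < m" for j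
      using S by (intro continuous_on_compose2[OF smooth_map_imp_continuous_on[OF coord_smooth[OF W[OF that] k]] cont]) auto
    then have "continuous_on {0..1} (\<lambda>t. \<Sum>j<m. a j t * c k (\<gamma> t) (W j (\<gamma> t)))"
      using a by (intro continuous_on_sum continuous_on_mult) simp_all
    then show "continuous_on {0..1} (\<lambda>t. c k (\<gamma> t) (V t))"
      by (rule continuous_on_eq) (use cV k in simp)
  next
    fix t assume t: "t \<in> {0<..<1} - K"
    then have t01: "t \<in> {0..1}" by simp
    obtain \<gamma>' a' where \<gamma>': "(\<gamma> has_vector_derivative \<gamma>') (at t)"
      and a': "\<And>j. j < m \<Longrightarrow> (a j has_real_derivative a' j) (at t)"
      and zero: "(\<Sum>j<m. a' j *\<^sub>R W j (\<gamma> t) + a j t *\<^sub>R covariant_deriv_at S D (\<gamma> t) \<gamma>' (W j)) = 0"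
      using par'[of t] t by force
    have ev: "\<forall>\<^sub>F s in nhds t. \<gamma> s \<in> S"
      unfolding eventually_nhds using t S by (intro exI[of _ "{0<..<1}"]) simp
    note \<gamma>'T = tangent_space_curve[OF \<gamma>' ev] and p = S[OF t01]
    have "((\<lambda>t. c k (\<gamma> t) (V t)) has_real_derivative
        - \<omega> (\<gamma> t) \<gamma>' * c k (\<gamma> t) (J (\<gamma> t) (V t))) (at t)" if k: "k < n" for k
    proof -
      let ?w = "\<lambda>j. c k (\<gamma> t) (W j (\<gamma> t))" and ?dw = "\<lambda>j. tangent_deriv S (\<lambda>q. c k q (W j q)) (\<gamma> t) \<gamma>'"
      have "((\<lambda>t. c k (\<gamma> t) (W j (\<gamma> t))) has_real_derivative ?dw j) (at t)" if "j < m" for j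
        unfolding has_real_derivative_iff_has_vector_derivative
        by (rule has_vector_derivative_along[OF coord_smooth[OF W[OF that] k] \<gamma>' ev])
      then have "((\<lambda>t. \<Sum>j<m. a j t * c k (\<gamma> t) (W j (\<gamma> t))) has_real_derivative
          (\<Sum>j<m. a' j * ?w j + ?dw j * a j t)) (at t)"
        using a' by (intro DERIV_sum DERIV_mult) simp_all
      moreover have "(\<Sum>j<m. a' j * ?w j + ?dw j * a j t) = - \<omega> (\<gamma> t) \<gamma>' * c k (\<gamma> t) (J (\<gamma> t) (V t))"
      proof -
        have "0 = c k (\<gamma> t) (\<Sum>j<m. a' j *\<^sub>R W j (\<gamma> t) + a j t *\<^sub>R covariant_deriv_at S D (\<gamma> t) \<gamma>' (W j))"
          unfolding zero using coord_linear[OF p k] by (simp add: linear_0)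
        also have "\<dots> = (\<Sum>j<m. a' j * ?w j + a j t * (?dw j + \<omega> (\<gamma> t) \<gamma>' * c k (\<gamma> t) (J (\<gamma> t) (W j (\<gamma> t)))))"
          using coord_linear[OF p k] coord_covariant_deriv_at(2)[OF \<gamma>'T W p k]
          by (simp add: linear_sum linear_add linear_cmul)
        also have "\<dots> = (\<Sum>j<m. a' j * ?w j + ?dw j * a j t)
            + \<omega> (\<gamma> t) \<gamma>' * (\<Sum>j<m. a j t * c k (\<gamma> t) (J (\<gamma> t) (W j (\<gamma> t))))"
          by (simp add: sum.distrib sum_distrib_left algebra_simps)
        also have "(\<Sum>j<m. a j t * c k (\<gamma> t) (J (\<gamma> t) (W j (\<gamma> t)))) = c k (\<gamma> t) (J (\<gamma> t) (V t))"
          using coord_linear[OF p k] linear_J[OF p] by (simp add: V[OF t01] linear_sum linear_cmul)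
        finally show ?thesis by simp
      qed
      ultimately have d: "((\<lambda>t. \<Sum>j<m. a j t * c k (\<gamma> t) (W j (\<gamma> t))) has_real_derivative
          - \<omega> (\<gamma> t) \<gamma>' * c k (\<gamma> t) (J (\<gamma> t) (V t))) (at t)" by simp
      show ?thesis
        by (rule has_field_derivative_transform_within_open[OF d, of "{0<..<1}"]) (use t cV k in simp_all)
    qed
    then show "\<exists>l. \<forall>k<n. ((\<lambda>t. c k (\<gamma> t) (V t)) has_real_derivative
        - l * c k (\<gamma> t) (J (\<gamma> t) (V t))) (at t)" by blast
  qed
qed

lemma constant_of_zero_derivative:
  fixes f :: "real \<Rightarrow> real"
  assumes "finite K" "continuous_on {0..1} f"
    "\<And>t. t \<in> {0<..<1} - K \<Longrightarrow> (f has_real_derivative 0) (at t)"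
  shows "f 1 = f 0"
proof (rule has_derivative_zero_unique_strong_interval[of "insert 0 (insert 1 K)" 0 1 f])
  fix x assume "x \<in> {0..1} - insert 0 (insert 1 K)"
  then have "x \<in> {0<..<1} - K" by auto
  from assms(3)[OF this] have "(f has_derivative (\<lambda>h. 0)) (at x)"
    by (simp add: has_field_derivative_def lambda_zero)
  then show "(f has_derivative (\<lambda>h. 0)) (at x within {0..1})"
    by (rule has_derivative_at_withinI)
next
  show "finite (insert 0 (insert 1 K))" using assms(1) by simp
qed (simp_all add: assms(2))

text \<open>The linear system rotates the first two coordinates into each other, so it preserves the sum of
  their squares, and it leaves the others constant.\<close>

lemma parallel_conserved:
  assumes par: "parallel_along S D \<gamma> V" and cont: "continuous_on {0..1} \<gamma>"
    and S: "\<And>t. t \<in> {0..1} \<Longrightarrow> \<gamma> t \<in> S"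
  shows "2 \<le> k \<Longrightarrow> k < n \<Longrightarrow> c k (\<gamma> 1) (V 1) = c k (\<gamma> 0) (V 0)"
    and "(c 0 (\<gamma> 1) (V 1))\<^sup>2 + (c 1 (\<gamma> 1) (V 1))\<^sup>2 = (c 0 (\<gamma> 0) (V 0))\<^sup>2 + (c 1 (\<gamma> 0) (V 0))\<^sup>2"
proof -
  from parallel_coords[OF par cont S] obtain K where
    "finite K \<and> (\<forall>k<n. continuous_on {0..1} (\<lambda>t. c k (\<gamma> t) (V t))) \<and>
    (\<forall>t\<in>{0<..<1} - K. \<exists>l. \<forall>k<n. ((\<lambda>t. c k (\<gamma> t) (V t)) has_real_derivative
        - l * c k (\<gamma> t) (J (\<gamma> t) (V t))) (at t))" ..
  then have K: "finite K"
    and cv: "\<And>k. k < n \<Longrightarrow> continuous_on {0..1} (\<lambda>t. c k (\<gamma> t) (V t))"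
    and d: "\<And>t. t \<in> {0<..<1} - K \<Longrightarrow> \<exists>l. \<forall>k<n. ((\<lambda>t. c k (\<gamma> t) (V t)) has_real_derivative
        - l * c k (\<gamma> t) (J (\<gamma> t) (V t))) (at t)"
    by simp_all
  {
    assume k: "2 \<le> k" "k < n"
    show "c k (\<gamma> 1) (V 1) = c k (\<gamma> 0) (V 0)"
    proof (rule constant_of_zero_derivative[OF K cv[OF k(2)]])
      fix t assume t: "t \<in> {0<..<1} - K"
      then have "c k (\<gamma> t) (J (\<gamma> t) (V t)) = 0" using coord_J[OF S k(2), of t] k by simp
      then show "((\<lambda>t. c k (\<gamma> t) (V t)) has_real_derivative 0) (at t)"
        using d[OF t] k(2) by auto
    qed
  }
  have "(\<lambda>t. (c 0 (\<gamma> t) (V t))\<^sup>2 + (c 1 (\<gamma> t) (V t))\<^sup>2) 1 = (\<lambda>t. (c 0 (\<gamma> t) (V t))\<^sup>2 + (c 1 (\<gamma> t) (V t))\<^sup>2) 0"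
  proof (rule constant_of_zero_derivative[OF K])
    show "continuous_on {0..1} (\<lambda>t. (c 0 (\<gamma> t) (V t))\<^sup>2 + (c 1 (\<gamma> t) (V t))\<^sup>2)"
      by (intro continuous_on_add continuous_on_power cv n_pos)
    fix t assume t: "t \<in> {0<..<1} - K"
    then have p: "\<gamma> t \<in> S" using S by simp
    obtain l where l: "\<And>k. k < n \<Longrightarrow> ((\<lambda>t. c k (\<gamma> t) (V t)) has_real_derivative
        - l * c k (\<gamma> t) (J (\<gamma> t) (V t))) (at t)"
      using d[OF t] by blast
    have "((\<lambda>t. c 0 (\<gamma> t) (V t)) has_real_derivative l * c 1 (\<gamma> t) (V t)) (at t)"
      "((\<lambda>t. c 1 (\<gamma> t) (V t)) has_real_derivative - l * c 0 (\<gamma> t) (V t)) (at t)"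
      using l[OF n_pos(1)] l[OF n_pos(2)] unfolding coord_J[OF p n_pos(1)] coord_J[OF p n_pos(2)] by simp_all
    then show "((\<lambda>t. (c 0 (\<gamma> t) (V t))\<^sup>2 + (c 1 (\<gamma> t) (V t))\<^sup>2) has_real_derivative 0) (at t)"
      by (auto intro!: derivative_eq_intros simp del: One_nat_def)
  qed
  then show "(c 0 (\<gamma> 1) (V 1))\<^sup>2 + (c 1 (\<gamma> 1) (V 1))\<^sup>2 = (c 0 (\<gamma> 0) (V 0))\<^sup>2 + (c 1 (\<gamma> 0) (V 0))\<^sup>2" .
qed

lemma holonomy_group_conserves:
  assumes B: "B \<in> holonomy_group S D p" and v: "v \<in> tangent_space S p"
  shows "2 \<le> k \<Longrightarrow> k < n \<Longrightarrow> c k p (blinfun_apply B v) = c k p v"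
    and "(c 0 p (blinfun_apply B v))\<^sup>2 + (c 1 p (blinfun_apply B v))\<^sup>2 = (c 0 p v)\<^sup>2 + (c 1 p v)\<^sup>2"
proof -
  obtain \<gamma> V where \<gamma>: "piecewise_smooth_loop S p \<gamma>" and V: "parallel_along S D \<gamma> V"
    "V 0 = v" "V 1 = blinfun_apply B v"
    using B v unfolding holonomy_group_def by blast
  have g: "\<gamma> 0 = p" "\<gamma> 1 = p" "\<And>t. t \<in> {0..1} \<Longrightarrow> \<gamma> t \<in> S"
    using \<gamma> by (auto simp: piecewise_smooth_loop_def)
  note cons = parallel_conserved[OF V(1) piecewise_smooth_loop_continuous[OF \<gamma>] g(3)]
  show "2 \<le> k \<Longrightarrow> k < n \<Longrightarrow> c k p (blinfun_apply B v) = c k p v"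
    using cons(1)[of k] g V by simp
  show "(c 0 p (blinfun_apply B v))\<^sup>2 + (c 1 p (blinfun_apply B v))\<^sup>2 = (c 0 p v)\<^sup>2 + (c 1 p v)\<^sup>2"
    using cons(2) g V by simp
qed

text \<open>The conserved quantities of the holonomy group are evaluated on \<open>exp (t A) v\<close> and differentiated
  at \<open>t = 0\<close>.\<close>

lemma holonomy_algebra_infinitesimal:
  assumes A: "A \<in> holonomy_algebra S D p" and v: "v \<in> tangent_space S p" and p: "p \<in> S"
  shows "2 \<le> k \<Longrightarrow> k < n \<Longrightarrow> c k p (blinfun_apply A v) = 0"
    and "c 0 p v * c 0 p (blinfun_apply A v) + c 1 p v * c 1 p (blinfun_apply A v) = 0"
proof -
  obtain B where B: "\<And>t. B t \<in> holonomy_group S D p"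
    and sB: "\<And>t v. v \<in> tangent_space S p \<Longrightarrow>
       (\<lambda>n. (t ^ n / fact n) *\<^sub>R (blinfun_apply A ^^ n) v) sums blinfun_apply (B t) v"
  proof -
    have "\<forall>t::real. \<exists>B. B \<in> holonomy_group S D p \<and> (\<forall>v\<in>tangent_space S p.
        (\<lambda>n. (t ^ n / fact n) *\<^sub>R (blinfun_apply A ^^ n) v) sums blinfun_apply B v)"
      using A unfolding holonomy_algebra_def by blast
    from choice[OF this] show ?thesis using that by blast
  qed
  define f where "f k t = c k p (blinfun_apply (B t) v)" for k t
  have ser: "(\<lambda>m. t ^ m / fact m * c k p ((blinfun_apply A ^^ m) v)) sums f k t" if k: "k < n" for k t
  proof -
    have bl: "bounded_linear (c k p)" using coord_linear[OF p k] by (simp add: linear_conv_bounded_linear)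
    show ?thesis
      using bounded_linear.sums[OF bl sB[OF v, of t]] coord_linear[OF p k]
      by (simp add: f_def linear_cmul)
  qed
  note f = exponential_series_derivative[OF ser]
  {
    assume k: "2 \<le> k" "k < n"
    have "f k = (\<lambda>t. c k p v)"
      using holonomy_group_conserves(1)[OF B v k] by (simp add: f_def fun_eq_iff)
    then have "(f k has_real_derivative 0) (at 0)" by simp
    from DERIV_unique[OF f(2)[OF k(2)] this] show "c k p (blinfun_apply A v) = 0" by simp
  }
  have "(\<lambda>t. (f 0 t)\<^sup>2 + (f 1 t)\<^sup>2) = (\<lambda>t. (c 0 p v)\<^sup>2 + (c 1 p v)\<^sup>2)"
    using holonomy_group_conserves(2)[OF B v] by (simp add: f_def fun_eq_iff)
  then have "((\<lambda>t. (f 0 t)\<^sup>2 + (f 1 t)\<^sup>2) has_real_derivative 0) (at 0)" by simp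
  moreover have "((\<lambda>t. (f 0 t)\<^sup>2 + (f 1 t)\<^sup>2) has_real_derivative
      2 * f 0 0 * c 0 p (blinfun_apply A v) + 2 * f 1 0 * c 1 p (blinfun_apply A v)) (at 0)"
    using f(2)[OF n_pos(1)] f(2)[OF n_pos(2)] by (auto intro!: derivative_eq_intros)
  ultimately show "c 0 p v * c 0 p (blinfun_apply A v) + c 1 p v * c 1 p (blinfun_apply A v) = 0"
    using f(1)[OF n_pos(1)] f(1)[OF n_pos(2)] by (auto dest: DERIV_unique)
qed

text \<open>The infinitesimal conservation laws say that \<open>A\<close> takes values in the plane and is skew on it.
  Applying them to \<open>E 0 + w\<close> and \<open>E 1 + w\<close>, with \<open>w\<close> transversal to the plane, shows that \<open>A\<close> kills \<open>w\<close>.\<close>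

lemma holonomy_algebra_multiple:
  assumes A: "A \<in> holonomy_algebra S D p" and p: "p \<in> S"
  shows "\<exists>\<beta>. \<forall>v\<in>tangent_space S p. blinfun_apply A v = \<beta> *\<^sub>R J p v"
proof -
  let ?T = "tangent_space S p" and ?A = "blinfun_apply A"
  note inf = holonomy_algebra_infinitesimal[OF A _ p]
  note lin = coord_linear[OF p n_pos(1)] coord_linear[OF p n_pos(2)]
  have E: "E 0 p \<in> ?T" "E 1 p \<in> ?T" using frame_tangent[OF p] n_pos by auto
  have cE: "c 0 p (E 0 p) = 1" "c 1 p (E 0 p) = 0" "c 0 p (E 1 p) = 0" "c 1 p (E 1 p) = 1"
    using coord_frame[OF p] n_pos by auto
  have add: "u + w \<in> ?T" if "u \<in> ?T" "w \<in> ?T" for u w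
    using tangent_subspace[OF p] that by (rule subspace_add)
  define \<beta> where "\<beta> = c 1 p (?A (E 0 p))"
  have 1: "c 0 p (?A (E 0 p)) = 0" "c 1 p (?A (E 1 p)) = 0"
    using inf(2)[OF E(1)] inf(2)[OF E(2)] by (simp_all add: cE del: One_nat_def)
  have 2: "c 0 p (?A (E 1 p)) = - \<beta>"
    using inf(2)[OF add[OF E]] 1
    by (simp add: cE \<beta>_def blinfun.add_right linear_add[OF lin(1)] linear_add[OF lin(2)] del: One_nat_def)
  have "?A v = \<beta> *\<^sub>R J p v" if v: "v \<in> ?T" for v
  proof -
    define w where "w = v - (c 0 p v *\<^sub>R E 0 p + c 1 p v *\<^sub>R E 1 p)"
    have w: "w \<in> ?T"
      unfolding w_def using tangent_subspace[OF p] v E by (simp add: subspace_diff subspace_add subspace_scale)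
    have cw: "c 0 p w = 0" "c 1 p w = 0"
      unfolding w_def
      by (simp_all add: linear_diff[OF lin(1)] linear_diff[OF lin(2)] linear_add[OF lin(1)] linear_add[OF lin(2)]
          linear_cmul[OF lin(1)] linear_cmul[OF lin(2)] cE del: One_nat_def)
    have cAw: "c 0 p (?A w) = 0" "c 1 p (?A w) = 0"
      using inf(2)[OF add[OF E(1) w]] inf(2)[OF add[OF E(2) w]] 1
      by (simp_all add: cE cw blinfun.add_right linear_add[OF lin(1)] linear_add[OF lin(2)] del: One_nat_def)
    have v': "v = c 0 p v *\<^sub>R E 0 p + c 1 p v *\<^sub>R E 1 p + w" by (simp add: w_def)
    have Av: "?A v = c 0 p v *\<^sub>R ?A (E 0 p) + c 1 p v *\<^sub>R ?A (E 1 p) + ?A w"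
      by (subst v') (simp only: blinfun.add_right blinfun.scaleR_right)
    show ?thesis
    proof (rule tangent_eqI[OF p])
      show "?A v \<in> ?T" using A v by (auto simp: holonomy_algebra_def tangent_endos_def)
      show "\<beta> *\<^sub>R J p v \<in> ?T" using tangent_subspace[OF p] J_tangent[OF p] by (simp add: subspace_scale)
      fix k assume k: "k < n"
      have rhs: "c k p (\<beta> *\<^sub>R J p v) = \<beta> * c k p (J p v)"
        using coord_linear[OF p k] by (simp add: linear_cmul)
      consider "k = 0" | "k = 1" | "2 \<le> k" by linarith
      then show "c k p (?A v) = c k p (\<beta> *\<^sub>R J p v)"
      proof cases
        case 1
        then show ?thesis unfolding rhs unfolding Av
          by (simp add: coord_J[OF p n_pos(1)] linear_add[OF lin(1)] linear_cmul[OF lin(1)]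
              \<open>c 0 p (?A (E 0 p)) = 0\<close> 2 cAw del: One_nat_def)
      next
        case 2
        then show ?thesis unfolding rhs unfolding Av
          by (simp add: coord_J[OF p n_pos(2)] linear_add[OF lin(2)] linear_cmul[OF lin(2)]
              1 \<beta>_def[symmetric] cAw del: One_nat_def)
      next
        case 3
        then show ?thesis unfolding rhs using inf(1)[OF v 3 k] coord_J[OF p k] by simp
      qed
    qed
  qed
  then show ?thesis by blast
qed

end

section \<open>Endomorphisms of a tangent space\<close>

context moving_frame
begin

text \<open>Riesz representation inside the tangent space: the component of the representing vector
  orthogonal to the tangent space is discarded. Functionals of this form vanish on the orthogonal
  complement, as membership in \<open>tangent_endos\<close> requires.\<close>

lemma tangent_representative:
  assumes p: "p \<in> S" and k: "k < n"
  obtains r where "r \<in> tangent_space S p" "\<And>v. v \<in> tangent_space S p \<Longrightarrow> r \<bullet> v = c k p v"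
proof -
  let ?r = "\<Sum>b\<in>Basis. c k p b *\<^sub>R b"
  have r: "?r \<bullet> v = c k p v" for v
  proof -
    have "c k p (\<Sum>b\<in>Basis. (v \<bullet> b) *\<^sub>R b) = (\<Sum>b\<in>Basis. (v \<bullet> b) * c k p b)"
      using coord_linear[OF p k] by (simp only: linear_sum linear_cmul real_scaleR_def)
    then have "c k p v = (\<Sum>b\<in>Basis. (v \<bullet> b) * c k p b)"
      unfolding euclidean_representation .
    also have "\<dots> = ?r \<bullet> v"
      unfolding inner_sum_left by (intro sum.cong) (simp_all add: inner_commute)
    finally show ?thesis ..
  qed
  obtain y z where y: "y \<in> span (tangent_space S p)"
    and z: "\<And>w. w \<in> span (tangent_space S p) \<Longrightarrow> orthogonal z w" and yz: "?r = y + z"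
    by (rule orthogonal_subspace_decomp_exists[of "tangent_space S p" ?r]) blast
  have span: "span (tangent_space S p) = tangent_space S p"
    using tangent_subspace[OF p] by (rule span_eq_iff[THEN iffD2])
  show thesis
  proof (rule that)
    show "y \<in> tangent_space S p" using y unfolding span .
    fix v assume "v \<in> tangent_space S p"
    then have "z \<bullet> v = 0" using z unfolding span orthogonal_def by blast
    then show "y \<bullet> v = c k p v"
      using r[of v] unfolding yz by (simp add: inner_add_left)
  qed
qed

lemma tangent_endo_exists:
  assumes p: "p \<in> S" and f: "linear f" "\<And>v. v \<in> tangent_space S p \<Longrightarrow> f v \<in> tangent_space S p"
  shows "\<exists>A\<in>tangent_endos S p. \<forall>v\<in>tangent_space S p. blinfun_apply A v = f v"
proof -
  let ?T = "tangent_space S p"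
  have "\<forall>k. \<exists>r. k < n \<longrightarrow> r \<in> ?T \<and> (\<forall>v\<in>?T. r \<bullet> v = c k p v)"
    using tangent_representative[OF p] by metis
  from choice[OF this] obtain r where r: "\<And>k. k < n \<Longrightarrow> r k \<in> ?T"
    "\<And>k v. k < n \<Longrightarrow> v \<in> ?T \<Longrightarrow> r k \<bullet> v = c k p v"
    by blast
  define A where "A = Blinfun (\<lambda>v. \<Sum>k<n. (r k \<bullet> v) *\<^sub>R f (E k p))"
  have "bounded_linear (\<lambda>v. \<Sum>k<n. (r k \<bullet> v) *\<^sub>R f (E k p))"
    by (intro bounded_linear_sum bounded_linear_scaleR_const bounded_linear_inner_right)
  then have A: "blinfun_apply A v = (\<Sum>k<n. (r k \<bullet> v) *\<^sub>R f (E k p))" for v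
    unfolding A_def by (simp add: bounded_linear_Blinfun_apply)
  have AT: "blinfun_apply A v = f v" if v: "v \<in> ?T" for v
  proof -
    have "f v = f (\<Sum>k<n. c k p v *\<^sub>R E k p)" using coord_expand[OF p v] by simp
    also have "\<dots> = (\<Sum>k<n. c k p v *\<^sub>R f (E k p))" using f(1) by (simp add: linear_sum linear_cmul)
    finally show ?thesis using r(2)[OF _ v] by (simp add: A)
  qed
  moreover have "A \<in> tangent_endos S p"
    unfolding tangent_endos_def using AT f(2) r(1) by (simp add: A)
  ultimately show ?thesis by blast
qed

lemma tangent_endo_eqI:
  assumes p: "p \<in> S" and A: "A \<in> tangent_endos S p" and B: "B \<in> tangent_endos S p"
    and eq: "\<And>v. v \<in> tangent_space S p \<Longrightarrow> blinfun_apply A v = blinfun_apply B v"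
  shows "A = B"
proof (rule blinfun_eqI)
  fix v
  obtain y z where y: "y \<in> span (tangent_space S p)"
    and z: "\<And>w. w \<in> span (tangent_space S p) \<Longrightarrow> orthogonal z w" and yz: "v = y + z"
    by (rule orthogonal_subspace_decomp_exists[of "tangent_space S p" v]) blast
  have span: "span (tangent_space S p) = tangent_space S p"
    using tangent_subspace[OF p] by (rule span_eq_iff[THEN iffD2])
  have "u \<bullet> z = 0" if "u \<in> tangent_space S p" for u
    using z[of u] that unfolding span orthogonal_def by (simp add: inner_commute)
  then have "blinfun_apply A z = 0" "blinfun_apply B z = 0"
    using A B unfolding tangent_endos_def by simp_all
  then show "blinfun_apply A v = blinfun_apply B v"
    using eq[of y] y unfolding span yz by (simp add: blinfun.add_right)
qed

end

section \<open>Rotations realised by loops\<close>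

context rotating_connection
begin

text \<open>Rodrigues' formula for the rotation \<open>exp (- \<theta> J)\<close>; the sign is chosen such that a curve along
  which \<open>\<omega>\<close> integrates to \<open>\<theta>\<close> transports by \<open>rot \<theta>\<close>.\<close>

definition rot :: "real \<Rightarrow> 'a \<Rightarrow> 'a \<Rightarrow> 'a" where
  "rot \<theta> p v = v + (1 - cos \<theta>) *\<^sub>R J p (J p v) - sin \<theta> *\<^sub>R J p v"

lemma linear_rot: "p \<in> S \<Longrightarrow> linear (rot \<theta> p)"
  using linear_J[of p]
  by (intro linearI) (simp_all add: rot_def linear_add linear_cmul algebra_simps)

lemma rot_tangent: "p \<in> S \<Longrightarrow> v \<in> tangent_space S p \<Longrightarrow> rot \<theta> p v \<in> tangent_space S p"
  using tangent_subspace[of p] J_tangent[of p] by (simp add: rot_def subspace_add subspace_diff subspace_scale)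

lemma coord_rot:
  assumes p: "p \<in> S"
  shows "c 0 p (rot \<theta> p v) = cos \<theta> * c 0 p v + sin \<theta> * c 1 p v"
    and "c 1 p (rot \<theta> p v) = cos \<theta> * c 1 p v - sin \<theta> * c 0 p v"
    and "2 \<le> k \<Longrightarrow> k < n \<Longrightarrow> c k p (rot \<theta> p v) = c k p v"
proof -
  have split: "c k p (rot \<theta> p v) = c k p v + (1 - cos \<theta>) * c k p (J p (J p v)) - sin \<theta> * c k p (J p v)"
    if "k < n" for k
    using coord_linear[OF p that] by (simp add: rot_def linear_add linear_diff linear_cmul)
  show "c 0 p (rot \<theta> p v) = cos \<theta> * c 0 p v + sin \<theta> * c 1 p v"
    "c 1 p (rot \<theta> p v) = cos \<theta> * c 1 p v - sin \<theta> * c 0 p v"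
    unfolding split[OF n_pos(1)] split[OF n_pos(2)] coord_J[OF p n_pos(1)] coord_J[OF p n_pos(2)]
    by (simp_all add: algebra_simps)
  show "c k p (rot \<theta> p v) = c k p v" if "2 \<le> k" "k < n"
    unfolding split[OF that(2)] using that by (simp add: coord_J[OF p that(2)])
qed

text \<open>With \<open>\<Theta>\<close> a primitive of \<open>\<omega>\<close> along the curve, the rotated coordinates solve the linear system of
  parallel transport.\<close>

lemma parallel_rot:
  assumes p: "p \<in> S" "v \<in> tangent_space S p" and S: "\<And>t. t \<in> {0..1} \<Longrightarrow> \<gamma> t \<in> S"
    and \<gamma>: "\<And>t. t \<in> {0..1} \<Longrightarrow> \<exists>\<gamma>'\<in>tangent_space S (\<gamma> t). (\<gamma> has_vector_derivative \<gamma>') (at t) \<and>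
        (\<Theta> has_real_derivative \<omega> (\<gamma> t) \<gamma>') (at t)"
  shows "parallel_along S D \<gamma> (\<lambda>t. \<Sum>k<n. c k p (rot (\<Theta> t) p v) *\<^sub>R E k (\<gamma> t))"
  unfolding parallel_along_def
proof (intro exI[of _ n] exI[of _ E] exI[of _ "\<lambda>k t. c k p (rot (\<Theta> t) p v)"] exI[of _ "{}"] conjI)
  let ?a = "\<lambda>k t. c k p (rot (\<Theta> t) p v)"
  \<comment> \<open>The derivative of the rotated coordinates with respect to the angle.\<close>
  define da where "da k t = (if k = 0 then ?a 1 t else if k = 1 then - ?a 0 t else 0)" for k :: nat and t
  have da: "(?a k has_real_derivative l * da k t) (at t)"
    if \<Theta>: "(\<Theta> has_real_derivative l) (at t)" and k: "k < n" for k t l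
  proof -
    consider "k = 0" | "k = 1" | "2 \<le> k" by linarith
    then show ?thesis
    proof cases
      case 1
      show ?thesis unfolding 1 da_def coord_rot[OF p(1)]
        using \<Theta> by (auto intro!: derivative_eq_intros simp: algebra_simps simp del: One_nat_def)
    next
      case 2
      show ?thesis unfolding 2 da_def coord_rot[OF p(1)]
        using \<Theta> by (auto intro!: derivative_eq_intros simp: algebra_simps simp del: One_nat_def)
    next
      case 3
      show ?thesis using 3 by (simp add: da_def coord_rot(3)[OF p(1) 3 k])
    qed
  qed
  have "continuous_on {0..1} \<Theta>"
    using \<gamma> DERIV_isCont by (intro continuous_at_imp_continuous_on ballI) blast
  then have "continuous_on {0..1} (?a k)" if "k < n" for k
    using coord_linear[OF p(1) that]
    by (auto simp: rot_def linear_add linear_diff linear_cmul intro!: continuous_intros)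
  then show "\<forall>k<n. vector_field S (E k) \<and> continuous_on {0..1} (?a k)"
    using frame_field by simp
  show "\<forall>t\<in>{0..1} - {}. \<exists>\<gamma>' a'. (\<gamma> has_vector_derivative \<gamma>') (at t) \<and>
      (\<forall>k<n. (?a k has_real_derivative a' k) (at t)) \<and>
      (\<Sum>k<n. a' k *\<^sub>R E k (\<gamma> t) + ?a k t *\<^sub>R covariant_deriv_at S D (\<gamma> t) \<gamma>' (E k)) = 0"
  proof
    fix t :: real assume "t \<in> {0..1} - {}"
    then have t: "t \<in> {0..1}" by simp
    note q = S[OF t]
    obtain \<gamma>' where \<gamma>': "\<gamma>' \<in> tangent_space S (\<gamma> t)" "(\<gamma> has_vector_derivative \<gamma>') (at t)"
      "(\<Theta> has_real_derivative \<omega> (\<gamma> t) \<gamma>') (at t)"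
      using \<gamma>[OF t] by blast
    let ?l = "\<omega> (\<gamma> t) \<gamma>'"
    have cov: "covariant_deriv_at S D (\<gamma> t) \<gamma>' (E k) = ?l *\<^sub>R J (\<gamma> t) (E k (\<gamma> t))" if k: "k < n" for k
    proof (rule tangent_eqI[OF q])
      show "covariant_deriv_at S D (\<gamma> t) \<gamma>' (E k) \<in> tangent_space S (\<gamma> t)"
        by (rule coord_covariant_deriv_at(1)[OF \<gamma>'(1) frame_field[OF k] q k])
      show "?l *\<^sub>R J (\<gamma> t) (E k (\<gamma> t)) \<in> tangent_space S (\<gamma> t)"
        using tangent_subspace[OF q] J_tangent[OF q] by (simp add: subspace_scale)
      fix j assume j: "j < n"
      have "tangent_deriv S (\<lambda>q. c j q (E k q)) (\<gamma> t) \<gamma>' = 0"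
        using coord_frame[OF _ k j] by (intro tangent_deriv_const[OF \<gamma>'(1)])
      then show "c j (\<gamma> t) (covariant_deriv_at S D (\<gamma> t) \<gamma>' (E k)) = c j (\<gamma> t) (?l *\<^sub>R J (\<gamma> t) (E k (\<gamma> t)))"
        unfolding coord_covariant_deriv_at(2)[OF \<gamma>'(1) frame_field[OF k] q j]
        using coord_linear[OF q j] by (simp add: linear_cmul)
    qed
    have "(\<Sum>k<n. ?a k t *\<^sub>R covariant_deriv_at S D (\<gamma> t) \<gamma>' (E k)) = ?l *\<^sub>R J (\<gamma> t) (\<Sum>k<n. ?a k t *\<^sub>R E k (\<gamma> t))"
      using linear_J[OF q] by (simp add: cov linear_sum linear_cmul scaleR_sum_right mult.commute)
    also have "J (\<gamma> t) (\<Sum>k<n. ?a k t *\<^sub>R E k (\<gamma> t)) = - (\<Sum>k<n. da k t *\<^sub>R E k (\<gamma> t))"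
    proof -
      have "(\<Sum>k<n. da k t *\<^sub>R E k (\<gamma> t)) = (\<Sum>k\<in>{0,1}. da k t *\<^sub>R E k (\<gamma> t))"
        using n2 by (intro sum.mono_neutral_right) (auto simp: da_def)
      then show ?thesis
        unfolding J_def coord_sum[OF q n_pos(1)] coord_sum[OF q n_pos(2)] by (simp add: da_def)
    qed
    finally have "(\<Sum>k<n. (?l * da k t) *\<^sub>R E k (\<gamma> t) + ?a k t *\<^sub>R covariant_deriv_at S D (\<gamma> t) \<gamma>' (E k)) = 0"
      by (simp add: sum.distrib scaleR_sum_right)
    then show "\<exists>\<gamma>' a'. (\<gamma> has_vector_derivative \<gamma>') (at t) \<and>
      (\<forall>k<n. (?a k has_real_derivative a' k) (at t)) \<and>
      (\<Sum>k<n. a' k *\<^sub>R E k (\<gamma> t) + ?a k t *\<^sub>R covariant_deriv_at S D (\<gamma> t) \<gamma>' (E k)) = 0"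
      using \<gamma>'(2) da[OF \<gamma>'(3)]
      by (intro exI[of _ \<gamma>'] exI[of _ "\<lambda>k. ?l * da k t"]) simp
  qed
qed simp_all

text \<open>A loop together with a primitive \<open>\<Theta>\<close> of \<open>\<omega>\<close> along it, so that \<open>\<theta>\<close> is the integral of \<open>\<omega>\<close> over the
  loop.\<close>

definition turning_loop :: "'a \<Rightarrow> real \<Rightarrow> (real \<Rightarrow> 'a) \<Rightarrow> bool" where
  "turning_loop p \<theta> \<gamma> \<longleftrightarrow> piecewise_smooth_loop S p \<gamma> \<and>
    (\<exists>\<Theta>. \<Theta> 0 = 0 \<and> \<Theta> 1 = \<theta> \<and>
      (\<forall>t\<in>{0..1}. \<exists>\<gamma>'\<in>tangent_space S (\<gamma> t). (\<gamma> has_vector_derivative \<gamma>') (at t) \<and>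
        (\<Theta> has_real_derivative \<omega> (\<gamma> t) \<gamma>') (at t)))"

lemma rot_in_holonomy_group:
  assumes p: "p \<in> S" and loop: "turning_loop p \<theta> \<gamma>"
  shows "\<exists>B\<in>holonomy_group S D p. \<forall>v\<in>tangent_space S p. blinfun_apply B v = rot \<theta> p v"
proof -
  obtain B where B: "B \<in> tangent_endos S p" "\<And>v. v \<in> tangent_space S p \<Longrightarrow> blinfun_apply B v = rot \<theta> p v"
    using tangent_endo_exists[OF p linear_rot[OF p, of \<theta>] rot_tangent[OF p]] by blast
  obtain \<Theta> where psl: "piecewise_smooth_loop S p \<gamma>" and \<Theta>: "\<Theta> 0 = 0" "\<Theta> 1 = \<theta>"
    "\<And>t. t \<in> {0..1} \<Longrightarrow> \<exists>\<gamma>'\<in>tangent_space S (\<gamma> t). (\<gamma> has_vector_derivative \<gamma>') (at t) \<and>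
        (\<Theta> has_real_derivative \<omega> (\<gamma> t) \<gamma>') (at t)"
    using loop unfolding turning_loop_def by blast
  have g: "\<gamma> 0 = p" "\<gamma> 1 = p" "\<And>t. t \<in> {0..1} \<Longrightarrow> \<gamma> t \<in> S"
    using psl by (auto simp: piecewise_smooth_loop_def)
  have "\<exists>V. parallel_along S D \<gamma> V \<and> V 0 = v \<and> V 1 = blinfun_apply B v" if v: "v \<in> tangent_space S p" for v
  proof -
    let ?V = "\<lambda>t. \<Sum>k<n. c k p (rot (\<Theta> t) p v) *\<^sub>R E k (\<gamma> t)"
    have "rot 0 p v = v" by (simp add: rot_def)
    then have "?V 0 = v" "?V 1 = blinfun_apply B v"
      using coord_expand[OF p v, symmetric] coord_expand[OF p rot_tangent[OF p v], symmetric]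
      by (simp_all add: g \<Theta> B(2)[OF v])
    then show ?thesis using parallel_rot[OF p v g(3) \<Theta>(3)] by (intro exI[of _ ?V]) simp
  qed
  then have "B \<in> holonomy_group S D p"
    unfolding holonomy_group_def using B(1) psl by blast
  then show ?thesis using B(2) by blast
qed

text \<open>Since \<open>J\<^sup>3 = -J\<close>, the powers of \<open>\<beta> J\<close> have period four up to scaling and the
  exponential series splits into the series of cosine and sine.\<close>

lemma exp_J_sums:
  assumes p: "p \<in> S" and v: "v \<in> tangent_space S p"
    and A: "\<And>v. v \<in> tangent_space S p \<Longrightarrow> blinfun_apply A v = \<beta> *\<^sub>R J p v"
  shows "(\<lambda>m. (t ^ m / fact m) *\<^sub>R (blinfun_apply A ^^ m) v) sums rot (- (t * \<beta>)) p v"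
proof -
  let ?JJ = "J p (J p v)"
  have JT: "J p w \<in> tangent_space S p" for w by (rule J_tangent[OF p])
  have pow: "(blinfun_apply A ^^ m) v = (\<beta> ^ m * fact m) *\<^sub>R (cos_coeff m *\<^sub>R (- ?JJ) + sin_coeff m *\<^sub>R J p v)
      + (if m = 0 then v + ?JJ else 0)" for m
  proof (induction m)
    case 0
    then show ?case by simp
  next
    case (Suc m)
    have "blinfun_apply A (if m = 0 then v + ?JJ else 0) = 0"
      by (simp add: blinfun.add_right blinfun.zero_right A v JT J_J_J[OF p])
    then have "(blinfun_apply A ^^ Suc m) v =
        (\<beta> ^ m * fact m) *\<^sub>R (cos_coeff m *\<^sub>R (\<beta> *\<^sub>R J p v) + sin_coeff m *\<^sub>R (\<beta> *\<^sub>R ?JJ))"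
      unfolding funpow.simps o_apply Suc
      by (simp add: blinfun.add_right blinfun.scaleR_right blinfun.minus_right blinfun.diff_right A JT J_J_J[OF p])
    also have "\<dots> = (\<beta> ^ Suc m * fact (Suc m)) *\<^sub>R (cos_coeff (Suc m) *\<^sub>R (- ?JJ) + sin_coeff (Suc m) *\<^sub>R J p v)"
    proof -
      have "\<beta> ^ Suc m * fact (Suc m) * cos_coeff (Suc m) = - (\<beta> ^ m * fact m * sin_coeff m * \<beta>)"
        "\<beta> ^ Suc m * fact (Suc m) * sin_coeff (Suc m) = \<beta> ^ m * fact m * cos_coeff m * \<beta>"
        by (simp_all add: cos_coeff_Suc sin_coeff_Suc field_simps del: of_nat_Suc)
      then show ?thesis by (simp only: scaleR_add_right scaleR_scaleR scaleR_minus_right) (simp add: algebra_simps)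
    qed
    finally show ?case by simp
  qed
  have summand: "(t ^ m / fact m) *\<^sub>R (blinfun_apply A ^^ m) v =
      (cos_coeff m *\<^sub>R (t * \<beta>) ^ m) *\<^sub>R (- ?JJ) + (sin_coeff m *\<^sub>R (t * \<beta>) ^ m) *\<^sub>R J p v
      + (if m = 0 then v + ?JJ else 0)" for m
  proof -
    have e: "t ^ m / fact m * (\<beta> ^ m * fact m) = (t * \<beta>) ^ m" by (simp add: power_mult_distrib)
    have "(t ^ m / fact m) *\<^sub>R (if m = 0 then v + ?JJ else 0) = (if m = 0 then v + ?JJ else 0)" by simp
    then show ?thesis
      unfolding pow scaleR_add_right[of "t ^ m / fact m"] scaleR_scaleR e
      by (simp only: scaleR_add_right scaleR_scaleR real_scaleR_def mult.commute)
  qed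
  have "(\<lambda>m. (cos_coeff m *\<^sub>R (t * \<beta>) ^ m) *\<^sub>R (- ?JJ) + (sin_coeff m *\<^sub>R (t * \<beta>) ^ m) *\<^sub>R J p v
      + (if m = 0 then v + ?JJ else 0)) sums (cos (t * \<beta>) *\<^sub>R (- ?JJ) + sin (t * \<beta>) *\<^sub>R J p v + (v + ?JJ))"
    by (intro sums_add bounded_linear.sums[OF bounded_linear_scaleR_left] cos_converges sin_converges
        sums_single[where i = 0 and f = "\<lambda>_. v + ?JJ", simplified])
  moreover have "cos (t * \<beta>) *\<^sub>R (- ?JJ) + sin (t * \<beta>) *\<^sub>R J p v + (v + ?JJ) = rot (- (t * \<beta>)) p v"
    by (simp add: rot_def algebra_simps)
  ultimately show ?thesis unfolding summand by simp
qed

text \<open>Every element is a multiple of \<open>J\<close> by the conservation laws. Conversely \<open>exp (t \<beta> J)\<close> is the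
  transport along a loop of turning angle \<open>- t \<beta>\<close>.\<close>

lemma holonomy_algebra_eq:
  assumes p: "p \<in> S" and loops: "\<And>\<theta>. \<exists>\<gamma>. turning_loop p \<theta> \<gamma>"
  obtains A where "A \<noteq> 0" "holonomy_algebra S D p = range (\<lambda>\<beta>. \<beta> *\<^sub>R A)"
proof -
  let ?T = "tangent_space S p"
  obtain A where A: "A \<in> tangent_endos S p" "\<And>v. v \<in> ?T \<Longrightarrow> blinfun_apply A v = J p v"
    using tangent_endo_exists[OF p linear_J[OF p] J_tangent[OF p]] by blast
  have mult: "\<beta> *\<^sub>R A \<in> tangent_endos S p" for \<beta>
    using A(1) tangent_subspace[OF p] by (simp add: tangent_endos_def blinfun.scaleR_left subspace_scale)
  have "A \<noteq> 0"
  proof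
    assume "A = 0"
    then have "J p (E 0 p) = 0" using A(2)[OF frame_tangent[OF p n_pos(1)]] by simp
    then have "c 1 p (J p (E 0 p)) = 0" using coord_linear[OF p n_pos(2)] by (simp add: linear_0)
    then show False using coord_J[OF p n_pos(2), of "E 0 p"] coord_frame[OF p n_pos(1) n_pos(1)] by simp
  qed
  moreover have "holonomy_algebra S D p = range (\<lambda>\<beta>. \<beta> *\<^sub>R A)"
  proof (intro equalityI subsetI)
    fix H assume H: "H \<in> holonomy_algebra S D p"
    obtain \<beta> where \<beta>: "\<forall>v\<in>?T. blinfun_apply H v = \<beta> *\<^sub>R J p v"
      using holonomy_algebra_multiple[OF H p] by blast
    have "H = \<beta> *\<^sub>R A"
      by (rule tangent_endo_eqI[OF p _ mult]) (use H \<beta> A(2) in \<open>auto simp: holonomy_algebra_def blinfun.scaleR_left\<close>)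
    then show "H \<in> range (\<lambda>\<beta>. \<beta> *\<^sub>R A)" by blast
  next
    fix H assume "H \<in> range (\<lambda>\<beta>. \<beta> *\<^sub>R A)"
    then obtain \<beta> where H: "H = \<beta> *\<^sub>R A" by blast
    have HT: "blinfun_apply H v = \<beta> *\<^sub>R J p v" if "v \<in> ?T" for v
      using A(2)[OF that] by (simp add: H blinfun.scaleR_left)
    have "\<exists>B\<in>holonomy_group S D p. \<forall>v\<in>?T. (\<lambda>m. (t ^ m / fact m) *\<^sub>R (blinfun_apply H ^^ m) v) sums blinfun_apply B v"
      for t :: real
    proof -
      obtain \<gamma> where "turning_loop p (- (t * \<beta>)) \<gamma>" using loops by blast
      then obtain B where "B \<in> holonomy_group S D p" "\<And>v. v \<in> ?T \<Longrightarrow> blinfun_apply B v = rot (- (t * \<beta>)) p v"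
        using rot_in_holonomy_group[OF p] by blast
      then show ?thesis using exp_J_sums[OF p _ HT] by (intro bexI[of _ B]) simp_all
    qed
    then show "H \<in> holonomy_algebra S D p"
      unfolding holonomy_algebra_def using mult H by blast
  qed
  ultimately show thesis by (rule that)
qed

end

section \<open>Lines of endomorphisms and the rotation algebra\<close>

lemma so2_eq: "so2 = range (\<lambda>\<beta>. \<beta> *\<^sub>R (vector [vector [0, -1], vector [1, 0]] :: real^2^2))"
proof -
  have "A \<in> so2 \<longleftrightarrow> A $ 1 $ 1 = 0 \<and> A $ 2 $ 2 = 0 \<and> A $ 1 $ 2 = - A $ 2 $ 1" for A :: "real^2^2"
    unfolding so2_def transpose_def by (auto simp: vec_eq_iff[of _ "- A"] vec_eq_iff[of _ "- A $ _"] forall_2)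
  moreover have "A \<in> range (\<lambda>\<beta>. \<beta> *\<^sub>R (vector [vector [0, -1], vector [1, 0]] :: real^2^2)) \<longleftrightarrow>
      A $ 1 $ 1 = 0 \<and> A $ 2 $ 2 = 0 \<and> A $ 1 $ 2 = - A $ 2 $ 1" (is "?L \<longleftrightarrow> ?R") for A :: "real^2^2"
  proof
    assume ?R
    then have "A = A $ 2 $ 1 *\<^sub>R vector [vector [0, -1], vector [1, 0]]"
      unfolding vec_eq_iff forall_2 by simp
    then show ?L by blast
  qed auto
  ultimately show ?thesis by blast
qed

text \<open>Any line of endomorphisms is an abelian Lie algebra of dimension one, and so is \<open>so2\<close>; a linear
  bijection between the two lines is an isomorphism.\<close>

lemma line_iso_so2:
  fixes A :: "'a::real_normed_vector \<Rightarrow>\<^sub>L 'a"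
  assumes A: "A \<noteq> 0" and L: "L = range (\<lambda>\<beta>. \<beta> *\<^sub>R A)"
  shows "subspace L" "\<forall>A\<in>L. \<forall>B\<in>L. blinfun_commutator A B = 0" "dim L = 1"
    "lie_algebra_iso L blinfun_commutator so2 matrix_commutator"
proof -
  have span: "L = span {A}" unfolding L by (simp add: span_singleton)
  show "subspace L" unfolding span by (rule subspace_span)
  show "dim L = 1" unfolding span dim_span using A by (simp add: dim_eq_card_independent)
  show comm: "\<forall>A\<in>L. \<forall>B\<in>L. blinfun_commutator A B = 0"
    unfolding L blinfun_commutator_def
    by (auto intro!: blinfun_eqI simp: blinfun.diff_left blinfun.scaleR_left blinfun.scaleR_right)
  let ?M = "vector [vector [0, -1], vector [1, 0]] :: real^2^2"
  have M: "?M \<noteq> 0" by (simp add: vec_eq_iff forall_2)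
  define f where "f B = (THE \<beta>. B = \<beta> *\<^sub>R A) *\<^sub>R ?M" for B
  have f: "f (\<beta> *\<^sub>R A) = \<beta> *\<^sub>R ?M" for \<beta>
    using A by (simp add: f_def)
  have "inj_on f L" unfolding L using M by (auto intro!: inj_onI simp: f)
  moreover have "f ` L = so2" unfolding L so2_eq by (simp add: image_image f)
  ultimately have "bij_betw f L so2" by (simp add: bij_betw_def)
  moreover have "f (x + y) = f x + f y \<and> f (blinfun_commutator x y) = matrix_commutator (f x) (f y)"
    if xy: "x \<in> L" "y \<in> L" for x y
  proof -
    obtain a where a: "x = a *\<^sub>R A" using xy(1) L by blast
    obtain b where b: "y = b *\<^sub>R A" using xy(2) L by blast
    note ab = a b
    have "f 0 = 0" using f[of 0] by simp
    moreover have "matrix_commutator (a *\<^sub>R ?M) (b *\<^sub>R ?M) = 0"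
      by (simp add: matrix_commutator_def matrix_matrix_mult_def vec_eq_iff forall_2 sum_2)
    ultimately have "f (blinfun_commutator x y) = matrix_commutator (f x) (f y)"
      using comm xy by (simp add: ab f)
    moreover have "f (x + y) = f x + f y"
      using f[of "a + b"] unfolding ab f scaleR_add_left .
    ultimately show ?thesis by blast
  qed
  moreover have "f (a *\<^sub>R x) = a *\<^sub>R f x" if x: "x \<in> L" for x and a :: real
  proof -
    obtain b where b: "x = b *\<^sub>R A" using x L by blast
    show ?thesis using f[of "a * b"] by (simp add: b f)
  qed
  ultimately show "lie_algebra_iso L blinfun_commutator so2 matrix_commutator"
    unfolding lie_algebra_iso_def by blast
qed

section \<open>Left-invariant fields and dual bases\<close>

lemma tangent_space_0: "p \<in> S \<Longrightarrow> 0 \<in> tangent_space S p"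
  using tangent_space_curve[of "\<lambda>t. p" 0 0 S] by simp

lemma tangent_space_Times: "tangent_space (A \<times> B) p = tangent_space A (fst p) \<times> tangent_space B (snd p)"
proof (intro equalityI subsetI)
  fix v assume "v \<in> tangent_space (A \<times> B) p"
  then obtain c where c: "curve_through (A \<times> B) p v c" by (auto simp: tangent_space_def)
  then have cv: "(c has_vector_derivative v) (at 0)" by (simp add: curve_through_def)
  have "curve_through A (fst p) (fst v) (\<lambda>t. fst (c t))"
    using c bounded_linear.has_vector_derivative[OF bounded_linear_fst cv]
    by (simp add: curve_through_def mem_Times_iff)
  moreover have "curve_through B (snd p) (snd v) (\<lambda>t. snd (c t))"
    using c bounded_linear.has_vector_derivative[OF bounded_linear_snd cv]
    by (simp add: curve_through_def mem_Times_iff)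
  ultimately show "v \<in> tangent_space A (fst p) \<times> tangent_space B (snd p)"
    by (auto simp: tangent_space_def mem_Times_iff)
next
  fix v assume "v \<in> tangent_space A (fst p) \<times> tangent_space B (snd p)"
  then obtain c d where cd: "curve_through A (fst p) (fst v) c" "curve_through B (snd p) (snd v) d"
    by (auto simp: tangent_space_def mem_Times_iff)
  then have "((\<lambda>t. (c t, d t)) has_vector_derivative (fst v, snd v)) (at 0)"
    by (intro has_vector_derivative_Pair) (simp_all add: curve_through_def)
  then have "curve_through (A \<times> B) p v (\<lambda>t. (c t, d t))"
    using cd by (simp add: curve_through_def)
  then show "v \<in> tangent_space (A \<times> B) p" by (auto simp: tangent_space_def)
qed

text \<open>Left translation is the restriction of a linear map, hence is its own derivative. Left-invariant
  fields are therefore restrictions of linear maps as well.\<close>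

lemma left_invariant_field_eq:
  assumes U: "left_invariant_field S m U" and m: "bounded_linear (m q)" "m q e = q"
    and e: "e \<in> S" and q: "q \<in> S"
  shows "U q = m q (U e)"
proof -
  have "tangent_deriv S (m q) e (U e) = U (m q e)"
    using U e q unfolding left_invariant_field_def by blast
  moreover have "tangent_deriv S (m q) e (U e) = m q (U e)"
    using U e by (intro tangent_deriv_linear m) (auto simp: left_invariant_field_def vector_field_def)
  ultimately show ?thesis using m(2) by simp
qed

text \<open>The commutator of matrices, in the form that holds for every bilinear multiplication.\<close>

lemma lie_bracket_translates:
  assumes B: "bounded_bilinear m" and U: "\<And>q. q \<in> S \<Longrightarrow> U q = m q u" and V: "\<And>q. q \<in> S \<Longrightarrow> V q = m q v"
    and T: "U p \<in> tangent_space S p" "V p \<in> tangent_space S p"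
  shows "lie_bracket S U V p = m (U p) v - m (V p) u"
proof -
  have "tangent_deriv S V p (U p) = tangent_deriv S (\<lambda>q. m q v) p (U p)"
    "tangent_deriv S U p (V p) = tangent_deriv S (\<lambda>q. m q u) p (V p)"
    by (intro tangent_deriv_cong U V; assumption)+
  then show ?thesis
    unfolding lie_bracket_def
    using tangent_deriv_linear[OF bounded_bilinear.bounded_linear_left[OF B]] T by simp
qed

lemma dual_functionals:
  fixes us :: "'a::euclidean_space list"
  assumes "distinct us" "independent (set us)"
  shows "\<exists>l. \<forall>k. linear (l k :: 'a \<Rightarrow> real) \<and>
    (k < length us \<longrightarrow> (\<forall>j<length us. l k (us ! j) = (if j = k then 1 else 0)))"
proof -
  have "\<exists>g. linear (g :: 'a \<Rightarrow> real) \<and>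
    (k < length us \<longrightarrow> (\<forall>j<length us. g (us ! j) = (if j = k then 1 else 0)))" for k
  proof -
    obtain g where g: "linear (g :: 'a \<Rightarrow> real)" "\<forall>v\<in>set us. g v = (if v = us ! k then 1 else 0)"
      using linear_independent_extend[OF assms(2), of "\<lambda>v. if v = us ! k then 1 else 0 :: real"] by blast
    then show ?thesis
      using assms(1) by (intro exI[of _ g]) (auto simp: nth_eq_iff_index_eq)
  qed
  then show ?thesis by (intro choice) blast
qed

lemma span_list:
  assumes "distinct us" "v \<in> span (set us)"
  shows "\<exists>a. v = (\<Sum>j<length us. a j *\<^sub>R us ! j)"
proof -
  obtain u where u: "v = (\<Sum>w\<in>set us. u w *\<^sub>R w)"
    using assms(2) span_finite[of "set us"] by auto
  also have "\<dots> = (\<Sum>j<length us. u (us ! j) *\<^sub>R us ! j)"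
    using sum.reindex_bij_betw[OF bij_betw_nth[OF assms(1) refl refl], of "\<lambda>w. u w *\<^sub>R w"] by simp
  finally show ?thesis by (intro exI[of _ "\<lambda>j. u (us ! j)"])
qed

section \<open>The Heisenberg group and the torus\<close>

lemma bounded_bilinear_matrix_mult: "bounded_bilinear ((**) :: real^3^3 \<Rightarrow> real^3^3 \<Rightarrow> real^3^3)"
  unfolding bilinear_conv_bounded_bilinear[symmetric] bilinear_def
  by (intro conjI allI linearI)
     (simp_all add: vec_eq_iff matrix_matrix_mult_def sum_3 algebra_simps)

lemma bounded_bilinear_vec_mult: "bounded_bilinear ((*) :: complex^3 \<Rightarrow> complex^3 \<Rightarrow> complex^3)"
  unfolding bilinear_conv_bounded_bilinear[symmetric] bilinear_def
  by (intro conjI allI linearI) (simp_all add: vec_eq_iff algebra_simps)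

lemma bounded_bilinear_HT_mult: "bounded_bilinear HT_mult"
  unfolding bilinear_conv_bounded_bilinear[symmetric] bilinear_def
  by (intro conjI allI linearI)
     (simp_all add: HT_mult_def bounded_bilinear.add_left[OF bounded_bilinear_matrix_mult]
      bounded_bilinear.add_right[OF bounded_bilinear_matrix_mult]
      bounded_bilinear.scaleR_left[OF bounded_bilinear_matrix_mult]
      bounded_bilinear.scaleR_right[OF bounded_bilinear_matrix_mult]
      bounded_bilinear.add_left[OF bounded_bilinear_vec_mult]
      bounded_bilinear.add_right[OF bounded_bilinear_vec_mult]
      bounded_bilinear.scaleR_left[OF bounded_bilinear_vec_mult]
      bounded_bilinear.scaleR_right[OF bounded_bilinear_vec_mult])

definition strictly_upper :: "real^3^3 \<Rightarrow> bool" where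
  "strictly_upper N \<longleftrightarrow> N $ 1 $ 1 = 0 \<and> N $ 2 $ 2 = 0 \<and> N $ 3 $ 3 = 0 \<and>
     N $ 2 $ 1 = 0 \<and> N $ 3 $ 1 = 0 \<and> N $ 3 $ 2 = 0"

lemma mat1_heisenberg: "mat 1 \<in> heisenberg"
  by (simp add: heisenberg_def mat_def)

lemma heisenberg_mult: "A \<in> heisenberg \<Longrightarrow> B \<in> heisenberg \<Longrightarrow> A ** B \<in> heisenberg"
  by (simp add: heisenberg_def matrix_matrix_mult_def sum_3)

lemma one_torus3: "1 \<in> torus3"
  by (simp add: torus3_def)

lemma tangent_heisenberg_strictly_upper:
  assumes "v \<in> tangent_space heisenberg p"
  shows "strictly_upper v"
proof -
  obtain c where c: "\<forall>t. c t \<in> heisenberg" "(c has_vector_derivative v) (at 0)"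
    using assms by (auto simp: tangent_space_def curve_through_def)
  have "v $ i $ j = 0" if "\<And>t. c t $ i $ j = k" for i j k
  proof -
    have bl: "bounded_linear (\<lambda>A::real^3^3. A $ i $ j)"
      by (intro bounded_linear_compose[OF bounded_linear_vec_nth] bounded_linear_vec_nth)
    have "((\<lambda>t. c t $ i $ j) has_vector_derivative v $ i $ j) (at 0)"
      by (rule bounded_linear.has_vector_derivative[OF bl c(2)])
    then have "((\<lambda>t. k) has_vector_derivative v $ i $ j) (at 0)" by (simp add: that)
    then show ?thesis using vector_derivative_unique_at[OF _ has_vector_derivative_const] by blast
  qed
  then show ?thesis using c(1) by (simp add: strictly_upper_def heisenberg_def)
qed

text \<open>The inverse of a unipotent matrix as a polynomial in it: \<open>(A - 1)\<^sup>3 = 0\<close> gives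
  \<open>A\<^sup>-\<^sup>1 = 3 - 3 A + A\<^sup>2\<close>. This makes smoothness of inversion evident.\<close>

definition heis_inv :: "real^3^3 \<Rightarrow> real^3^3" where
  "heis_inv A = 3 *\<^sub>R mat 1 - 3 *\<^sub>R A + A ** A"

lemma heis_inv: "A \<in> heisenberg \<Longrightarrow> heis_inv A ** A = mat 1"
  unfolding heis_inv_def heisenberg_def
  by (simp add: vec_eq_iff forall_3 matrix_matrix_mult_def sum_3 mat_def algebra_simps)

definition torus_inv :: "complex^3 \<Rightarrow> complex^3" where
  "torus_inv z = (\<chi> i. cnj (z $ i))"

lemma torus_inv: "z \<in> torus3 \<Longrightarrow> torus_inv z * z = 1"
  by (simp add: torus3_def torus_inv_def vec_eq_iff mult.commute[of "cnj _"] complex_norm_square[symmetric])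

lemma bounded_linear_torus_inv: "bounded_linear torus_inv"
  unfolding linear_conv_bounded_linear[symmetric]
  by (intro linearI) (simp_all add: torus_inv_def vec_eq_iff)

text \<open>The product \<open>exp (a x) exp (b y)\<close> for strictly upper triangular \<open>x\<close> and \<open>y\<close>, whose triple products
  vanish.\<close>

definition heis_loop :: "real^3^3 \<Rightarrow> real^3^3 \<Rightarrow> real \<Rightarrow> real \<Rightarrow> real^3^3" where
  "heis_loop x y a b = mat 1 + a *\<^sub>R x + b *\<^sub>R y + (a\<^sup>2 / 2) *\<^sub>R (x ** x) + (a * b) *\<^sub>R (x ** y) + (b\<^sup>2 / 2) *\<^sub>R (y ** y)"

lemma heis_loop_in: "strictly_upper x \<Longrightarrow> strictly_upper y \<Longrightarrow> heis_loop x y a b \<in> heisenberg"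
  by (simp add: heis_loop_def heisenberg_def strictly_upper_def mat_def matrix_matrix_mult_def sum_3)

text \<open>Moving \<open>exp (b y)\<close> past \<open>x\<close> produces the commutator: the left logarithmic derivative of
  \<open>exp (a x) exp (b y)\<close> is \<open>a' (x + b [x,y]) + b' y\<close>.\<close>

lemma heis_loop_derivative:
  assumes x: "strictly_upper x" and y: "strictly_upper y"
    and a: "(a has_real_derivative a') (at t)" and b: "(b has_real_derivative b') (at t)"
  shows "((\<lambda>t. heis_loop x y (a t) (b t)) has_vector_derivative
    heis_loop x y (a t) (b t) ** (a' *\<^sub>R x + b' *\<^sub>R y + (a' * b t) *\<^sub>R (x ** y - y ** x))) (at t)"
proof -
  have "((\<lambda>t. heis_loop x y (a t) (b t)) has_vector_derivative
      a' *\<^sub>R x + b' *\<^sub>R y + (a t * a') *\<^sub>R (x ** x) + (a' * b t + a t * b') *\<^sub>R (x ** y) + (b t * b') *\<^sub>R (y ** y)) (at t)"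
    unfolding heis_loop_def
    by (rule has_vector_derivative_eq_rhs)
       (auto intro!: derivative_eq_intros a b has_vector_derivative_scaleR simp: algebra_simps)
  also have "a' *\<^sub>R x + b' *\<^sub>R y + (a t * a') *\<^sub>R (x ** x) + (a' * b t + a t * b') *\<^sub>R (x ** y) + (b t * b') *\<^sub>R (y ** y)
      = heis_loop x y (a t) (b t) ** (a' *\<^sub>R x + b' *\<^sub>R y + (a' * b t) *\<^sub>R (x ** y - y ** x))"
    using x y unfolding heis_loop_def strictly_upper_def
    by (simp add: vec_eq_iff forall_3 matrix_matrix_mult_def sum_3 mat_def algebra_simps)
  finally show ?thesis .
qed

section \<open>The left-invariant frame\<close>

text \<open>The hypotheses on the structure, collected once for all lemmas about it.\<close>

locale heisenberg_torus_structure =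
  fixes X Y Z :: "real^3^3 \<Rightarrow> real^3^3"
    and \<zeta> :: "nat \<Rightarrow> complex^3 \<Rightarrow> complex^3"
    and g1 :: "real^3^3 \<Rightarrow> real^3^3 \<Rightarrow> real^3^3 \<Rightarrow> real"
    and g2 :: "complex^3 \<Rightarrow> complex^3 \<Rightarrow> complex^3 \<Rightarrow> real"
    and h :: "ambient \<Rightarrow> ambient \<Rightarrow> ambient \<Rightarrow> real"
    and \<xi> :: "nat \<Rightarrow> ambient \<Rightarrow> ambient"
    and \<phi> :: "ambient \<Rightarrow> ambient \<Rightarrow> ambient"
    and nabla_h nabla :: "ambient conn"
  assumes frame_H: "left_invariant_frame heisenberg (**) [X, Y, Z]"
    and brackets: "\<And>p. p \<in> heisenberg \<Longrightarrow> lie_bracket heisenberg X Y p = Z p"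
      "\<And>p. p \<in> heisenberg \<Longrightarrow> lie_bracket heisenberg X Z p = 0"
      "\<And>p. p \<in> heisenberg \<Longrightarrow> lie_bracket heisenberg Y Z p = 0"
    and g1: "left_invariant_metric heisenberg (**) g1"
    and g1_orthogonal: "\<And>p. p \<in> heisenberg \<Longrightarrow>
      g1 p (X p) (Y p) = 0 \<and> g1 p (X p) (Z p) = 0 \<and> g1 p (Y p) (Z p) = 0"
    and g1_lengths: "\<And>p. p \<in> heisenberg \<Longrightarrow>
      g1 p (X p) (X p) = 1/2 \<and> g1 p (Y p) (Y p) = 1/2 \<and> g1 p (Z p) (Z p) = 4"
    and g2: "left_invariant_metric torus3 (*) g2"
    and frame_T: "left_invariant_frame torus3 (*) [\<zeta> 1, \<zeta> 2, \<zeta> 3]"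
    and orthonormal_T: "orthonormal_fields torus3 g2 {1..3} \<zeta>"
    and h: "h = product_metric g1 g2"
    and \<xi>_left_invariant: "\<And>i. i \<in> {1..4} \<Longrightarrow> left_invariant_field HT HT_mult (\<xi> i)"
    and \<xi>_span: "\<And>i. i \<in> {1..4} \<Longrightarrow> \<exists>c::nat \<Rightarrow> real. \<forall>p\<in>HT.
      \<xi> i p = c 0 *\<^sub>R lift_H Z p + (\<Sum>j=1..3. c j *\<^sub>R lift_T (\<zeta> j) p)"
    and \<xi>_orthonormal: "orthonormal_fields HT h {1..4} \<xi>"
    and \<xi>_sum: "\<And>p. p \<in> HT \<Longrightarrow> lift_H Z p = (\<Sum>i=1..4. \<xi> i p)"
    and \<phi>: "left_invariant_endo HT HT_mult \<phi>"
    and \<phi>_values: "\<And>p. p \<in> HT \<Longrightarrow> \<phi> p (lift_H X p) = lift_H Y p"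
      "\<And>p. p \<in> HT \<Longrightarrow> \<phi> p (lift_H Y p) = - lift_H X p"
      "\<And>p i. p \<in> HT \<Longrightarrow> i \<in> {1..4} \<Longrightarrow> \<phi> p (\<xi> i p) = 0"
    and nabla_h: "levi_civita HT h nabla_h"
    and nabla: "affine_connection HT nabla"
    and nabla_torsion: "\<And>U V W p. vector_field HT U \<Longrightarrow> vector_field HT V \<Longrightarrow> vector_field HT W \<Longrightarrow>
      p \<in> HT \<Longrightarrow> h p (nabla U V p) (W p) =
        h p (nabla_h U V p) (W p) + 1/2 * torsion_form h \<phi> \<xi> p (U p) (V p) (W p)"
begin

definition heis_frame :: "nat \<Rightarrow> real^3^3 \<Rightarrow> real^3^3" where "heis_frame k = [X, Y, Z] ! k"

definition torus_frame :: "nat \<Rightarrow> complex^3 \<Rightarrow> complex^3" where "torus_frame k = [\<zeta> 1, \<zeta> 2, \<zeta> 3] ! k"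

text \<open>The frame \<open>X, Y, Z, \<zeta>\<^sub>1, \<zeta>\<^sub>2, \<zeta>\<^sub>3\<close> in this order, so that the index \<open>2\<close> belongs to \<open>Z\<close> and the plane of
  rotation is spanned by the first two fields.\<close>

definition E :: "nat \<Rightarrow> ambient \<Rightarrow> ambient" where
  "E k = (if k < 3 then lift_H (heis_frame k) else lift_T (torus_frame (k - 3)))"

definition frame_at_one :: "nat \<Rightarrow> ambient" where
  "frame_at_one k = (if k < 3 then (heis_frame k (mat 1), 0) else (0, torus_frame (k - 3) 1))"

lemma E_lifts: "E 0 = lift_H X" "E 1 = lift_H Y" "E 2 = lift_H Z"
  "E 3 = lift_T (\<zeta> 1)" "E 4 = lift_T (\<zeta> 2)" "E 5 = lift_T (\<zeta> 3)"
  by (simp_all add: E_def heis_frame_def torus_frame_def numeral_2_eq_2)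

lemma less3: "k < 3 \<longleftrightarrow> k = 0 \<or> k = 1 \<or> k = (2::nat)"
  by auto

lemma heis_frame_left_invariant: "k < 3 \<Longrightarrow> left_invariant_field heisenberg (**) (heis_frame k)"
  using frame_H unfolding left_invariant_frame_def heis_frame_def less3 by (elim disjE) simp_all

lemma torus_frame_left_invariant: "k < 3 \<Longrightarrow> left_invariant_field torus3 (*) (torus_frame k)"
  using frame_T unfolding left_invariant_frame_def torus_frame_def less3 by (elim disjE) simp_all

lemma heis_frame_eq: "k < 3 \<Longrightarrow> A \<in> heisenberg \<Longrightarrow> heis_frame k A = A ** heis_frame k (mat 1)"
  by (rule left_invariant_field_eq[OF heis_frame_left_invariant
        bounded_bilinear.bounded_linear_right[OF bounded_bilinear_matrix_mult] _ mat1_heisenberg]) simp_all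

lemma torus_frame_eq: "k < 3 \<Longrightarrow> w \<in> torus3 \<Longrightarrow> torus_frame k w = w * torus_frame k 1"
  by (rule left_invariant_field_eq[OF torus_frame_left_invariant
        bounded_bilinear.bounded_linear_right[OF bounded_bilinear_vec_mult] _ one_torus3]) simp_all

lemma heis_frame_map: "map (\<lambda>U. U A) [X, Y, Z] = map (\<lambda>k. heis_frame k A) [0..<3]"
  by (simp add: heis_frame_def upt_rec numeral_2_eq_2)

lemma torus_frame_map: "map (\<lambda>U. U w) [\<zeta> 1, \<zeta> 2, \<zeta> 3] = map (\<lambda>k. torus_frame k w) [0..<3]"
  by (simp add: torus_frame_def upt_rec numeral_2_eq_2)

lemma heis_frame_basis:
  assumes "A \<in> heisenberg"
  shows "distinct (map (\<lambda>k. heis_frame k A) [0..<3])" "independent (set (map (\<lambda>k. heis_frame k A) [0..<3]))"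
    "span (set (map (\<lambda>k. heis_frame k A) [0..<3])) = tangent_space heisenberg A"
  using frame_H assms unfolding left_invariant_frame_def heis_frame_map by blast+

lemma torus_frame_basis:
  assumes "w \<in> torus3"
  shows "distinct (map (\<lambda>k. torus_frame k w) [0..<3])" "independent (set (map (\<lambda>k. torus_frame k w) [0..<3]))"
    "span (set (map (\<lambda>k. torus_frame k w) [0..<3])) = tangent_space torus3 w"
  using frame_T assms unfolding left_invariant_frame_def torus_frame_map by blast+

lemma tangent_HT: "tangent_space HT p = tangent_space heisenberg (fst p) \<times> tangent_space torus3 (snd p)"
  unfolding HT_def by (rule tangent_space_Times)

lemma tangent_HT_subspace:
  assumes "p \<in> HT" shows "subspace (tangent_space HT p)"
proof -
  have "fst p \<in> heisenberg" "snd p \<in> torus3" using assms by (auto simp: HT_def)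
  note span = heis_frame_basis(3)[OF this(1), symmetric] torus_frame_basis(3)[OF this(2), symmetric]
  show ?thesis unfolding tangent_HT span by (intro subspace_Times subspace_span)
qed

lemma heis_frame_tangent: "k < 3 \<Longrightarrow> A \<in> heisenberg \<Longrightarrow> heis_frame k A \<in> tangent_space heisenberg A"
  using heis_frame_left_invariant by (simp add: left_invariant_field_def vector_field_def)

lemma torus_frame_tangent: "k < 3 \<Longrightarrow> w \<in> torus3 \<Longrightarrow> torus_frame k w \<in> tangent_space torus3 w"
  using torus_frame_left_invariant by (simp add: left_invariant_field_def vector_field_def)

lemma E_eq: "p \<in> HT \<Longrightarrow> k < 6 \<Longrightarrow> E k p = HT_mult p (frame_at_one k)"
  using heis_frame_eq[of k "fst p"] torus_frame_eq[of "k - 3" "snd p"]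
  by (auto simp: E_def frame_at_one_def HT_mult_def HT_def lift_H_def lift_T_def)

lemma E_tangent: "p \<in> HT \<Longrightarrow> k < 6 \<Longrightarrow> E k p \<in> tangent_space HT p"
  unfolding tangent_HT using heis_frame_tangent[of k "fst p"] torus_frame_tangent[of "k - 3" "snd p"]
  by (auto simp: E_def HT_def lift_H_def lift_T_def tangent_space_0)

lemma E_field:
  assumes "k < 6" shows "vector_field HT (E k)"
proof -
  have "smooth_map HT (\<lambda>p. HT_mult p (frame_at_one k))"
    by (rule smooth_map_bounded_linear[OF bounded_bilinear.bounded_linear_left[OF bounded_bilinear_HT_mult]])
  then have "smooth_map HT (E k)"
    by (rule smooth_map_cong) (simp add: E_eq assms)
  then show ?thesis using E_tangent[OF _ assms] by (simp add: vector_field_def)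
qed

definition heis_dual :: "nat \<Rightarrow> real^3^3 \<Rightarrow> real" where
  "heis_dual = (SOME l. \<forall>k. linear (l k) \<and> (k < 3 \<longrightarrow> (\<forall>j<3. l k (heis_frame j (mat 1)) = (if j = k then 1 else 0))))"

definition torus_dual :: "nat \<Rightarrow> complex^3 \<Rightarrow> real" where
  "torus_dual = (SOME l. \<forall>k. linear (l k) \<and> (k < 3 \<longrightarrow> (\<forall>j<3. l k (torus_frame j 1) = (if j = k then 1 else 0))))"

lemma heis_dual: "linear (heis_dual k)" "k < 3 \<Longrightarrow> j < 3 \<Longrightarrow> heis_dual k (heis_frame j (mat 1)) = (if j = k then 1 else 0)"
proof -
  have "\<exists>l. \<forall>k. linear (l k) \<and> (k < 3 \<longrightarrow> (\<forall>j<3. l k (heis_frame j (mat 1)) = (if j = k then 1 else (0::real))))"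
    using dual_functionals[OF heis_frame_basis(1,2)[OF mat1_heisenberg]] by simp
  from someI_ex[OF this] show "linear (heis_dual k)"
    "k < 3 \<Longrightarrow> j < 3 \<Longrightarrow> heis_dual k (heis_frame j (mat 1)) = (if j = k then 1 else 0)"
    unfolding heis_dual_def[symmetric] by blast+
qed

lemma torus_dual: "linear (torus_dual k)" "k < 3 \<Longrightarrow> j < 3 \<Longrightarrow> torus_dual k (torus_frame j 1) = (if j = k then 1 else 0)"
proof -
  have "\<exists>l. \<forall>k. linear (l k) \<and> (k < 3 \<longrightarrow> (\<forall>j<3. l k (torus_frame j 1) = (if j = k then 1 else (0::real))))"
    using dual_functionals[OF torus_frame_basis(1,2)[OF one_torus3]] by simp
  from someI_ex[OF this] show "linear (torus_dual k)"
    "k < 3 \<Longrightarrow> j < 3 \<Longrightarrow> torus_dual k (torus_frame j 1) = (if j = k then 1 else 0)"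
    unfolding torus_dual_def[symmetric] by blast+
qed

text \<open>Coordinates are read off at the identity, after translating back by the inverse of \<open>p\<close>.\<close>

definition c :: "nat \<Rightarrow> ambient \<Rightarrow> ambient \<Rightarrow> real" where
  "c k p v = (if k < 3 then heis_dual k (heis_inv (fst p) ** fst v) else torus_dual (k - 3) (torus_inv (snd p) * snd v))"

lemma c_linear: "linear (c k p)"
  by (intro linearI)
     (simp_all add: c_def linear_add[OF heis_dual(1)] linear_cmul[OF heis_dual(1)] linear_add[OF torus_dual(1)] linear_cmul[OF torus_dual(1)]
      bounded_bilinear.add_right[OF bounded_bilinear_matrix_mult]
      bounded_bilinear.scaleR_right[OF bounded_bilinear_matrix_mult]
      bounded_bilinear.add_right[OF bounded_bilinear_vec_mult]
      bounded_bilinear.scaleR_right[OF bounded_bilinear_vec_mult])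

lemma c_E:
  assumes p: "p \<in> HT" and j: "j < 6" and k: "k < 6"
  shows "c k p (E j p) = (if j = k then 1 else 0)"
proof -
  have p': "fst p \<in> heisenberg" "snd p \<in> torus3" using p by (auto simp: HT_def)
  have H: "heis_inv (fst p) ** heis_frame j (fst p) = heis_frame j (mat 1)" if "j < 3" for j
    unfolding heis_frame_eq[OF that p'(1)] matrix_mul_assoc heis_inv[OF p'(1)] by simp
  have T: "torus_inv (snd p) * torus_frame j (snd p) = torus_frame j 1" if "j < 3" for j
    unfolding torus_frame_eq[OF that p'(2)] mult.assoc[symmetric] torus_inv[OF p'(2)] by simp
  have zero: "heis_dual k 0 = 0" "torus_dual (k - 3) 0 = 0" "heis_inv (fst p) ** 0 = 0"
    by (simp_all add: linear_0[OF heis_dual(1)] linear_0[OF torus_dual(1)]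
        bounded_bilinear.zero_right[OF bounded_bilinear_matrix_mult])
  show ?thesis
  proof (cases "j < 3")
    case True
    then have "c k p (E j p) = (if k < 3 then heis_dual k (heis_frame j (mat 1)) else 0)"
      by (simp add: c_def E_def lift_H_def H zero)
    then show ?thesis using True by (simp add: heis_dual(2))
  next
    case False
    then have "c k p (E j p) = (if k < 3 then 0 else torus_dual (k - 3) (torus_frame (j - 3) 1))"
      using j by (simp add: c_def E_def lift_T_def T zero)
    then show ?thesis using False j k torus_dual(2)[of "k - 3" "j - 3"] by (cases "k < 3") auto
  qed
qed

lemma sum_lessThan_6: "(\<Sum>k<6. f k) = f 0 + f 1 + f 2 + f 3 + f 4 + f (5::nat)"
  by (simp add: eval_nat_numeral)

lemma c_expand:
  assumes p: "p \<in> HT" and v: "v \<in> tangent_space HT p"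
  shows "v = (\<Sum>k<6. c k p v *\<^sub>R E k p)"
proof -
  have p': "fst p \<in> heisenberg" "snd p \<in> torus3" using p by (auto simp: HT_def)
  have v': "fst v \<in> span (set (map (\<lambda>k. heis_frame k (fst p)) [0..<3]))" "snd v \<in> span (set (map (\<lambda>k. torus_frame k (snd p)) [0..<3]))"
    using v unfolding tangent_HT heis_frame_basis(3)[OF p'(1)] torus_frame_basis(3)[OF p'(2)] by auto
  obtain a where a: "fst v = (\<Sum>j<3. a j *\<^sub>R heis_frame j (fst p))"
    using span_list[OF heis_frame_basis(1)[OF p'(1)] v'(1)] by auto
  obtain b where b: "snd v = (\<Sum>j<3. b j *\<^sub>R torus_frame j (snd p))"
    using span_list[OF torus_frame_basis(1)[OF p'(2)] v'(2)] by auto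
  define d where "d k = (if k < 3 then a k else b (k - 3))" for k :: nat
  have vd: "v = (\<Sum>k<6. d k *\<^sub>R E k p)"
    by (rule prod_eqI)
       (simp_all add: a b d_def sum_lessThan_6 E_def lift_H_def lift_T_def eval_nat_numeral)
  have "c k p v = d k" if k: "k < 6" for k
  proof -
    have "c k p v = c k p (\<Sum>j<6. d j *\<^sub>R E j p)" using vd by (rule arg_cong)
    also have "\<dots> = (\<Sum>j<6. d j * c k p (E j p))"
      using c_linear by (simp only: linear_sum linear_cmul real_scaleR_def)
    also have "\<dots> = (\<Sum>j<6. if j = k then d j else 0)"
      by (intro sum.cong) (simp_all add: c_E[OF p _ k])
    finally show ?thesis using k by simp
  qed
  then have "(\<Sum>k<6. c k p v *\<^sub>R E k p) = (\<Sum>k<6. d k *\<^sub>R E k p)" by simp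
  with vd show ?thesis by (rule trans[OF _ sym])
qed

lemma c_smooth:
  assumes W: "vector_field HT W"
  shows "smooth_map HT (\<lambda>p. c k p (W p))"
proof -
  note W' = vector_fieldD(1)[OF W]
  have id: "smooth_map HT fst" "smooth_map HT snd"
    by (rule smooth_map_bounded_linear[OF bounded_linear_fst] smooth_map_bounded_linear[OF bounded_linear_snd])+
  have "smooth_map HT (\<lambda>p. heis_inv (fst p) ** fst (W p))"
    unfolding heis_inv_def
    by (intro smooth_map_bilinear[OF bounded_bilinear_matrix_mult] smooth_map_add smooth_map_minus
        smooth_map_const smooth_map_linear_comp[OF bounded_linear_scaleR_right] id
        smooth_map_linear_comp[OF bounded_linear_fst W'])
  then have 1: "smooth_map HT (\<lambda>p. heis_dual k (heis_inv (fst p) ** fst (W p)))"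
    by (rule smooth_map_linear_comp[OF heis_dual(1)[unfolded linear_conv_bounded_linear]])
  have "smooth_map HT (\<lambda>p. torus_inv (snd p) * snd (W p))"
    by (intro smooth_map_bilinear[OF bounded_bilinear_vec_mult]
        smooth_map_linear_comp[OF bounded_linear_torus_inv] id smooth_map_linear_comp[OF bounded_linear_snd W'])
  then have 2: "smooth_map HT (\<lambda>p. torus_dual (k - 3) (torus_inv (snd p) * snd (W p)))"
    by (rule smooth_map_linear_comp[OF torus_dual(1)[unfolded linear_conv_bounded_linear]])
  show ?thesis by (cases "k < 3") (simp_all add: c_def 1 2)
qed

lemma moving_frame_E: "moving_frame HT E 6 c"
  by (rule moving_frame.intro; (rule E_field c_linear c_E c_expand c_smooth tangent_HT_subspace; assumption)?)

end

section \<open>Metric, torsion form and brackets in the frame\<close>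

lemma metric_sym:
  assumes "left_invariant_metric S m g" "p \<in> S" "u \<in> tangent_space S p" "v \<in> tangent_space S p"
  shows "g p u v = g p v u"
  using assms unfolding left_invariant_metric_def riemannian_metric_def by blast

lemma metric_linear:
  assumes "left_invariant_metric S m g" "p \<in> S" "u \<in> tangent_space S p" "v \<in> tangent_space S p"
    "w \<in> tangent_space S p"
  shows "g p (a *\<^sub>R u + b *\<^sub>R v) w = a * g p u w + b * g p v w"
  using assms unfolding left_invariant_metric_def riemannian_metric_def by blast

lemma metric_zero:
  assumes g: "left_invariant_metric S m g" and p: "p \<in> S" and u: "u \<in> tangent_space S p"
  shows "g p 0 u = 0" "g p u 0 = 0"
proof -
  show "g p 0 u = 0" using metric_linear[OF g p u u u, of 0 0] by simp
  then show "g p u 0 = 0" using metric_sym[OF g p u tangent_space_0[OF p]] by simp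
qed

sublocale heisenberg_torus_structure \<subseteq> frame: moving_frame HT E 6 c
  by (rule moving_frame_E)

context heisenberg_torus_structure
begin

text \<open>The squared lengths of the frame fields.\<close>

definition sq_length :: "nat \<Rightarrow> real" where
  "sq_length k = (if k < 2 then 1/2 else if k = 2 then 4 else 1)"

text \<open>The structure constants: \<open>[E i, E j] = struct_const i j *\<^sub>R E 2\<close>.\<close>

definition struct_const :: "nat \<Rightarrow> nat \<Rightarrow> real" where
  "struct_const i j = (if i = 0 \<and> j = 1 then 1 else if i = 1 \<and> j = 0 then -1 else 0)"

lemma h_sym:
  assumes p: "p \<in> HT" and u: "u \<in> tangent_space HT p" and v: "v \<in> tangent_space HT p"
  shows "h p u v = h p v u"
proof -
  have p': "fst p \<in> heisenberg" "snd p \<in> torus3" using p by (auto simp: HT_def)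
  have t: "fst u \<in> tangent_space heisenberg (fst p)" "fst v \<in> tangent_space heisenberg (fst p)"
    "snd u \<in> tangent_space torus3 (snd p)" "snd v \<in> tangent_space torus3 (snd p)"
    using u v unfolding tangent_HT by auto
  show ?thesis
    using metric_sym[OF g1 p'(1) t(1,2)] metric_sym[OF g2 p'(2) t(3,4)] by (simp add: h product_metric_def)
qed

lemma h_linear:
  assumes p: "p \<in> HT" and u: "u \<in> tangent_space HT p" and v: "v \<in> tangent_space HT p"
    and w: "w \<in> tangent_space HT p"
  shows "h p (a *\<^sub>R u + b *\<^sub>R v) w = a * h p u w + b * h p v w"
proof -
  have p': "fst p \<in> heisenberg" "snd p \<in> torus3" using p by (auto simp: HT_def)
  have t: "fst u \<in> tangent_space heisenberg (fst p)" "fst v \<in> tangent_space heisenberg (fst p)"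
    "fst w \<in> tangent_space heisenberg (fst p)" "snd u \<in> tangent_space torus3 (snd p)"
    "snd v \<in> tangent_space torus3 (snd p)" "snd w \<in> tangent_space torus3 (snd p)"
    using u v w unfolding tangent_HT by auto
  show ?thesis
    using metric_linear[OF g1 p'(1) t(1,2,3), of a b] metric_linear[OF g2 p'(2) t(4,5,6), of a b]
    by (simp add: h product_metric_def algebra_simps)
qed

lemma h_sum:
  assumes p: "p \<in> HT" and w: "w \<in> tangent_space HT p"
    and K: "finite K" and v: "\<And>k. k \<in> K \<Longrightarrow> v k \<in> tangent_space HT p"
  shows "h p (\<Sum>k\<in>K. a k *\<^sub>R v k) w = (\<Sum>k\<in>K. a k * h p (v k) w)"
  using K v
proof (induction K)
  case empty
  show ?case using h_linear[OF p w w w, of 0 0] by simp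
next
  case (insert k K)
  have "(\<Sum>k\<in>K. a k *\<^sub>R v k) \<in> tangent_space HT p"
    using insert.prems frame.tangent_subspace[OF p] by (intro subspace_sum subspace_scale) auto
  then show ?case
    using insert h_linear[OF p _ _ w, of "v k" "\<Sum>k\<in>K. a k *\<^sub>R v k" "a k" 1] by simp
qed

lemma g1_heis_frame:
  assumes A: "A \<in> heisenberg" and "j < 3" "k < 3"
  shows "g1 A (heis_frame j A) (heis_frame k A) = (if j = k then sq_length j else 0)"
proof -
  have sym: "g1 A (heis_frame k A) (heis_frame j A) = g1 A (heis_frame j A) (heis_frame k A)" if "j < 3" "k < 3" for j k
    by (rule metric_sym[OF g1 A heis_frame_tangent[OF that(2) A] heis_frame_tangent[OF that(1) A]])
  have X: "heis_frame 0 = X" "heis_frame 1 = Y" "heis_frame 2 = Z" by (simp_all add: heis_frame_def numeral_2_eq_2)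
  have s: "g1 A (Y A) (X A) = 0" "g1 A (Z A) (X A) = 0" "g1 A (Z A) (Y A) = 0"
    using sym[of 0 1] sym[of 0 2] sym[of 1 2] g1_orthogonal[OF A] unfolding X by simp_all
  show ?thesis
    using assms(2,3) unfolding less3
    by (elim disjE; simp only: X sq_length_def) (simp_all add: s g1_orthogonal[OF A] g1_lengths[OF A])
qed

lemma g2_torus_frame:
  assumes w: "w \<in> torus3" and "j < 3" "k < 3"
  shows "g2 w (torus_frame j w) (torus_frame k w) = (if j = k then 1 else 0)"
proof -
  have f: "torus_frame k = \<zeta> (Suc k)" if "k < 3" for k
    using that unfolding less3 by (elim disjE) (simp_all add: torus_frame_def eval_nat_numeral)
  have "Suc j \<in> {1..3}" "Suc k \<in> {1..3}" using assms by auto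
  then show ?thesis
    using orthonormal_T w unfolding orthonormal_fields_def f[OF assms(2)] f[OF assms(3)] by simp
qed

lemma h_E:
  assumes p: "p \<in> HT" and j: "j < 6" and k: "k < 6"
  shows "h p (E j p) (E k p) = (if j = k then sq_length j else 0)"
proof -
  have p': "fst p \<in> heisenberg" "snd p \<in> torus3" using p by (auto simp: HT_def)
  note z = metric_zero[OF g1 p'(1) heis_frame_tangent[OF _ p'(1)]] metric_zero[OF g2 p'(2) torus_frame_tangent[OF _ p'(2)]]
    metric_zero[OF g1 p'(1) tangent_space_0[OF p'(1)]] metric_zero[OF g2 p'(2) tangent_space_0[OF p'(2)]]
  have j': "\<not> j < 3 \<Longrightarrow> j - 3 < 3" and k': "\<not> k < 3 \<Longrightarrow> k - 3 < 3" using j k by auto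
  show ?thesis
  proof (cases "j < 3")
    case True
    show ?thesis
    proof (cases "k < 3")
      case True
      then show ?thesis using \<open>j < 3\<close>
        by (simp add: h product_metric_def E_def lift_H_def z g1_heis_frame[OF p'(1)])
    next
      case False
      then show ?thesis using \<open>j < 3\<close> k'
        by (simp add: h product_metric_def E_def lift_H_def lift_T_def z)
    qed
  next
    case False
    show ?thesis
    proof (cases "k < 3")
      case True
      then show ?thesis using \<open>\<not> j < 3\<close> j'
        by (simp add: h product_metric_def E_def lift_H_def lift_T_def z)
    next
      case False
      then show ?thesis using \<open>\<not> j < 3\<close> j' k'
        by (auto simp: h product_metric_def E_def lift_T_def z g2_torus_frame[OF p'(2)] sq_length_def)
    qed
  qed
qed

lemma h_coord:
  assumes p: "p \<in> HT" and v: "v \<in> tangent_space HT p" and j: "j < 6"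
  shows "h p v (E j p) = c j p v * sq_length j" "h p (E j p) v = c j p v * sq_length j"
proof -
  have "h p v (E j p) = h p (\<Sum>k<6. c k p v *\<^sub>R E k p) (E j p)"
    using c_expand[OF p v] by (rule arg_cong)
  also have "\<dots> = (\<Sum>k<6. c k p v * h p (E k p) (E j p))"
    by (rule h_sum[OF p E_tangent[OF p j]]) (simp_all add: E_tangent[OF p])
  also have "\<dots> = (\<Sum>k<6. if k = j then c k p v * sq_length k else 0)"
    by (intro sum.cong) (simp_all add: h_E[OF p _ j])
  finally show 1: "h p v (E j p) = c j p v * sq_length j" using j by simp
  show "h p (E j p) v = c j p v * sq_length j"
    unfolding h_sym[OF p E_tangent[OF p j] v] by (rule 1)
qed

lemma \<xi>_tangent: "i \<in> {1..4} \<Longrightarrow> p \<in> HT \<Longrightarrow> \<xi> i p \<in> tangent_space HT p"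
  using \<xi>_left_invariant by (simp add: left_invariant_field_def vector_field_def)

text \<open>The sum of the forms \<open>\<eta>\<^sub>i\<close> is dual to \<open>Z\<close>, whose squared length is \<open>4\<close>.\<close>

lemma eta_sum:
  assumes p: "p \<in> HT" and u: "u \<in> tangent_space HT p"
  shows "(\<Sum>i=1..4. dual_form h (\<xi> i) p u) = 4 * c 2 p u"
proof -
  have "h p (\<Sum>i=1..4. 1 *\<^sub>R \<xi> i p) u = (\<Sum>i=1..4. 1 * h p (\<xi> i p) u)"
    by (rule h_sum[OF p u]) (simp_all add: \<xi>_tangent p)
  moreover have "(\<Sum>i=1..4. 1 *\<^sub>R \<xi> i p) = E 2 p" using \<xi>_sum[OF p] by (simp add: E_lifts)
  ultimately show ?thesis
    using h_coord(2)[OF p u, of 2] by (simp add: dual_form_def sq_length_def)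
qed

lemma \<phi>_linear:
  assumes "p \<in> HT" "u \<in> tangent_space HT p" "v \<in> tangent_space HT p"
  shows "\<phi> p (a *\<^sub>R u + b *\<^sub>R v) = a *\<^sub>R \<phi> p u + b *\<^sub>R \<phi> p v"
  using \<phi> assms unfolding left_invariant_endo_def by blast

lemma \<phi>_sum:
  assumes p: "p \<in> HT" and K: "finite K" and v: "\<And>k. k \<in> K \<Longrightarrow> v k \<in> tangent_space HT p"
  shows "\<phi> p (\<Sum>k\<in>K. a k *\<^sub>R v k) = (\<Sum>k\<in>K. a k *\<^sub>R \<phi> p (v k))"
  using K v
proof (induction K)
  case empty
  have "0 \<in> tangent_space HT p" using frame.tangent_subspace[OF p] by (rule subspace_0)
  then show ?case using \<phi>_linear[OF p, of 0 0 0 0] by simp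
next
  case (insert k K)
  have "(\<Sum>k\<in>K. a k *\<^sub>R v k) \<in> tangent_space HT p"
    using insert.prems frame.tangent_subspace[OF p] by (intro subspace_sum subspace_scale) auto
  then show ?case
    using insert \<phi>_linear[OF p, of "v k" "\<Sum>k\<in>K. a k *\<^sub>R v k" "a k" 1] by simp
qed

text \<open>Four orthonormal vectors in the span of the four fields \<open>Z, \<zeta>\<^sub>1, \<zeta>\<^sub>2, \<zeta>\<^sub>3\<close> have to span it. This is how
  the values of \<open>\<phi>\<close> on the \<open>\<zeta>\<^sub>j\<close>, which are only given on the \<open>\<xi>\<^sub>i\<close>, become available.\<close>

lemma span_\<xi>:
  assumes p: "p \<in> HT" and k: "2 \<le> k" "k < 6"
  shows "E k p \<in> span ((\<lambda>i. \<xi> i p) ` {1..4})"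
proof -
  let ?B = "(\<lambda>i. \<xi> i p) ` {1..4}" and ?V = "span ((\<lambda>k. E k p) ` {2..5})"
  have on: "h p (\<xi> i p) (\<xi> j p) = (if i = j then 1 else 0)" if "i \<in> {1..4}" "j \<in> {1..4}" for i j
    using \<xi>_orthonormal p that unfolding orthonormal_fields_def by blast
  have inj: "inj_on (\<lambda>i. \<xi> i p) {1..4}"
  proof (rule inj_onI)
    fix i j assume ij: "i \<in> {1..4}" "j \<in> {1..4}" "\<xi> i p = \<xi> j p"
    then show "i = j" using on[OF ij(1,2)] on[OF ij(1,1)] by (auto split: if_splits)
  qed
  have "independent ?B"
    unfolding dependent_finite[OF finite_imageI[OF finite_atLeastAtMost]]
  proof (rule notI)
    assume "\<exists>u. (\<exists>v\<in>?B. u v \<noteq> 0) \<and> (\<Sum>v\<in>?B. u v *\<^sub>R v) = 0"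
    then obtain u i where i: "i \<in> {1..4}" and u: "u (\<xi> i p) \<noteq> 0" and s: "(\<Sum>v\<in>?B. u v *\<^sub>R v) = 0"
      by blast
    have "0 = h p (\<Sum>j=1..4. u (\<xi> j p) *\<^sub>R \<xi> j p) (\<xi> i p)"
      using s h_linear[OF p \<xi>_tangent[OF i p] \<xi>_tangent[OF i p] \<xi>_tangent[OF i p], of 0 0]
      unfolding sum.reindex[OF inj] by simp
    also have "\<dots> = (\<Sum>j=1..4. u (\<xi> j p) * h p (\<xi> j p) (\<xi> i p))"
      by (rule h_sum[OF p \<xi>_tangent[OF i p]]) (simp_all add: \<xi>_tangent p)
    also have "\<dots> = (\<Sum>j=1..4. if j = i then u (\<xi> j p) else 0)"
      using on[OF _ i] by (intro sum.cong) (simp_all del: One_nat_def atLeastAtMost_iff)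
    also have "\<dots> = u (\<xi> i p)" using i by simp
    finally show False using u by simp
  qed
  moreover have "?B \<subseteq> ?V"
  proof (rule image_subsetI)
    fix i :: nat assume i: "i \<in> {1..4}"
    have three: "{1..3} = {1, 2, 3::nat}" by auto
    obtain d :: "nat \<Rightarrow> real" where "\<xi> i p = d 0 *\<^sub>R lift_H Z p + (\<Sum>j=1..3. d j *\<^sub>R lift_T (\<zeta> j) p)"
      using \<xi>_span[OF i] p by blast
    also have "\<dots> = d 0 *\<^sub>R E 2 p + (d 1 *\<^sub>R E 3 p + d 2 *\<^sub>R E 4 p + d 3 *\<^sub>R E 5 p)"
      unfolding three by (simp add: E_lifts add.assoc)
    also have "\<dots> \<in> ?V"
      by (intro span_add span_scale span_base imageI) simp_all
    finally show "\<xi> i p \<in> ?V" .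
  qed
  moreover have "dim ?V \<le> card ?B"
  proof -
    have "dim ?V \<le> card ((\<lambda>k. E k p) ` {2..5})" unfolding dim_span by (rule dim_le_card') simp
    also have "\<dots> \<le> card {2..5::nat}" by (rule card_image_le) simp
    also have "\<dots> = card ?B" using card_image[OF inj] by simp
    finally show ?thesis .
  qed
  ultimately have "?V \<subseteq> span ?B" using card_ge_dim_independent[of ?B ?V] by blast
  moreover have "E k p \<in> ?V" using k by (intro span_base imageI) simp
  ultimately show ?thesis by blast
qed

lemma \<phi>_E:
  assumes p: "p \<in> HT"
  shows "\<phi> p (E 0 p) = E 1 p" "\<phi> p (E 1 p) = - E 0 p" "2 \<le> k \<Longrightarrow> k < 6 \<Longrightarrow> \<phi> p (E k p) = 0"
proof -
  show "\<phi> p (E 0 p) = E 1 p" "\<phi> p (E 1 p) = - E 0 p" using \<phi>_values(1,2)[OF p] by (simp_all only: E_lifts)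
  let ?N = "{v \<in> tangent_space HT p. \<phi> p v = 0}"
  note T = frame.tangent_subspace[OF p]
  have "subspace ?N"
    unfolding subspace_def
  proof (intro conjI ballI allI)
    show "0 \<in> ?N" using subspace_0[OF T] \<phi>_linear[OF p subspace_0[OF T] subspace_0[OF T], of 0 0] by simp
    fix u assume u: "u \<in> ?N"
    show "a *\<^sub>R u \<in> ?N" for a
      using u T \<phi>_linear[OF p, of u u a 0] by (simp add: subspace_scale)
    fix v assume "v \<in> ?N"
    then show "u + v \<in> ?N" using u T \<phi>_linear[OF p, of u v 1 1] by (simp add: subspace_add)
  qed
  moreover have "(\<lambda>i. \<xi> i p) ` {1..4} \<subseteq> ?N" using \<phi>_values(3)[OF p] \<xi>_tangent[OF _ p] by blast
  ultimately have "span ((\<lambda>i. \<xi> i p) ` {1..4}) \<subseteq> ?N" by (intro span_minimal)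
  then show "2 \<le> k \<Longrightarrow> k < 6 \<Longrightarrow> \<phi> p (E k p) = 0" using span_\<xi>[OF p] by blast
qed

text \<open>The factor is the squared length \<open>1/2\<close> of \<open>X\<close> and \<open>Y\<close>.\<close>

lemma fundamental_form_coord:
  assumes p: "p \<in> HT" and u: "u \<in> tangent_space HT p" and v: "v \<in> tangent_space HT p"
  shows "fundamental_form h \<phi> p u v = (c 0 p v * c 1 p u - c 1 p v * c 0 p u) / 2"
proof -
  have E: "E 0 p \<in> tangent_space HT p" "E 1 p \<in> tangent_space HT p" using E_tangent[OF p] by simp_all
  have "\<phi> p v = \<phi> p (\<Sum>k<6. c k p v *\<^sub>R E k p)" using c_expand[OF p v] by (rule arg_cong)
  also have "\<dots> = (\<Sum>k<6. c k p v *\<^sub>R \<phi> p (E k p))" by (rule \<phi>_sum[OF p]) (simp_all add: E_tangent[OF p])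
  also have "\<dots> = c 0 p v *\<^sub>R E 1 p + (- c 1 p v) *\<^sub>R E 0 p"
    unfolding sum_lessThan_6 using \<phi>_E[OF p] by simp
  finally have \<phi>v: "\<phi> p v = c 0 p v *\<^sub>R E 1 p + (- c 1 p v) *\<^sub>R E 0 p" .
  have "fundamental_form h \<phi> p u v = h p (\<phi> p v) u"
    unfolding fundamental_form_def using \<phi> p v h_sym[OF p u] by (auto simp: left_invariant_endo_def)
  also have "\<dots> = c 0 p v * h p (E 1 p) u + (- c 1 p v) * h p (E 0 p) u"
    unfolding \<phi>v by (rule h_linear[OF p E(2,1) u])
  finally show ?thesis
    using h_coord(2)[OF p u, of 0] h_coord(2)[OF p u, of 1] by (simp add: sq_length_def)
qed

lemma torsion_coord:
  assumes p: "p \<in> HT" and u: "u \<in> tangent_space HT p" and v: "v \<in> tangent_space HT p"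
    and w: "w \<in> tangent_space HT p"
  shows "torsion_form h \<phi> \<xi> p u v w =
    4 * (c 2 p u * (c 0 p w * c 1 p v - c 1 p w * c 0 p v)
       - c 2 p v * (c 0 p w * c 1 p u - c 1 p w * c 0 p u)
       + c 2 p w * (c 0 p v * c 1 p u - c 1 p v * c 0 p u))"
  unfolding torsion_form_def wedge_1_2_def eta_sum[OF p u] eta_sum[OF p v] eta_sum[OF p w]
    fundamental_form_coord[OF p v w] fundamental_form_coord[OF p u w] fundamental_form_coord[OF p u v]
  by (simp add: field_simps)

lemma bracket_heis_frame:
  assumes A: "A \<in> heisenberg" and i: "i < 3" and j: "j < 3"
  shows "heis_frame i A ** heis_frame j (mat 1) - heis_frame j A ** heis_frame i (mat 1) = struct_const i j *\<^sub>R heis_frame 2 A"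
proof -
  have br: "lie_bracket heisenberg (heis_frame i) (heis_frame j) A = heis_frame i A ** heis_frame j (mat 1) - heis_frame j A ** heis_frame i (mat 1)"
    if "i < 3" "j < 3" for i j
    by (rule lie_bracket_translates[OF bounded_bilinear_matrix_mult heis_frame_eq[OF that(1)] heis_frame_eq[OF that(2)]
          heis_frame_tangent[OF that(1) A] heis_frame_tangent[OF that(2) A]])
  have X: "heis_frame 0 = X" "heis_frame 1 = Y" "heis_frame 2 = Z" by (simp_all add: heis_frame_def numeral_2_eq_2)
  have b: "heis_frame 0 A ** heis_frame 1 (mat 1) - heis_frame 1 A ** heis_frame 0 (mat 1) = heis_frame 2 A"
    "heis_frame 0 A ** heis_frame 2 (mat 1) - heis_frame 2 A ** heis_frame 0 (mat 1) = 0"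
    "heis_frame 1 A ** heis_frame 2 (mat 1) - heis_frame 2 A ** heis_frame 1 (mat 1) = 0"
    using br[of 0 1] br[of 0 2] br[of 1 2] brackets[OF A] unfolding X by simp_all
  then have "heis_frame 1 A ** heis_frame 0 (mat 1) - heis_frame 0 A ** heis_frame 1 (mat 1) = - heis_frame 2 A"
    "heis_frame 2 A ** heis_frame 0 (mat 1) - heis_frame 0 A ** heis_frame 2 (mat 1) = 0"
    "heis_frame 2 A ** heis_frame 1 (mat 1) - heis_frame 1 A ** heis_frame 2 (mat 1) = 0"
    by (simp_all add: algebra_simps)
  with b i j show ?thesis
    unfolding less3 struct_const_def by (elim disjE) (simp_all del: One_nat_def)
qed

lemma bracket_E:
  assumes p: "p \<in> HT" and i: "i < 6" and j: "j < 6"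
  shows "lie_bracket HT (E i) (E j) p = struct_const i j *\<^sub>R E 2 p"
proof -
  have p': "fst p \<in> heisenberg" "snd p \<in> torus3" using p by (auto simp: HT_def)
  have br: "lie_bracket HT (E i) (E j) p = HT_mult (E i p) (frame_at_one j) - HT_mult (E j p) (frame_at_one i)"
    by (rule lie_bracket_translates[OF bounded_bilinear_HT_mult E_eq[OF _ i] E_eq[OF _ j]
          E_tangent[OF p i] E_tangent[OF p j]])
  note zero = bounded_bilinear.zero_right[OF bounded_bilinear_matrix_mult]
    bounded_bilinear.zero_left[OF bounded_bilinear_matrix_mult]
  have E2: "E 2 p = (heis_frame 2 (fst p), 0)" by (simp add: E_def lift_H_def)
  show ?thesis
  proof (cases "i < 3 \<and> j < 3")
    case True
    then have "lie_bracket HT (E i) (E j) p =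
        (heis_frame i (fst p) ** heis_frame j (mat 1) - heis_frame j (fst p) ** heis_frame i (mat 1), 0)"
      unfolding br by (simp add: E_def frame_at_one_def HT_mult_def lift_H_def)
    then show ?thesis using True by (simp add: bracket_heis_frame[OF p'(1)] E2)
  next
    case False
    then have C0: "struct_const i j = 0" by (auto simp: struct_const_def)
    consider "i < 3" "\<not> j < 3" | "\<not> i < 3" "j < 3" | "\<not> i < 3" "\<not> j < 3" using False by blast
    then show ?thesis
    proof cases
      case 3
      have "torus_frame (i - 3) (snd p) * torus_frame (j - 3) 1 = torus_frame (j - 3) (snd p) * torus_frame (i - 3) 1"
        using torus_frame_eq[OF _ p'(2), of "i - 3"] torus_frame_eq[OF _ p'(2), of "j - 3"] i j 3 by (simp add: ac_simps)
      then show ?thesis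
        unfolding br C0 using 3 by (simp add: E_def frame_at_one_def HT_mult_def lift_T_def zero zero_prod_def)
    qed (unfold br C0, simp_all add: E_def frame_at_one_def HT_mult_def lift_T_def lift_H_def zero zero_prod_def)
  qed
qed

end

section \<open>The connection with skew-symmetric torsion\<close>

context heisenberg_torus_structure
begin

lemma nabla_h_affine: "affine_connection HT nabla_h"
  and nabla_h_torsion_free: "vector_field HT U \<Longrightarrow> vector_field HT V \<Longrightarrow> p \<in> HT \<Longrightarrow>
    nabla_h U V p - nabla_h V U p = lie_bracket HT U V p"
  and nabla_h_metric: "vector_field HT U \<Longrightarrow> vector_field HT V \<Longrightarrow> vector_field HT W \<Longrightarrow> p \<in> HT \<Longrightarrow>
    tangent_deriv HT (\<lambda>q. h q (V q) (W q)) p (U p) = h p (nabla_h U V p) (W p) + h p (V p) (nabla_h U W p)"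
  using nabla_h unfolding levi_civita_def by blast+

lemma nabla_h_field: "vector_field HT U \<Longrightarrow> vector_field HT V \<Longrightarrow> vector_field HT (nabla_h U V)"
  using nabla_h_affine unfolding affine_connection_def by blast

text \<open>The torsion-free connection gives smoothness and tangency of the bracket without computing
  it.\<close>

lemma lie_bracket_field:
  assumes "vector_field HT U" "vector_field HT V"
  shows "vector_field HT (lie_bracket HT U V)"
  by (rule vector_field_cong[OF frame.diff_field[OF nabla_h_field[OF assms] nabla_h_field[OF assms(2,1)]]])
     (rule nabla_h_torsion_free[OF assms])

text \<open>The Koszul formula. Inner products of frame fields are constant, so only the three brackets
  remain, and a bracket has a component along \<open>Z\<close> only.\<close>

lemma nabla_h_E:
  assumes p: "p \<in> HT" and i: "i < 6" and j: "j < 6" and k: "k < 6"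
  shows "h p (nabla_h (E i) (E j) p) (E k p) =
    2 * (if k = 2 then struct_const i j else 0) - 2 * (if j = 2 then struct_const i k else 0) - 2 * (if i = 2 then struct_const j k else 0)"
proof -
  have T: "nabla_h (E i) (E j) p \<in> tangent_space HT p" if "i < 6" "j < 6" for i j
    using nabla_h_field[OF E_field[OF that(1)] E_field[OF that(2)]] p by (rule vector_fieldD)
  have skew: "h p (nabla_h (E i) (E j) p) (E k p) = - h p (nabla_h (E i) (E k) p) (E j p)"
    if "i < 6" "j < 6" "k < 6" for i j k
  proof -
    have "tangent_deriv HT (\<lambda>q. h q (E j q) (E k q)) p (E i p) = 0"
      by (rule tangent_deriv_const[OF E_tangent[OF p that(1)]]) (rule h_E[OF _ that(2,3)])
    then show ?thesis
      using nabla_h_metric[OF E_field[OF that(1)] E_field[OF that(2)] E_field[OF that(3)] p]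
        h_sym[OF p E_tangent[OF p that(2)] T[OF that(1,3)]] by simp
  qed
  have tors: "h p (nabla_h (E i) (E j) p) (E k p) - h p (nabla_h (E j) (E i) p) (E k p) = (if k = 2 then 4 * struct_const i j else 0)"
    if "i < 6" "j < 6" "k < 6" for i j k
  proof -
    have "h p (1 *\<^sub>R nabla_h (E i) (E j) p + (-1) *\<^sub>R nabla_h (E j) (E i) p) (E k p) =
      1 * h p (nabla_h (E i) (E j) p) (E k p) + (-1) * h p (nabla_h (E j) (E i) p) (E k p)"
      by (rule h_linear[OF p T[OF that(1,2)] T[OF that(2,1)] E_tangent[OF p that(3)]])
    moreover have "1 *\<^sub>R nabla_h (E i) (E j) p + (-1) *\<^sub>R nabla_h (E j) (E i) p = struct_const i j *\<^sub>R E 2 p + 0 *\<^sub>R E 2 p"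
      using nabla_h_torsion_free[OF E_field[OF that(1)] E_field[OF that(2)] p] bracket_E[OF p that(1,2)] by simp
    moreover have "h p (struct_const i j *\<^sub>R E 2 p + 0 *\<^sub>R E 2 p) (E k p) = struct_const i j * h p (E 2 p) (E k p) + 0 * h p (E 2 p) (E k p)"
      by (rule h_linear[OF p _ _ E_tangent[OF p that(3)]]) (simp_all add: E_tangent[OF p])
    ultimately show ?thesis using h_E[OF p _ that(3), of 2] by (cases "k = 2") (simp_all add: sq_length_def)
  qed
  show ?thesis
    using skew[OF i j k] skew[OF j i k] skew[OF k i j]
      tors[OF i j k] tors[OF i k j] tors[OF j k i]
    by (simp split: if_splits)
qed

lemma nabla_field: "vector_field HT U \<Longrightarrow> vector_field HT V \<Longrightarrow> vector_field HT (nabla U V)"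
  using nabla unfolding affine_connection_def by blast

text \<open>Of the three terms of the Koszul formula the torsion form cancels the two in which \<open>Z\<close> is the
  second or third argument, and doubles the one in which it is the first.\<close>

lemma nabla_E_coord:
  assumes p: "p \<in> HT" and i: "i < 6" and j: "j < 6" and k: "k < 6"
  shows "c k p (nabla (E i) (E j) p) * sq_length k = (if i = 2 then - 4 * struct_const j k else 0)"
proof -
  have T: "nabla (E i) (E j) p \<in> tangent_space HT p"
    using nabla_field[OF E_field[OF i] E_field[OF j]] p by (rule vector_fieldD)
  have "c k p (nabla (E i) (E j) p) * sq_length k = h p (nabla (E i) (E j) p) (E k p)"
    using h_coord(1)[OF p T k] by simp
  also have "\<dots> = h p (nabla_h (E i) (E j) p) (E k p) + 1/2 * torsion_form h \<phi> \<xi> p (E i p) (E j p) (E k p)"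
    by (rule nabla_torsion[OF E_field[OF i] E_field[OF j] E_field[OF k] p])
  also have "\<dots> = (if i = 2 then - 4 * struct_const j k else 0)"
    unfolding nabla_h_E[OF p i j k] torsion_coord[OF p E_tangent[OF p i] E_tangent[OF p j] E_tangent[OF p k]]
    using i j k by (simp add: c_E[OF p] struct_const_def)
  finally show ?thesis .
qed

lemma nabla_E:
  assumes p: "p \<in> HT" and j: "j < 6" and i: "i < 6"
  shows "nabla (E i) (E j) p = (if i = 2 then -8 * struct_const j 1 else 0) *\<^sub>R E 1 p + (if i = 2 then -8 * struct_const j 0 else 0) *\<^sub>R E 0 p"
    (is "_ = ?v")
proof (rule frame.tangent_eqI[OF p])
  show "nabla (E i) (E j) p \<in> tangent_space HT p"
    using nabla_field[OF E_field[OF i] E_field[OF j]] p by (rule vector_fieldD)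
  show "?v \<in> tangent_space HT p"
    using frame.tangent_subspace[OF p] E_tangent[OF p, of 0] E_tangent[OF p, of 1]
    by (simp add: subspace_add subspace_scale)
  fix k :: nat assume k: "k < 6"
  have "c k p ?v = (if i = 2 then -8 * struct_const j 1 else 0) * c k p (E 1 p) + (if i = 2 then -8 * struct_const j 0 else 0) * c k p (E 0 p)"
    by (simp only: linear_add[OF c_linear] linear_cmul[OF c_linear] real_scaleR_def)
  moreover consider "k = 0" | "k = 1" | "2 \<le> k" by linarith
  then have "c k p (nabla (E i) (E j) p) = (if i = 2 then -8 * struct_const j 1 else 0) * (if 1 = k then 1 else 0)
      + (if i = 2 then -8 * struct_const j 0 else 0) * (if 0 = k then 1 else 0)"
  proof cases
    case 3
    then have "struct_const j k = 0" "sq_length k \<noteq> 0" by (auto simp: struct_const_def sq_length_def)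
    then show ?thesis using nabla_E_coord[OF p i j k] 3 by (simp split: if_splits)
  qed (use nabla_E_coord[OF p i j k] in \<open>cases "i = 2"; simp add: sq_length_def\<close>)+
  ultimately show "c k p (nabla (E i) (E j) p) = c k p ?v"
    using c_E[OF p _ k, of 0] c_E[OF p _ k, of 1] by simp
qed

definition rotation_form :: "ambient \<Rightarrow> ambient \<Rightarrow> real" where
  "rotation_form p v = -8 * c 2 p v"

lemma framed_connection_nabla: "framed_connection HT E 6 c nabla"
  using moving_frame_E nabla by (simp add: framed_connection_def framed_connection_axioms_def)

text \<open>The connection rotates the plane of \<open>X\<close> and \<open>Y\<close>. The factor \<open>-8\<close> of \<open>rotation_form\<close> is the
  coefficient \<open>-4\<close> of the previous computation divided by the squared length \<open>1/2\<close>.\<close>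

lemma nabla_frame:
  assumes U: "vector_field HT U" and p: "p \<in> HT" and j: "j < 6"
  shows "nabla U (E j) p = (rotation_form p (U p) * struct_const j 1) *\<^sub>R E 1 p + (rotation_form p (U p) * struct_const j 0) *\<^sub>R E 0 p"
proof -
  have "nabla U (E j) p = (\<Sum>i<6. c i p (U p) *\<^sub>R nabla (E i) (E j) p)"
    by (rule framed_connection.conn_expand_left[OF framed_connection_nabla U E_field[OF j] p])
  then show ?thesis
    by (simp add: sum_lessThan_6 nabla_E[OF p j] rotation_form_def algebra_simps)
qed

lemma rotating_connection_nabla: "rotating_connection HT E 6 c nabla rotation_form"
proof (rule rotating_connection.intro[OF framed_connection_nabla], unfold_locales)
  fix U p assume U: "vector_field HT U" and p: "p \<in> HT"
  show "nabla U (E 0) p = rotation_form p (U p) *\<^sub>R E 1 p" "nabla U (E 1) p = - rotation_form p (U p) *\<^sub>R E 0 p"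
    using nabla_frame[OF U p, of 0] nabla_frame[OF U p, of 1] by (simp_all add: struct_const_def)
  show "nabla U (E k) p = 0" if "2 \<le> k" "k < 6" for k
    using nabla_frame[OF U p that(2)] that(1) by (simp add: struct_const_def)
next
  fix U assume U: "vector_field HT U"
  show "smooth_map HT (\<lambda>q. rotation_form q (U q))"
    unfolding rotation_form_def by (intro smooth_map_mult smooth_map_const c_smooth U)
qed simp

lemma rotating_connection_brackets_nabla: "rotating_connection_brackets HT E 6 c nabla rotation_form"
  by (intro rotating_connection_brackets.intro rotating_connection_nabla
      rotating_connection_brackets_axioms.intro lie_bracket_field)

end

sublocale heisenberg_torus_structure \<subseteq> rotating_connection_brackets HT E 6 c nabla rotation_form
  by (rule rotating_connection_brackets_nabla)

context heisenberg_torus_structure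
begin

text \<open>The \<open>Z\<close>-component of the bracket is obtained from the torsion of \<open>nabla\<close>: since \<open>nabla\<close> keeps \<open>Z\<close>
  parallel, that component is \<open>U(v\<^sub>Z) - V(u\<^sub>Z)\<close> up to a multiple of the torsion form on \<open>U, V, Z\<close>.\<close>

lemma bracket_coord:
  assumes U: "vector_field HT U" and V: "vector_field HT V" and p: "p \<in> HT"
  shows "c 2 p (lie_bracket HT U V p) =
    tangent_deriv HT (\<lambda>q. c 2 q (V q)) p (U p) - tangent_deriv HT (\<lambda>q. c 2 q (U q)) p (V p)
    + (c 0 p (U p) * c 1 p (V p) - c 1 p (U p) * c 0 p (V p))"
proof -
  note Up = vector_fieldD(2)[OF U p] and Vp = vector_fieldD(2)[OF V p]
  have E2: "vector_field HT (E 2)" by (rule E_field) simp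
  note E2p = vector_fieldD(2)[OF E2 p]
  have c2: "4 * c 2 p (nabla_h U V p) = 4 * tangent_deriv HT (\<lambda>q. c 2 q (V q)) p (U p)
      - 2 * (c 0 p (V p) * c 1 p (U p) - c 1 p (V p) * c 0 p (U p))"
    if U: "vector_field HT U" and V: "vector_field HT V" for U V
  proof -
    note Up = vector_fieldD(2)[OF U p] and Vp = vector_fieldD(2)[OF V p]
    have "h p (nabla U V p) (E 2 p) = h p (nabla_h U V p) (E 2 p) + 1/2 * torsion_form h \<phi> \<xi> p (U p) (V p) (E 2 p)"
      by (rule nabla_torsion[OF U V E2 p])
    then show ?thesis
      unfolding torsion_coord[OF p Up Vp E2p]
      using h_coord(1)[OF p vector_fieldD(2)[OF nabla_field[OF U V] p], of 2]
        h_coord(1)[OF p vector_fieldD(2)[OF nabla_h_field[OF U V] p], of 2]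
        coord_conn_cases(3)[OF U V p, of 2]
      by (simp add: sq_length_def c_E[OF p] field_simps)
  qed
  have "c 2 p (lie_bracket HT U V p) = c 2 p (nabla_h U V p) - c 2 p (nabla_h V U p)"
    unfolding nabla_h_torsion_free[OF U V p, symmetric] by (rule linear_diff[OF c_linear])
  then show ?thesis using c2[OF U V] c2[OF V U] by (simp add: algebra_simps)
qed

lemma d\<omega>_area:
  assumes U: "vector_field HT U" and V: "vector_field HT V" and p: "p \<in> HT"
  shows "d\<omega> U V p = 8 * (c 0 p (U p) * c 1 p (V p) - c 1 p (U p) * c 0 p (V p))"
proof -
  have "tangent_deriv HT (\<lambda>q. rotation_form q (V q)) p (U p) = -8 * tangent_deriv HT (\<lambda>q. c 2 q (V q)) p (U p)"
    if U: "vector_field HT U" and V: "vector_field HT V" for U V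
    unfolding rotation_form_def
    using tangent_deriv_mult[OF smooth_map_const c_smooth[OF V] vector_fieldD(2)[OF U p], of "-8" 2]
      tangent_deriv_const[OF vector_fieldD(2)[OF U p], of "\<lambda>_. -8" "-8::real"] by simp
  from this[OF U V] this[OF V U] show ?thesis
    unfolding d\<omega>_def rotation_form_def[of p] bracket_coord[OF U V p] by simp
qed

text \<open>The curve \<open>exp (a x) exp (b y)\<close>, translated to \<open>p\<close>, is closed as soon as \<open>a\<close> and \<open>b\<close> vanish at the
  ends. Its velocity has \<open>Z\<close>-component \<open>a' b\<close>, so that \<open>\<omega>\<close> integrates to \<open>-8\<close> times the area \<open>\<integral> a' b\<close>
  enclosed by the curve in the \<open>(a,b)\<close>-plane.\<close>

lemma turning_loop_exists:
  assumes p: "p \<in> HT"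
  shows "\<exists>\<gamma>. turning_loop p \<theta> \<gamma>"
proof -
  have p': "fst p \<in> heisenberg" "snd p \<in> torus3" using p by (auto simp: HT_def)
  let ?x = "heis_frame 0 (mat 1)" and ?y = "heis_frame 1 (mat 1)" and ?z = "heis_frame 2 (mat 1)"
  have su: "strictly_upper ?x" "strictly_upper ?y"
    using tangent_heisenberg_strictly_upper[OF heis_frame_tangent[OF _ mat1_heisenberg]] by simp_all
  have z: "?x ** ?y - ?y ** ?x = ?z"
    using bracket_heis_frame[OF mat1_heisenberg, of 0 1] heis_frame_eq[OF _ mat1_heisenberg] by (simp add: struct_const_def)
  \<comment> \<open>With \<open>\<rho> = 1\<close> the integral of \<open>a' b\<close> is \<open>1/30\<close>, hence the turning angle is \<open>-8/30\<close>.\<close>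
  define \<rho> where "\<rho> = - 30 / 8 * \<theta>"
  define a where "a t = \<rho> * (t * (1 - t))" for t :: real
  define b where "b t = t * (1 - t) * (1 - 2 * t)" for t :: real
  define a' where "a' t = \<rho> * (1 - 2 * t)" for t :: real
  define b' where "b' t = 1 - 6 * t + 6 * t\<^sup>2" for t :: real
  \<comment> \<open>The primitive of \<open>- 8 a' b = - 8 \<rho> (t - 5 t\<^sup>2 + 8 t\<^sup>3 - 4 t\<^sup>4)\<close>.\<close>
  define \<Theta> where "\<Theta> t = - 8 * \<rho> * (t\<^sup>2 / 2 - 5 * t ^ 3 / 3 + 2 * t ^ 4 - 4 * t ^ 5 / 5)" for t :: real
  define \<Phi> where "\<Phi> t = heis_loop ?x ?y (a t) (b t)" for t
  define \<gamma> where "\<gamma> t = HT_mult p (\<Phi> t, 1)" for t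
  have da: "(a has_real_derivative a' t) (at t)" for t
    unfolding a_def a'_def by (auto intro!: derivative_eq_intros simp: algebra_simps)
  have db: "(b has_real_derivative b' t) (at t)" for t
    unfolding b_def b'_def by (auto intro!: derivative_eq_intros simp: algebra_simps power2_eq_square)
  have d\<Theta>: "(\<Theta> has_real_derivative - 8 * (a' t * b t)) (at t)" for t
    unfolding \<Theta>_def a'_def b_def
    by (auto intro!: derivative_eq_intros simp: algebra_simps eval_nat_numeral)
  have d\<Phi>: "(\<Phi> has_vector_derivative \<Phi> t ** (a' t *\<^sub>R ?x + b' t *\<^sub>R ?y + (a' t * b t) *\<^sub>R ?z)) (at t)" for t
    unfolding \<Phi>_def using heis_loop_derivative[OF su da db, of t] unfolding z .
  have \<Phi>: "\<Phi> t \<in> heisenberg" for t unfolding \<Phi>_def by (rule heis_loop_in[OF su])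
  have \<gamma>HT: "\<gamma> t \<in> HT" for t
    using p' \<Phi>[of t] by (simp add: \<gamma>_def HT_def HT_mult_def heisenberg_mult)
  have d\<gamma>: "(\<gamma> has_vector_derivative a' t *\<^sub>R E 0 (\<gamma> t) + b' t *\<^sub>R E 1 (\<gamma> t) + (a' t * b t) *\<^sub>R E 2 (\<gamma> t)) (at t)" for t
  proof -
    have "((\<lambda>t. (\<Phi> t, 1)) has_vector_derivative
        (\<Phi> t ** (a' t *\<^sub>R ?x + b' t *\<^sub>R ?y + (a' t * b t) *\<^sub>R ?z), 0)) (at t)"
      by (intro has_vector_derivative_Pair d\<Phi> has_vector_derivative_const)
    from bounded_linear.has_vector_derivative[OF bounded_bilinear.bounded_linear_right[OF bounded_bilinear_HT_mult] this]
    have "(\<gamma> has_vector_derivative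
        HT_mult p (\<Phi> t ** (a' t *\<^sub>R ?x + b' t *\<^sub>R ?y + (a' t * b t) *\<^sub>R ?z), 0)) (at t)"
      unfolding \<gamma>_def[abs_def] .
    also have "HT_mult p (\<Phi> t ** (a' t *\<^sub>R ?x + b' t *\<^sub>R ?y + (a' t * b t) *\<^sub>R ?z), 0) =
        HT_mult (\<gamma> t) (a' t *\<^sub>R frame_at_one 0 + b' t *\<^sub>R frame_at_one 1 + (a' t * b t) *\<^sub>R frame_at_one 2)"
      by (simp add: \<gamma>_def HT_mult_def frame_at_one_def matrix_mul_assoc)
    also have "\<dots> = a' t *\<^sub>R E 0 (\<gamma> t) + b' t *\<^sub>R E 1 (\<gamma> t) + (a' t * b t) *\<^sub>R E 2 (\<gamma> t)"
      by (simp add: E_eq[OF \<gamma>HT] bounded_bilinear.add_right[OF bounded_bilinear_HT_mult]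
          bounded_bilinear.scaleR_right[OF bounded_bilinear_HT_mult])
    finally show ?thesis .
  qed
  have T: "a' t *\<^sub>R E 0 (\<gamma> t) + b' t *\<^sub>R E 1 (\<gamma> t) + (a' t * b t) *\<^sub>R E 2 (\<gamma> t) \<in> tangent_space HT (\<gamma> t)" for t
    using frame.tangent_subspace[OF \<gamma>HT] E_tangent[OF \<gamma>HT] by (simp add: subspace_add subspace_scale)
  have l: "rotation_form (\<gamma> t) (a' t *\<^sub>R E 0 (\<gamma> t) + b' t *\<^sub>R E 1 (\<gamma> t) + (a' t * b t) *\<^sub>R E 2 (\<gamma> t)) = - 8 * (a' t * b t)" for t
    by (simp add: rotation_form_def linear_add[OF c_linear] linear_cmul[OF c_linear] c_E[OF \<gamma>HT])
  have "smooth_map {0..1} \<gamma>"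
  proof -
    have sm: "smooth_map {0..1} a" "smooth_map {0..1} b"
      unfolding a_def b_def
      by (intro smooth_map_mult smooth_map_minus smooth_map_const smooth_map_bounded_linear[OF bounded_linear_ident])+
    have "smooth_map {0..1} (\<lambda>t. mat 1 + a t *\<^sub>R ?x + b t *\<^sub>R ?y + (1/2 * (a t * a t)) *\<^sub>R (?x ** ?x)
        + (a t * b t) *\<^sub>R (?x ** ?y) + (1/2 * (b t * b t)) *\<^sub>R (?y ** ?y))"
      by (intro smooth_map_add smooth_map_scaleR smooth_map_mult smooth_map_const sm)
    then have "smooth_map {0..1} \<Phi>"
      by (rule smooth_map_cong) (simp add: \<Phi>_def heis_loop_def power2_eq_square)
    then have "smooth_map {0..1} (\<lambda>t. (\<Phi> t, 0) + (0, 1 :: complex^3))"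
      by (intro smooth_map_add smooth_map_const smooth_map_linear_comp[where L = "\<lambda>A. (A, 0)"])
         (intro bounded_linear_Pair bounded_linear_ident bounded_linear_zero)
    from smooth_map_linear_comp[OF bounded_bilinear.bounded_linear_right[OF bounded_bilinear_HT_mult, of p] this]
    show ?thesis by (simp add: \<gamma>_def[abs_def])
  qed
  moreover have "\<gamma> 0 = p" "\<gamma> 1 = p"
    by (simp_all add: \<gamma>_def \<Phi>_def heis_loop_def a_def b_def HT_mult_def)
  ultimately have "piecewise_smooth_loop HT p \<gamma>"
    unfolding piecewise_smooth_loop_def using \<gamma>HT
    by (intro conjI exI[of _ 1] exI[of _ real]) simp_all
  moreover have "\<Theta> 0 = 0" "\<Theta> 1 = \<theta>" by (simp_all add: \<Theta>_def \<rho>_def)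
  ultimately have "turning_loop p \<theta> \<gamma>"
    unfolding turning_loop_def
    using d\<gamma> T d\<Theta> by (intro conjI exI[of _ \<Theta>] ballI bexI[OF _ T]) (simp_all only: l)
  then show ?thesis by blast
qed

lemma holonomy_and_parallel_curvature:
  "(\<forall>p\<in>HT.
      subspace (holonomy_algebra HT nabla p) \<and>
      (\<forall>A\<in>holonomy_algebra HT nabla p. \<forall>B\<in>holonomy_algebra HT nabla p.
         blinfun_commutator A B = 0) \<and>
      dim (holonomy_algebra HT nabla p) = 1 \<and>
      lie_algebra_iso (holonomy_algebra HT nabla p) blinfun_commutator so2 matrix_commutator) \<and>
   parallel_curvature HT nabla"
proof (intro conjI ballI)
  fix p assume p: "p \<in> HT"
  obtain A where A: "A \<noteq> 0" "holonomy_algebra HT nabla p = range (\<lambda>\<beta>. \<beta> *\<^sub>R A)"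
    by (rule holonomy_algebra_eq[OF p turning_loop_exists[OF p]])
  note line = line_iso_so2[OF A]
  show "subspace (holonomy_algebra HT nabla p)" by (rule line(1))
  show "dim (holonomy_algebra HT nabla p) = 1" by (rule line(3))
  show "lie_algebra_iso (holonomy_algebra HT nabla p) blinfun_commutator so2 matrix_commutator" by (rule line(4))
  fix H K assume "H \<in> holonomy_algebra HT nabla p" "K \<in> holonomy_algebra HT nabla p"
  then show "blinfun_commutator H K = 0" using line(2) by blast
qed (rule parallel_curvatureI[OF d\<omega>_area])

end

theorem theorem5p14:
  fixes X Y Z :: "real^3^3 \<Rightarrow> real^3^3"
    and \<zeta> :: "nat \<Rightarrow> complex^3 \<Rightarrow> complex^3"
    and g1 :: "real^3^3 \<Rightarrow> real^3^3 \<Rightarrow> real^3^3 \<Rightarrow> real"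
    and g2 :: "complex^3 \<Rightarrow> complex^3 \<Rightarrow> complex^3 \<Rightarrow> real"
    and h :: "ambient \<Rightarrow> ambient \<Rightarrow> ambient \<Rightarrow> real"
    and \<xi> :: "nat \<Rightarrow> ambient \<Rightarrow> ambient"
    and \<phi> :: "ambient \<Rightarrow> ambient \<Rightarrow> ambient"
    and nabla_h nabla :: "ambient conn"
  assumes frame_H: "left_invariant_frame heisenberg (**) [X, Y, Z]"
    and brackets: "\<And>p. p \<in> heisenberg \<Longrightarrow> lie_bracket heisenberg X Y p = Z p"
      "\<And>p. p \<in> heisenberg \<Longrightarrow> lie_bracket heisenberg X Z p = 0"
      "\<And>p. p \<in> heisenberg \<Longrightarrow> lie_bracket heisenberg Y Z p = 0"
    and g1: "left_invariant_metric heisenberg (**) g1"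
    and g1_orthogonal: "\<And>p. p \<in> heisenberg \<Longrightarrow>
      g1 p (X p) (Y p) = 0 \<and> g1 p (X p) (Z p) = 0 \<and> g1 p (Y p) (Z p) = 0"
    and g1_lengths: "\<And>p. p \<in> heisenberg \<Longrightarrow>
      g1 p (X p) (X p) = 1/2 \<and> g1 p (Y p) (Y p) = 1/2 \<and> g1 p (Z p) (Z p) = 4"
    and g2: "left_invariant_metric torus3 (*) g2"
    and frame_T: "left_invariant_frame torus3 (*) [\<zeta> 1, \<zeta> 2, \<zeta> 3]"
    and orthonormal_T: "orthonormal_fields torus3 g2 {1..3} \<zeta>"
    and h: "h = product_metric g1 g2"
    and \<xi>_left_invariant: "\<And>i. i \<in> {1..4} \<Longrightarrow> left_invariant_field HT HT_mult (\<xi> i)"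
    and \<xi>_span: "\<And>i. i \<in> {1..4} \<Longrightarrow> \<exists>c::nat \<Rightarrow> real. \<forall>p\<in>HT.
      \<xi> i p = c 0 *\<^sub>R lift_H Z p + (\<Sum>j=1..3. c j *\<^sub>R lift_T (\<zeta> j) p)"
    and \<xi>_orthonormal: "orthonormal_fields HT h {1..4} \<xi>"
    and \<xi>_sum: "\<And>p. p \<in> HT \<Longrightarrow> lift_H Z p = (\<Sum>i=1..4. \<xi> i p)"
    and \<phi>: "left_invariant_endo HT HT_mult \<phi>"
    and \<phi>_values: "\<And>p. p \<in> HT \<Longrightarrow> \<phi> p (lift_H X p) = lift_H Y p"
      "\<And>p. p \<in> HT \<Longrightarrow> \<phi> p (lift_H Y p) = - lift_H X p"
      "\<And>p i. p \<in> HT \<Longrightarrow> i \<in> {1..4} \<Longrightarrow> \<phi> p (\<xi> i p) = 0"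
    and nabla_h: "levi_civita HT h nabla_h"
    and nabla: "affine_connection HT nabla"
    and nabla_torsion: "\<And>U V W p. vector_field HT U \<Longrightarrow> vector_field HT V \<Longrightarrow> vector_field HT W \<Longrightarrow>
      p \<in> HT \<Longrightarrow> h p (nabla U V p) (W p) =
        h p (nabla_h U V p) (W p) + 1/2 * torsion_form h \<phi> \<xi> p (U p) (V p) (W p)"
  shows "(\<forall>p\<in>HT.
            subspace (holonomy_algebra HT nabla p) \<and>
            (\<forall>A\<in>holonomy_algebra HT nabla p. \<forall>B\<in>holonomy_algebra HT nabla p.
               blinfun_commutator A B = 0) \<and>
            dim (holonomy_algebra HT nabla p) = 1 \<and>
            lie_algebra_iso (holonomy_algebra HT nabla p) blinfun_commutator
              so2 matrix_commutator) \<and>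
         parallel_curvature HT nabla"
proof -
  interpret heisenberg_torus_structure X Y Z \<zeta> g1 g2 h \<xi> \<phi> nabla_h nabla
    by (rule heisenberg_torus_structure.intro) (fact assms)+
  show ?thesis by (rule holonomy_and_parallel_curvature)
qed

end
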